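(* Consider a large financial market, i.e. a sequence of semimartingale market models $S^n$ on $(\Omega^n,\mathcal F^n,(\mathcal F^n_t)_{t\ge 0},P^n)$, $n\in\mathbb N$, such that $M^n\cap\mathbb P^n\neq\varnothing$ for all $n\in\mathbb N$. Then the following conditions are equivalent: (i) NAMFL$(\mathbb U_2)$ (no asymptotic market free lunch with respect to $\mathbb U_2$): for every $\varepsilon>0$ and every net $\mathcal W=(w^\gamma)_{\gamma\in\Gamma}$ with $w^\gamma\in D^{\varepsilon,n_\gamma}$ ($n_\gamma\in\mathbb N$), there exist $u\in\mathbb U_2$ and a sequence $(R^n)$ with $R^n\in\mathbb P^n$ and $(R^n)\lhd\rhd(P^n)$ such that for all sequences $(w^k)_{k\in\mathbb N}\subseteq\mathcal W$ (with $w^k\in D^{\varepsilon,n_k}$, $n_k$ being the market index of the member $w^k$ of the net) $$\limsup_{k\to\infty}\ \sup_{f^k\in\mathbf C^{n_k}}E_{R^{n_k}}[u(f^k-w^k)]<u(0).$$ (ii) NAMFL$^*(\mathbb U_2)$ (uniformly no asymptotic market free lunch with respect to $\mathbb U_2$): for every $\varepsilon>0$ there exist $\delta>0$, $u\in\mathbb U_2$ and a sequence $(R^n)$ with $R^n\in\mathbb P^n$ and $(R^n)\lhd\rhd(P^n)$ such that for every sequence $(w^n)$ with $w^n\in D^{\varepsilon,n}$ for all $n$, $$\limsup_{n\to\infty}\ \sup_{f^n\in\mathbf C^n}E_{R^n}[u(f^n-w^n)]<u(0)-\delta.$$ (iii) NAFL (no asymptotic free lunch): for each $\varepsilon>0$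 there is a Young function $F\in\mathcal Y$ such that $\mathbf C^n\cap(D^{\varepsilon,n}+V^{F}(P^n))=\varnothing$ for all $n\in\mathbb N$.
   Context: Large financial market: for each $n\in\mathbb N$, $(\Omega^n,\mathcal F^n,(\mathcal F^n_t)_{t\in[0,\infty)},P^n)$ is a filtered probability space whose filtration satisfies the usual conditions, and $S^n=(S^n_t)_{t\in[0,\infty)}$ is an adapted $\mathbb R^{d(n)}$-valued semimartingale ($d(n)<\infty$). $\mathbb P^n$ is the set of probability measures on $(\Omega^n,\mathcal F^n)$ equivalent to $P^n$. A predictable $S^n$-integrable process $H$ is admissible if there is $a>0$ with $(H\cdot S^n)\ge -a$, where $H\cdot S^n$ is the stochastic integral. Define $$\mathbf K^n=\{(H\cdot S^n)_\infty: H\text{ admissible and }(H\cdot S^n)_\infty=\lim_{t\to\infty}(H\cdot S^n)_t\text{ exists a.s.}\},$$ $$\mathbf C^n=(\mathbf K^n-L^0_+(P^n))\cap L^\infty(P^n),$$ $$M^n=\{Q\ll P^n \text{ probability measure}:\ \mathbf K^n\subseteq L^1(Q)\text{ and }E_Q[f]\le 0\text{ for all }f\in\mathbf K^n\}.$$ For $\varepsilon>0$, $D^{\varepsilon,n}=\{w\in L^\infty(P^n):0\le w\le 1\text{ and }E_{P^n}[w]\ge\varepsilon\}$. $\mathbb U_2$ is the set of functions $u:\mathbb R\to\mathbb R$ that are nondecreasing and concave on $\mathbb R$ (finite-valued). Contiguity: $(R^n)\lhd(P^n)$ means that for all $A^n\in\mathcal F^n$, $P^n(A^n)\to 0$ implies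 $R^n(A^n)\to 0$. $(R^n)\lhd\rhd(P^n)$ means $(R^n)\lhd(P^n)$ and $(P^n)\lhd(R^n)$. $\mathcal Y$ is the class of Young functions: $F:[0,\infty)\to[0,\infty)$ continuously differentiable with $F(0)=F'(0)=0$, $F'$ strictly increasing and $\lim_{t\uparrow\infty}F'(t)=\infty$. For a probability measure $P$, $L_F(P)=\{f\in L^0(P):E_P[F(a|f|)]<\infty\text{ for some }a>0\}$, with norm $\|f\|_F=\inf\{a>0:E_P[F(|f|/a)]\le 1\}$; $B^F(P)=\{f\in L_F(P):\|f\|_F\le 1\}$; and $V^F(P)=\{g\in L^\infty(P):|E_P[gh]|\le 1\text{ for all }h\in B^F(P)\}$. *)

theory Defs
  imports "HOL-Probability.Probability"
begin

section \<open>Filtered probability spaces\<close>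

text \<open>
  Time is \<open>[0, \<infinity>)\<close>, encoded as \<open>real\<close> with guards \<open>0 \<le> t\<close>; values at negative times are irrelevant
  throughout.  Processes take time first, then the state of the world.  An \<open>\<real>^d\<close>-valued process is a
  family \<open>S i t \<omega>\<close> of which only the components \<open>i < d\<close> matter, so that \<open>d\<close> may vary with the market.
\<close>

type_synonym 'a process = "real \<Rightarrow> 'a \<Rightarrow> real"

definition usual_filtration :: "'a measure \<Rightarrow> (real \<Rightarrow> 'a measure) \<Rightarrow> bool" where
  "usual_filtration P F \<longleftrightarrow>
     (\<forall>t\<ge>0. subalgebra P (F t)) \<and>
     (\<forall>s t. 0 \<le> s \<longrightarrow> s \<le> t \<longrightarrow> sets (F s) \<subseteq> sets (F t)) \<and>
     (\<forall>t\<ge>0. sets (F t) = (\<Inter>s\<in>{t<..}. sets (F s))) \<and>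
     complete_measure P \<and> null_sets P \<subseteq> sets (F 0)"

definition adapted :: "(real \<Rightarrow> 'a measure) \<Rightarrow> 'a process \<Rightarrow> bool" where
  "adapted F X \<longleftrightarrow> (\<forall>t\<ge>0. X t \<in> borel_measurable (F t))"

definition cadlag :: "'a measure \<Rightarrow> 'a process \<Rightarrow> bool" where
  "cadlag P X \<longleftrightarrow> (\<forall>\<omega>\<in>space P.
     (\<forall>t\<ge>0. continuous (at_right t) (\<lambda>s. X s \<omega>)) \<and>
     (\<forall>t>0. \<exists>l. ((\<lambda>s. X s \<omega>) \<longlongrightarrow> l) (at_left t)))"

definition predictable_sigma :: "'a measure \<Rightarrow> (real \<Rightarrow> 'a measure) \<Rightarrow> (real \<times> 'a) measure" where
  "predictable_sigma P F = sigma ({0..} \<times> space P)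
     ({{0} \<times> A | A. A \<in> sets (F 0)} \<union>
      {{s<..t} \<times> A | s t A. 0 \<le> s \<and> s \<le> t \<and> A \<in> sets (F s)})"

section \<open>Semimartingales\<close>

definition martingale :: "'a measure \<Rightarrow> (real \<Rightarrow> 'a measure) \<Rightarrow> 'a process \<Rightarrow> bool" where
  "martingale P F X \<longleftrightarrow> adapted F X \<and> (\<forall>t\<ge>0. integrable P (X t)) \<and>
     (\<forall>s t. 0 \<le> s \<longrightarrow> s \<le> t \<longrightarrow> (AE \<omega> in P. real_cond_exp P (F s) (X t) \<omega> = X s \<omega>))"

text \<open>
  Localizing times may be taken finite (replace \<open>\<tau> k\<close> by \<open>min (\<tau> k) k\<close>).
\<close>

definition local_martingale :: "'a measure \<Rightarrow> (real \<Rightarrow> 'a measure) \<Rightarrow> 'a process \<Rightarrow> bool" where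
  "local_martingale P F X \<longleftrightarrow> adapted F X \<and> cadlag P X \<and>
     (\<exists>\<tau> :: nat \<Rightarrow> 'a \<Rightarrow> real.
        (\<forall>k. \<forall>\<omega>\<in>space P. 0 \<le> \<tau> k \<omega> \<and> \<tau> k \<omega> \<le> \<tau> (Suc k) \<omega>) \<and>
        (\<forall>k. \<forall>t\<ge>0. {\<omega>\<in>space P. \<tau> k \<omega> \<le> t} \<in> sets (F t)) \<and>
        (AE \<omega> in P. filterlim (\<lambda>k. \<tau> k \<omega>) at_top sequentially) \<and>
        (\<forall>k. martingale P F (\<lambda>t \<omega>. X (min t (\<tau> k \<omega>)) \<omega> - X 0 \<omega>)))"

definition finite_variation :: "'a measure \<Rightarrow> 'a process \<Rightarrow> bool" where
  "finite_variation P A \<longleftrightarrow> (\<forall>\<omega>\<in>space P. \<forall>t\<ge>0.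
     bdd_above {\<Sum>j<m. \<bar>A (s (Suc j)) \<omega> - A (s j) \<omega>\<bar> | (m :: nat) (s :: nat \<Rightarrow> real).
                  mono s \<and> range s \<subseteq> {0..t}})"

definition semimartingale :: "'a measure \<Rightarrow> (real \<Rightarrow> 'a measure) \<Rightarrow> 'a process \<Rightarrow> bool" where
  "semimartingale P F X \<longleftrightarrow> adapted F X \<and> cadlag P X \<and>
     (\<exists>N A. local_martingale P F N \<and>
            adapted F A \<and> cadlag P A \<and> finite_variation P A \<and>
            (\<forall>\<omega>\<in>space P. N 0 \<omega> = 0 \<and> A 0 \<omega> = 0 \<and> (\<forall>t\<ge>0. X t \<omega> = X 0 \<omega> + N t \<omega> + A t \<omega>)))"

section \<open>Stochastic integration\<close>

text \<open>
  The predicates below relate an \<open>\<real>^d\<close>-valued integrand \<open>H\<close> to (a version of) the integral process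
  \<open>H \<cdot> S\<close>, the integral being taken over \<open>(0, t]\<close>, so that \<open>(H \<cdot> S)\<^sub>0 = 0\<close>.
\<close>

inductive elementary_integral ::
  "(real \<Rightarrow> 'a measure) \<Rightarrow> nat \<Rightarrow> (nat \<Rightarrow> 'a process) \<Rightarrow> (nat \<Rightarrow> 'a process) \<Rightarrow> 'a process \<Rightarrow> bool"
  for F :: "real \<Rightarrow> 'a measure" and d :: nat and S :: "nat \<Rightarrow> 'a process"
where
  initial:
    "\<lbrakk>\<And>i. i < d \<Longrightarrow> Y i \<in> borel_measurable (F 0);
      \<And>i \<omega>. i < d \<Longrightarrow> \<omega> \<in> space (F 0) \<Longrightarrow> \<bar>Y i \<omega>\<bar> \<le> c\<rbrakk> \<Longrightarrow>
     elementary_integral F d S (\<lambda>i t \<omega>. if t = 0 then Y i \<omega> else 0) (\<lambda>t \<omega>. 0)"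
| step:
    "\<lbrakk>0 \<le> a; a \<le> b;
      \<And>i. i < d \<Longrightarrow> Y i \<in> borel_measurable (F a);
      \<And>i \<omega>. i < d \<Longrightarrow> \<omega> \<in> space (F a) \<Longrightarrow> \<bar>Y i \<omega>\<bar> \<le> c\<rbrakk> \<Longrightarrow>
     elementary_integral F d S (\<lambda>i t \<omega>. if a < t \<and> t \<le> b then Y i \<omega> else 0)
       (\<lambda>t \<omega>. \<Sum>i<d. Y i \<omega> * (S i (min t b) \<omega> - S i (min t a) \<omega>))"
| add:
    "\<lbrakk>elementary_integral F d S H X; elementary_integral F d S G Z\<rbrakk> \<Longrightarrow>
     elementary_integral F d S (\<lambda>i t \<omega>. H i t \<omega> + G i t \<omega>) (\<lambda>t \<omega>. X t \<omega> + Z t \<omega>)"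

definition ucp_limit :: "'a measure \<Rightarrow> (nat \<Rightarrow> 'a process) \<Rightarrow> 'a process \<Rightarrow> bool" where
  "ucp_limit P Xk X \<longleftrightarrow> (\<forall>t\<ge>0. \<forall>e>0.
     (\<lambda>k. measure P {\<omega>\<in>space P. \<exists>s\<in>{0..t}. e < \<bar>Xk k s \<omega> - X s \<omega>\<bar>}) \<longlonglongrightarrow> 0)"

definition pointwise_limit ::
  "'a measure \<Rightarrow> nat \<Rightarrow> (nat \<Rightarrow> nat \<Rightarrow> 'a process) \<Rightarrow> (nat \<Rightarrow> 'a process) \<Rightarrow> bool" where
  "pointwise_limit P d Hk H \<longleftrightarrow>
     (\<forall>i<d. \<forall>t\<ge>0. \<forall>\<omega>\<in>space P. (\<lambda>k. Hk k i t \<omega>) \<longlonglongrightarrow> H i t \<omega>)"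

text \<open>
  Integral of bounded predictable integrands: the extension of the elementary integral by dominated
  convergence.  For a semimartingale \<open>S\<close>, the monotone class theorem shows that this reaches every
  bounded predictable integrand, with an integral that is unique up to indistinguishability.
\<close>

inductive bounded_integral ::
  "'a measure \<Rightarrow> (real \<Rightarrow> 'a measure) \<Rightarrow> nat \<Rightarrow> (nat \<Rightarrow> 'a process) \<Rightarrow>
     (nat \<Rightarrow> 'a process) \<Rightarrow> 'a process \<Rightarrow> bool"
  for P :: "'a measure" and F :: "real \<Rightarrow> 'a measure" and d :: nat and S :: "nat \<Rightarrow> 'a process"
where
  elementary: "elementary_integral F d S H X \<Longrightarrow> bounded_integral P F d S H X"
| limit:
    "\<lbrakk>\<And>k. bounded_integral P F d S (Hk k) (Xk k);
      \<And>k i t \<omega>. i < d \<Longrightarrow> 0 \<le> t \<Longrightarrow> \<omega> \<in> space P \<Longrightarrow> \<bar>Hk k i t \<omega>\<bar> \<le> c;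
      pointwise_limit P d Hk H;
      adapted F X; cadlag P X; ucp_limit P Xk X\<rbrakk> \<Longrightarrow>
     bounded_integral P F d S H X"

text \<open>
  Convergence in Emery's semimartingale topology.  It suffices to test with elementary predictable
  \<open>\<theta>\<close>, \<open>\<bar>\<theta>\<bar> \<le> 1\<close>, whose integral \<open>Z\<close> against the scalar process \<open>Xk k - X\<close> is explicit.
\<close>

definition emery_limit ::
  "'a measure \<Rightarrow> (real \<Rightarrow> 'a measure) \<Rightarrow> (nat \<Rightarrow> 'a process) \<Rightarrow> 'a process \<Rightarrow> bool" where
  "emery_limit P F Xk X \<longleftrightarrow> ucp_limit P Xk X \<and>
     (\<forall>t\<ge>0. \<forall>e>0. \<forall>\<eta>>0. \<exists>k0. \<forall>k\<ge>k0. \<forall>\<theta> Z.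
        elementary_integral F 1 (\<lambda>_ t \<omega>. Xk k t \<omega> - X t \<omega>) \<theta> Z \<longrightarrow>
        (\<forall>t\<ge>0. \<forall>\<omega>\<in>space P. \<bar>\<theta> 0 t \<omega>\<bar> \<le> 1) \<longrightarrow>
        measure P {\<omega>\<in>space P. \<exists>s\<in>{0..t}. e < \<bar>Z s \<omega>\<bar>} \<le> \<eta>)"

text \<open>
  \<open>H\<close> is a predictable \<open>S\<close>-integrable process and \<open>X\<close> is a version of the vector stochastic integral
  \<open>H \<cdot> S\<close>: \<open>H\<close> is the pointwise limit of bounded predictable integrands whose integrals converge to
  \<open>X\<close> in the semimartingale topology.  For a semimartingale \<open>S\<close> the approximating sequence can always
  be taken to be the truncations \<open>H 1\<^bsub>{\<bar>H\<bar> \<le> k}\<^esub>\<close>, and \<open>X\<close> does not depend on its choice.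
\<close>

definition stochastic_integral ::
  "'a measure \<Rightarrow> (real \<Rightarrow> 'a measure) \<Rightarrow> nat \<Rightarrow> (nat \<Rightarrow> 'a process) \<Rightarrow>
     (nat \<Rightarrow> 'a process) \<Rightarrow> 'a process \<Rightarrow> bool" where
  "stochastic_integral P F d S H X \<longleftrightarrow>
     (\<forall>i<d. (\<lambda>(t, \<omega>). H i t \<omega>) \<in> borel_measurable (predictable_sigma P F)) \<and>
     adapted F X \<and> cadlag P X \<and>
     (\<exists>Hk Xk. (\<forall>k. bounded_integral P F d S (Hk k) (Xk k)) \<and>
              pointwise_limit P d Hk H \<and> emery_limit P F Xk X)"

section \<open>A single market\<close>

definition market :: "'a measure \<Rightarrow> (real \<Rightarrow> 'a measure) \<Rightarrow> nat \<Rightarrow> (nat \<Rightarrow> 'a process) \<Rightarrow> bool" where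
  "market P F d S \<longleftrightarrow> prob_space P \<and> usual_filtration P F \<and> (\<forall>i<d. semimartingale P F (S i))"

text \<open>
  Elements of \<open>L\<^sup>0\<close> and \<open>L\<^sup>\<infinity>\<close> are represented by measurable functions; all sets of such functions
  defined here are closed under almost sure equality.
\<close>

definition Linfty :: "'a measure \<Rightarrow> ('a \<Rightarrow> real) set" where
  "Linfty P = {f \<in> borel_measurable P. \<exists>c. AE \<omega> in P. \<bar>f \<omega>\<bar> \<le> c}"

definition equivalent_measures :: "'a measure \<Rightarrow> 'a measure set" where
  "equivalent_measures P =
     {Q. prob_space Q \<and> sets Q = sets P \<and> absolutely_continuous P Q \<and> absolutely_continuous Q P}"

definition K_set ::
  "'a measure \<Rightarrow> (real \<Rightarrow> 'a measure) \<Rightarrow> nat \<Rightarrow> (nat \<Rightarrow> 'a process) \<Rightarrow> ('a \<Rightarrow> real) set" where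
  "K_set P F d S = {f \<in> borel_measurable P. \<exists>H X.
     stochastic_integral P F d S H X \<and>
     (\<exists>a>0. AE \<omega> in P. \<forall>t\<ge>0. - a \<le> X t \<omega>) \<and>
     (AE \<omega> in P. ((\<lambda>t. X t \<omega>) \<longlongrightarrow> f \<omega>) at_top)}"

definition C_set ::
  "'a measure \<Rightarrow> (real \<Rightarrow> 'a measure) \<Rightarrow> nat \<Rightarrow> (nat \<Rightarrow> 'a process) \<Rightarrow> ('a \<Rightarrow> real) set" where
  "C_set P F d S = {f \<in> Linfty P. \<exists>g \<in> K_set P F d S. \<exists>l \<in> borel_measurable P.
     (AE \<omega> in P. 0 \<le> l \<omega>) \<and> (AE \<omega> in P. f \<omega> = g \<omega> - l \<omega>)}"

definition separating_measures ::
  "'a measure \<Rightarrow> (real \<Rightarrow> 'a measure) \<Rightarrow> nat \<Rightarrow> (nat \<Rightarrow> 'a process) \<Rightarrow> 'a measure set" where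
  "separating_measures P F d S = {Q. prob_space Q \<and> sets Q = sets P \<and> absolutely_continuous P Q \<and>
     (\<forall>f \<in> K_set P F d S. integrable Q f \<and> integral\<^sup>L Q f \<le> 0)}"

definition D_set :: "real \<Rightarrow> 'a measure \<Rightarrow> ('a \<Rightarrow> real) set" where
  "D_set \<epsilon> P = {w \<in> Linfty P. (AE \<omega> in P. 0 \<le> w \<omega> \<and> w \<omega> \<le> 1) \<and> \<epsilon> \<le> integral\<^sup>L P w}"

section \<open>Utility functions, contiguity, Young functions\<close>

definition U2 :: "(real \<Rightarrow> real) set" where
  "U2 = {u. mono u \<and> concave_on UNIV u}"

definition contiguous :: "(nat \<Rightarrow> 'a measure) \<Rightarrow> (nat \<Rightarrow> 'a measure) \<Rightarrow> bool" where
  "contiguous R P \<longleftrightarrow> (\<forall>A. (\<forall>n. A n \<in> sets (P n)) \<longrightarrow>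
     (\<lambda>n. measure (P n) (A n)) \<longlonglongrightarrow> 0 \<longrightarrow> (\<lambda>n. measure (R n) (A n)) \<longlonglongrightarrow> 0)"

definition bicontiguous :: "(nat \<Rightarrow> 'a measure) \<Rightarrow> (nat \<Rightarrow> 'a measure) \<Rightarrow> bool" where
  "bicontiguous R P \<longleftrightarrow> contiguous R P \<and> contiguous P R"

text \<open>Only the values of a Young function on \<open>[0, \<infinity>)\<close> are relevant.\<close>

definition young_function :: "(real \<Rightarrow> real) \<Rightarrow> bool" where
  "young_function Y \<longleftrightarrow> (\<forall>t\<ge>0. 0 \<le> Y t) \<and> Y 0 = 0 \<and>
     (\<exists>Y'. (\<forall>t\<ge>0. (Y has_real_derivative Y' t) (at t within {0..})) \<and>
           continuous_on {0..} Y' \<and> Y' 0 = 0 \<and>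
           strict_mono_on {0..} Y' \<and> filterlim Y' at_top at_top)"

text \<open>Expectations of \<open>Y (a * \<bar>f\<bar>)\<close> may be infinite and hence are taken in \<open>ennreal\<close>.\<close>

definition orlicz_space :: "(real \<Rightarrow> real) \<Rightarrow> 'a measure \<Rightarrow> ('a \<Rightarrow> real) set" where
  "orlicz_space Y P =
     {f \<in> borel_measurable P. \<exists>a>0. (\<integral>\<^sup>+\<omega>. ennreal (Y (a * \<bar>f \<omega>\<bar>)) \<partial>P) < \<infinity>}"

definition orlicz_norm :: "(real \<Rightarrow> real) \<Rightarrow> 'a measure \<Rightarrow> ('a \<Rightarrow> real) \<Rightarrow> real" where
  "orlicz_norm Y P f = Inf {a. 0 < a \<and> (\<integral>\<^sup>+\<omega>. ennreal (Y (\<bar>f \<omega>\<bar> / a)) \<partial>P) \<le> 1}"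

definition orlicz_ball :: "(real \<Rightarrow> real) \<Rightarrow> 'a measure \<Rightarrow> ('a \<Rightarrow> real) set" where
  "orlicz_ball Y P = {f \<in> orlicz_space Y P. orlicz_norm Y P f \<le> 1}"

definition orlicz_polar :: "(real \<Rightarrow> real) \<Rightarrow> 'a measure \<Rightarrow> ('a \<Rightarrow> real) set" where
  "orlicz_polar Y P =
     {g \<in> Linfty P. \<forall>h \<in> orlicz_ball Y P. \<bar>LINT \<omega>|P. g \<omega> * h \<omega>\<bar> \<le> 1}"

section \<open>The large financial market\<close>

definition directed_set :: "'g set \<Rightarrow> ('g \<Rightarrow> 'g \<Rightarrow> bool) \<Rightarrow> bool" where
  "directed_set \<Gamma> le \<longleftrightarrow> \<Gamma> \<noteq> {} \<and> (\<forall>x\<in>\<Gamma>. le x x) \<and>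
     (\<forall>x\<in>\<Gamma>. \<forall>y\<in>\<Gamma>. \<forall>z\<in>\<Gamma>. le x y \<longrightarrow> le y z \<longrightarrow> le x z) \<and>
     (\<forall>x\<in>\<Gamma>. \<forall>y\<in>\<Gamma>. \<exists>z\<in>\<Gamma>. le x z \<and> le y z)"

text \<open>
  A net consists of a directed index set \<open>\<Gamma>\<close>, market indices \<open>m \<gamma>\<close> and members \<open>w \<gamma>\<close>; a sequence in the
  net is a sequence \<open>\<gamma>\<close> of indices.  \<open>NAMFL_nets\<close> is the condition for nets whose indices are drawn
  from one type \<open>'g\<close>.  HOL cannot quantify over types inside a formula, but the type
  \<open>nat \<times> ('a \<Rightarrow> real)\<close> used in \<open>NAMFL\<close> covers nets over all index types, see \<open>NAMFL_all_nets\<close>.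
\<close>

definition NAMFL_nets ::
  "'g itself \<Rightarrow> (nat \<Rightarrow> 'a measure) \<Rightarrow> (nat \<Rightarrow> real \<Rightarrow> 'a measure) \<Rightarrow> (nat \<Rightarrow> nat) \<Rightarrow>
     (nat \<Rightarrow> nat \<Rightarrow> 'a process) \<Rightarrow> bool" where
  "NAMFL_nets (_ :: 'g itself) P F d S \<longleftrightarrow>
     (\<forall>\<epsilon>>0. \<forall>(\<Gamma> :: 'g set) le (m :: 'g \<Rightarrow> nat) w.
        directed_set \<Gamma> le \<longrightarrow> (\<forall>\<gamma>\<in>\<Gamma>. w \<gamma> \<in> D_set \<epsilon> (P (m \<gamma>))) \<longrightarrow>
        (\<exists>u\<in>U2. \<exists>R. (\<forall>n. R n \<in> equivalent_measures (P n)) \<and> bicontiguous R P \<and>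
           (\<forall>\<gamma> :: nat \<Rightarrow> 'g. range \<gamma> \<subseteq> \<Gamma> \<longrightarrow>
              limsup (\<lambda>k. SUP f \<in> C_set (P (m (\<gamma> k))) (F (m (\<gamma> k))) (d (m (\<gamma> k))) (S (m (\<gamma> k))).
                            ereal (LINT \<omega>|R (m (\<gamma> k)). u (f \<omega> - w (\<gamma> k) \<omega>)))
              < ereal (u 0))))"

definition NAMFL ::
  "(nat \<Rightarrow> 'a measure) \<Rightarrow> (nat \<Rightarrow> real \<Rightarrow> 'a measure) \<Rightarrow> (nat \<Rightarrow> nat) \<Rightarrow>
     (nat \<Rightarrow> nat \<Rightarrow> 'a process) \<Rightarrow> bool" where
  "NAMFL P F d S \<longleftrightarrow> NAMFL_nets TYPE(nat \<times> ('a \<Rightarrow> real)) P F d S"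

lemma NAMFL_all_nets:
  assumes "NAMFL P F d S"
  shows "NAMFL_nets TYPE('g) P F d S"
  unfolding NAMFL_nets_def
proof (intro allI impI, goal_cases)
  case (1 \<epsilon> \<Gamma> le m w)
  let ?\<Gamma> = "(\<lambda>\<gamma>. (m \<gamma>, w \<gamma>)) ` \<Gamma>"
  have ne: "?\<Gamma> \<noteq> {}"
    using 1(2) by (simp add: directed_set_def)
  have dir: "directed_set ?\<Gamma> (\<lambda>_ _. True)"
    unfolding directed_set_def using ne by simp
  have mem: "\<forall>p\<in>?\<Gamma>. snd p \<in> D_set \<epsilon> (P (fst p))"
    using 1(3) by simp
  have "\<exists>u\<in>U2. \<exists>R. (\<forall>n. R n \<in> equivalent_measures (P n)) \<and> bicontiguous R P \<and>
      (\<forall>p :: nat \<Rightarrow> nat \<times> ('a \<Rightarrow> real). range p \<subseteq> ?\<Gamma> \<longrightarrow>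
         limsup (\<lambda>k. SUP f \<in> C_set (P (fst (p k))) (F (fst (p k))) (d (fst (p k))) (S (fst (p k))).
                       ereal (LINT \<omega>|R (fst (p k)). u (f \<omega> - snd (p k) \<omega>))) < ereal (u 0))"
    using assms[unfolded NAMFL_def NAMFL_nets_def, THEN spec, THEN mp, OF 1(1), THEN spec, of ?\<Gamma>,
        THEN spec, of "\<lambda>_ _. True", THEN spec, of fst, THEN spec, of snd, THEN mp, OF dir, THEN mp, OF mem] .
  then obtain u R where u: "u \<in> U2" "\<forall>n. R n \<in> equivalent_measures (P n)" "bicontiguous R P"
    and lim: "\<And>p :: nat \<Rightarrow> nat \<times> ('a \<Rightarrow> real). range p \<subseteq> ?\<Gamma> \<Longrightarrow>
      limsup (\<lambda>k. SUP f \<in> C_set (P (fst (p k))) (F (fst (p k))) (d (fst (p k))) (S (fst (p k))).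
                    ereal (LINT \<omega>|R (fst (p k)). u (f \<omega> - snd (p k) \<omega>))) < ereal (u 0)"
    by blast
  show ?case
  proof (rule bexI[OF _ u(1)], rule exI[of _ R], intro conjI u(2,3) allI impI)
    fix \<gamma> :: "nat \<Rightarrow> 'g" assume "range \<gamma> \<subseteq> \<Gamma>"
    then have "range (\<lambda>k. (m (\<gamma> k), w (\<gamma> k))) \<subseteq> ?\<Gamma>" by auto
    from lim[OF this]
    show "limsup (\<lambda>k. SUP f \<in> C_set (P (m (\<gamma> k))) (F (m (\<gamma> k))) (d (m (\<gamma> k))) (S (m (\<gamma> k))).
            ereal (LINT \<omega>|R (m (\<gamma> k)). u (f \<omega> - w (\<gamma> k) \<omega>))) < ereal (u 0)"
      by simp
  qed
qed

definition NAMFL_uniform ::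
  "(nat \<Rightarrow> 'a measure) \<Rightarrow> (nat \<Rightarrow> real \<Rightarrow> 'a measure) \<Rightarrow> (nat \<Rightarrow> nat) \<Rightarrow>
     (nat \<Rightarrow> nat \<Rightarrow> 'a process) \<Rightarrow> bool" where
  "NAMFL_uniform P F d S \<longleftrightarrow>
     (\<forall>\<epsilon>>0. \<exists>\<delta>>0. \<exists>u\<in>U2. \<exists>R. (\<forall>n. R n \<in> equivalent_measures (P n)) \<and> bicontiguous R P \<and>
        (\<forall>w. (\<forall>n. w n \<in> D_set \<epsilon> (P n)) \<longrightarrow>
           limsup (\<lambda>n. SUP f \<in> C_set (P n) (F n) (d n) (S n).
                         ereal (LINT \<omega>|R n. u (f \<omega> - w n \<omega>)))
           < ereal (u 0 - \<delta>)))"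

definition NAFL ::
  "(nat \<Rightarrow> 'a measure) \<Rightarrow> (nat \<Rightarrow> real \<Rightarrow> 'a measure) \<Rightarrow> (nat \<Rightarrow> nat) \<Rightarrow>
     (nat \<Rightarrow> nat \<Rightarrow> 'a process) \<Rightarrow> bool" where
  "NAFL P F d S \<longleftrightarrow>
     (\<forall>\<epsilon>>0. \<exists>Y. young_function Y \<and>
        (\<forall>n. C_set (P n) (F n) (d n) (S n) \<inter>
               {\<lambda>\<omega>. w \<omega> + v \<omega> | w v. w \<in> D_set \<epsilon> (P n) \<and> v \<in> orlicz_polar Y (P n)} = {}))"

end

theory Submission
  imports Defs
begin

text \<open>
  From NAFL, the algebraic Hahn--Banach theorem separates \<open>C n\<close> from \<open>D \<epsilon> n + V\<close>, for each
  \<open>\<epsilon> = (1/2) ^ k\<close>.  The polar \<open>V\<close> of an Orlicz ball absorbs bounded functions, and it contains large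
  multiples of indicators of sets of small probability, both uniformly in \<open>n\<close>.  Hence the separating functionals are
  given by probability measures, uniformly absolutely continuous with respect to \<open>P n\<close>, and their mixture over \<open>k\<close>
  is a bicontiguous sequence of separating measures; with these, \<open>u x = x\<close> gives (i).

  From (ii) to NAFL, one chooses a Young function that grows so slowly that membership in its polar forces
  any prescribed decay of the tails of \<open>v\<^sup>-\<close>, so that the loss of utility caused by \<open>v\<^sup>-\<close> is uniformly below \<open>\<delta>\<close>.

  From (i) to (ii), all pairs \<open>(n, w)\<close> with \<open>w\<close> in \<open>D \<epsilon> n\<close> are the members of one net, whose order is irrelevant.
\<close>

section \<open>Young functions\<close>

text \<open>The implications form the cycle (i), (ii), (iii), (i). The obstacle throughout is
  uniformity: every constant has to be fixed before the market index \<open>n\<close>, and it is the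
  single Young function that makes this possible. The separation is purely algebraic, and countable
  additivity of the functionals is recovered afterwards from their values on sets of small
  probability. A functional obtained at one level \<epsilon> is bounded below only on sets of
  probability at least \<epsilon> and may vanish on smaller ones; the mixture over all levels
  removes this defect and yields both equivalence to \<open>P n\<close> and the second half of
  bicontiguity. Stochastic integration enters through one fact: \<open>C_set\<close> is a convex
  cone that contains the nonpositive bounded functions. Equivalent separating measures serve for the
  finitely many markets about which a limsup is silent.\<close>

text \<open>The derivative \<open>g\<close> is a sum of ramps: up to the factor
  \<open>\<eta> / 4\<close>, ramp \<open>j\<close> rises linearly to 1, reached at
  \<open>2 ^ j * b j\<close>, and then stays there. Infinitely many ramps drive \<open>g\<close> to
  infinity, but at \<open>b j\<close> the ramps before \<open>j\<close> contribute at most 1 each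
  and the others a geometric tail, so \<open>g (b j)\<close> grows only linearly in
  \<open>j\<close>.\<close>

lemma slow_young_function:
  fixes \<eta> :: real and b :: "nat \<Rightarrow> real"
  assumes \<eta>: "0 < \<eta>" and b: "\<And>j. 0 < b j" "incseq b"
  shows "\<exists>Y. young_function Y \<and> (\<forall>j. Y (b j) < \<eta> * (real j + 1) * b j)"
proof -
  \<comment> \<open>The factor \<open>2 ^ j\<close> makes the sum of ramps converge even for bounded
    \<open>b\<close>. The factor \<open>\<eta> / 4\<close> in \<open>g\<close> absorbs the bound
    \<open>j + 2\<close> obtained below for the sum at \<open>b j\<close>, as
    \<open>j + 2 < 4 * (j + 1)\<close>.\<close>
  define m where "m t j = min 1 (t / (2 ^ j * b j))" for t :: real and j :: nat
  define g where "g t = \<eta> / 4 * (\<Sum>j. m t j)" for t :: real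
  define Y where "Y t = integral {0..t} g" for t
  have b0: "b 0 \<le> b j" for j using b(2) by (simp add: incseq_def)
  have half: "summable (\<lambda>j. c * (1/2::real) ^ j)" for c
    by (intro summable_mult summable_geometric) auto
  have m_nonneg: "0 \<le> m t j" if "0 \<le> t" for t j
    unfolding m_def using that b(1)[of j] by simp
  have frac_le: "1 / (2 ^ j * b j) \<le> 1 / b 0 * (1/2) ^ j" for j
    using b0[of j] b(1)[of 0] by (simp add: field_simps)
  have m_le: "m t j \<le> t / b 0 * (1/2) ^ j" if "0 \<le> t" for t j
    using mult_left_mono[OF frac_le[of j] that] by (simp add: m_def)
  have m_summable: "summable (m t)" if "0 \<le> t" for t
    by (rule summable_comparison_test'[OF half[of "t / b 0"], of 0]) (use m_nonneg m_le that in auto)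
  have m_diff: "\<bar>m s j - m t j\<bar> \<le> \<bar>s - t\<bar> / b 0 * (1/2) ^ j" for s t j
  proof -
    have "\<bar>m s j - m t j\<bar> \<le> \<bar>s / (2 ^ j * b j) - t / (2 ^ j * b j)\<bar>" unfolding m_def by linarith
    also have "\<dots> = \<bar>s - t\<bar> * (1 / (2 ^ j * b j))"
      using b(1)[of j] by (simp add: diff_divide_distrib[symmetric] abs_mult)
    also have "\<dots> \<le> \<bar>s - t\<bar> * (1 / b 0 * (1/2) ^ j)" by (intro mult_left_mono frac_le) auto
    finally show ?thesis by (simp add: mult.assoc)
  qed
  have g_diff: "\<bar>g s - g t\<bar> \<le> (\<eta> / (2 * b 0)) * \<bar>s - t\<bar>" if "0 \<le> s" "0 \<le> t" for s t
  proof -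
    have "\<bar>(\<Sum>j. m s j) - (\<Sum>j. m t j)\<bar> = \<bar>\<Sum>j. m s j - m t j\<bar>"
      using m_summable that by (simp add: suminf_diff)
    also have "\<dots> \<le> (\<Sum>j. \<bar>s - t\<bar> / b 0 * (1/2) ^ j)"
      using norm_suminf_le[OF _ half[of "\<bar>s - t\<bar> / b 0"], of "\<lambda>j. m s j - m t j"] m_diff by simp
    also have "\<dots> = \<bar>s - t\<bar> / b 0 * 2" by (subst suminf_mult) (simp_all add: suminf_geometric)
    finally have "\<eta> / 4 * \<bar>(\<Sum>j. m s j) - (\<Sum>j. m t j)\<bar> \<le> \<eta> / 4 * (\<bar>s - t\<bar> / b 0 * 2)"
      by (intro mult_left_mono) (use \<eta> in auto)
    moreover have "\<bar>g s - g t\<bar> = \<eta> / 4 * \<bar>(\<Sum>j. m s j) - (\<Sum>j. m t j)\<bar>"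
      unfolding g_def right_diff_distrib[symmetric] abs_mult using \<eta> by simp
    ultimately show ?thesis by simp
  qed
  have "(\<eta> / (2 * b 0))-lipschitz_on {0..} g"
    by (rule lipschitz_onI) (use g_diff \<eta> b(1)[of 0] in \<open>auto simp: dist_real_def\<close>)
  then have g_cont: "continuous_on {0..} g" by (rule lipschitz_on_continuous_on)
  have g_strict: "g s < g t" if st: "0 \<le> s" "s < t" for s t
  proof -
    \<comment> \<open>A ramp that is still rising at \<open>t\<close> makes the increase strict; the
      other ramps are nondecreasing.\<close>
    obtain j :: nat where "t / b 0 < 2 ^ j"
      using real_arch_pow[of 2 "t / b 0"] by auto
    then have "t < 2 ^ j * b 0" using b(1)[of 0] by (simp add: field_simps)
    also have "\<dots> \<le> 2 ^ j * b j" using b0 by simp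
    finally have "m s j < m t j" using st b(1)[of j] by (simp add: m_def divide_strict_right_mono min_def)
    moreover have mono: "m s i \<le> m t i" for i
      unfolding m_def using st b(1)[of i] by (intro min.mono) (auto intro: divide_right_mono)
    ultimately have "0 < (\<Sum>j. m t j - m s j)"
      by (intro suminf_pos2[where i=j] summable_diff m_summable) (use st in auto)
    then show ?thesis
      unfolding g_def using \<eta> suminf_diff[OF m_summable[of t] m_summable[of s]] st by simp
  qed
  have g0: "g 0 = 0" by (simp add: g_def m_def)
  have g_top: "filterlim g at_top at_top"
    unfolding filterlim_at_top
  proof
    fix Z :: real
    obtain N :: nat where N: "4 * Z / \<eta> \<le> real N" using real_arch_simple by blast
    show "\<forall>\<^sub>F t in at_top. Z \<le> g t"
      using eventually_ge_at_top[of "2 ^ N * b N"]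
    proof eventually_elim
      case (elim t)
      have "m t j = 1" if "j < N" for j
      proof -
        have "2 ^ j * b j \<le> 2 ^ N * b N"
          using b that by (intro mult_mono power_increasing) (auto simp: incseq_def less_imp_le)
        then show ?thesis using elim b(1)[of j] by (simp add: m_def)
      qed
      then have "real N = (\<Sum>j<N. m t j)" by simp
      also have "\<dots> \<le> (\<Sum>j. m t j)"
        using elim b(1)[of N] by (intro sum_le_suminf m_summable) (auto intro!: m_nonneg order_trans[OF _ elim])
      finally have "4 * Z / \<eta> \<le> (\<Sum>j. m t j)" using N by linarith
      then show "Z \<le> g t" using \<eta> by (simp add: g_def field_simps)
    qed
  qed
  have Y_deriv: "(Y has_real_derivative g t) (at t within {0..})" if "0 \<le> t" for t
  proof -
    have "(Y has_real_derivative g t) (at t within {0..t+1})"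
      unfolding Y_def
      by (rule integral_has_real_derivative) (use that g_cont in \<open>auto intro: continuous_on_subset\<close>)
    moreover have "at t within {0..t+1} = at t within {0..}"
      by (rule at_within_nhd[of _ "{..<t+1}"]) auto
    ultimately show ?thesis by simp
  qed
  have g_nonneg: "0 \<le> g t" if "0 \<le> t" for t
    using g_strict[of 0 t] g0 that by (cases "t = 0") auto
  have int: "g integrable_on {0..t}" for t
    by (intro integrable_continuous_real continuous_on_subset[OF g_cont]) auto
  have "young_function Y"
    unfolding young_function_def
  proof (intro conjI exI[of _ g] allI impI)
    show "0 \<le> Y t" if "0 \<le> t" for t
      unfolding Y_def by (intro integral_nonneg int) (use g_nonneg in auto)
    show "strict_mono_on {0..} g" by (auto simp: strict_mono_on_def g_strict)
  qed (use Y_deriv g_cont g0 g_top in \<open>auto simp: Y_def\<close>)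
  moreover have "Y (b j) < \<eta> * (real j + 1) * b j" for j
  proof -
    have bound: "m (b j) i \<le> (if i < j then 1 else (1/2) ^ i)" for i
    proof (cases "i < j")
      case False
      then have "b j / b i \<le> 1" using b by (simp add: incseq_def)
      then have "b j / (2 ^ i * b i) \<le> (1/2) ^ i"
        using b(1)[of i] by (simp add: field_simps)
      then show ?thesis using False by (simp add: m_def)
    qed (simp add: m_def)
    have sums: "(\<lambda>i. (if i < j then 1 else 0) + (1/2::real) ^ i) sums (real j + 2)"
      using sums_add[OF sums_If_finite_set[of "{..<j}" "\<lambda>_. 1::real"] geometric_sums[of "1/2::real"]] by simp
    have "(\<Sum>i. m (b j) i) \<le> (\<Sum>i. (if i < j then 1 else 0) + (1/2::real) ^ i)"
      using bound b(1)[of j] sums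
      by (intro suminf_le m_summable) (auto simp: sums_iff split: if_splits intro: order_trans[OF bound])
    then have "g (b j) \<le> \<eta> / 4 * (real j + 2)"
      unfolding g_def using sums \<eta> by (intro mult_left_mono) (auto simp: sums_iff)
    also have "\<dots> < \<eta> * (real j + 1)" using \<eta> by (simp add: field_simps add_pos_nonneg)
    finally have gb: "g (b j) < \<eta> * (real j + 1)" .
    have "Y (b j) \<le> integral {0..b j} (\<lambda>_. g (b j))"
      unfolding Y_def
      by (intro integral_le int) (use g_strict in \<open>auto simp: less_eq_real_def\<close>)
    also have "\<dots> = g (b j) * b j" using b(1)[of j] by simp
    also have "\<dots> < \<eta> * (real j + 1) * b j" using gb b(1)[of j] by simp
    finally show ?thesis .
  qed
  ultimately show ?thesis by blast
qed

lemma young_function_cases: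
  assumes "young_function Y"
  obtains Y' where "\<And>t. 0 \<le> t \<Longrightarrow> (Y has_real_derivative Y' t) (at t within {0..})"
    "\<And>s t. 0 \<le> s \<Longrightarrow> s \<le> t \<Longrightarrow> Y' s \<le> Y' t" "filterlim Y' at_top at_top"
    "\<And>t. 0 \<le> t \<Longrightarrow> 0 \<le> Y' t"
proof -
  from assms obtain Y' where Y': "\<forall>t\<ge>0. (Y has_real_derivative Y' t) (at t within {0..})"
    "Y' 0 = 0" "strict_mono_on {0..} Y'" "filterlim Y' at_top at_top"
    unfolding young_function_def by blast
  have mono: "Y' s \<le> Y' t" if "0 \<le> s" "s \<le> t" for s t
    using strict_mono_onD[OF Y'(3), of s t] that by (cases "s = t") auto
  show ?thesis
    by (rule that[of Y']) (use Y' mono mono[of 0] in auto)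
qed

lemma young_function_increment:
  assumes Y': "\<And>t. 0 \<le> t \<Longrightarrow> (Y has_real_derivative Y' t) (at t within {0..})"
    and mono: "\<And>s t. 0 \<le> s \<Longrightarrow> s \<le> t \<Longrightarrow> Y' s \<le> Y' t" and st: "0 \<le> s" "s \<le> t"
  shows "Y' s * (t - s) \<le> Y t - Y s" "Y t - Y s \<le> Y' t * (t - s)"
proof -
  have "Y' s * (t - s) \<le> Y t - Y s \<and> Y t - Y s \<le> Y' t * (t - s)"
  proof (cases "s = t")
    case False
    have "\<exists>z\<in>{s<..<t}. Y t - Y s = (\<lambda>h. h * Y' z) (t - s)"
    proof (rule mvt_simple)
      show "s < t" using st False by simp
      show "(Y has_derivative (\<lambda>h. h * Y' x)) (at x within {s..t})" if "s \<le> x" "x \<le> t" for x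
        using has_field_derivative_subset[OF Y'[of x], of "{s..t}"] that st
        by (simp add: has_field_derivative_def mult.commute[of _ "Y' x"] mult_commute_abs)
    qed
    then obtain z where z: "s < z" "z < t" "Y t - Y s = (t - s) * Y' z" by auto
    then show ?thesis using mono[of s z] mono[of z t] st
      by (simp add: mult.commute[of "t - s"] mult_right_mono)
  qed auto
  then show "Y' s * (t - s) \<le> Y t - Y s" "Y t - Y s \<le> Y' t * (t - s)" by auto
qed

lemma young_function_mono:
  assumes "young_function Y" "0 \<le> s" "s \<le> t"
  shows "Y s \<le> Y t"
proof -
  from assms(1) obtain Y' where Y': "\<And>t. 0 \<le> t \<Longrightarrow> (Y has_real_derivative Y' t) (at t within {0..})"
    "\<And>s t. 0 \<le> s \<Longrightarrow> s \<le> t \<Longrightarrow> Y' s \<le> Y' t" "\<And>t. 0 \<le> t \<Longrightarrow> 0 \<le> Y' t"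
    using young_function_cases by metis
  have "0 \<le> Y' s * (t - s)" using Y'(3) assms by simp
  then show ?thesis using young_function_increment(1)[OF Y'(1,2) assms(2,3)] by linarith
qed

text \<open>Convexity along the ray from 0, where \<open>Y\<close> vanishes. The slope of
  \<open>Y\<close> at \<open>?z = c * x\<close> bounds the increment over \<open>[0, ?z]\<close>
  from above and the one over \<open>[?z, x]\<close> from below, and
  \<open>(1 - c) * ?z = c * (x - ?z)\<close>.\<close>

lemma young_function_scale:
  assumes "young_function Y" "0 \<le> c" "c \<le> 1" "0 \<le> x"
  shows "Y (c * x) \<le> c * Y x"
proof -
  from assms(1) obtain Y' where Y': "\<And>t. 0 \<le> t \<Longrightarrow> (Y has_real_derivative Y' t) (at t within {0..})"
    "\<And>s t. 0 \<le> s \<Longrightarrow> s \<le> t \<Longrightarrow> Y' s \<le> Y' t" "\<And>t. 0 \<le> t \<Longrightarrow> 0 \<le> Y' t"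
    using young_function_cases by metis
  have Y0: "Y 0 = 0" using assms(1) by (simp add: young_function_def)
  let ?z = "c * x"
  have z: "0 \<le> ?z" "?z \<le> x" using assms by (auto intro: mult_left_le_one_le)
  have "Y ?z \<le> Y' ?z * ?z"
    using young_function_increment(2)[OF Y'(1,2), of 0 ?z] z Y0 by simp
  moreover have "Y' ?z * (x - ?z) \<le> Y x - Y ?z"
    using young_function_increment(1)[OF Y'(1,2), of ?z x] z by simp
  ultimately have "(1 - c) * Y ?z \<le> (1 - c) * (Y' ?z * ?z)" "c * (Y' ?z * (x - ?z)) \<le> c * (Y x - Y ?z)"
    using assms by (auto intro: mult_left_mono)
  then show ?thesis by (simp add: algebra_simps)
qed

text \<open>The growth condition of de la Vallee-Poussin: past the point \<open>z\<close> where the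
  derivative reaches \<open>L\<close>, the function \<open>Y\<close> grows at least as fast as
  \<open>L * x\<close>, so \<open>T = L * z\<close> is enough.\<close>

lemma young_function_superlinear:
  assumes "young_function Y" "0 < L"
  shows "\<exists>T\<ge>0. \<forall>x\<ge>0. L * x \<le> T + Y x"
proof -
  from assms(1) obtain Y' where Y': "\<And>t. 0 \<le> t \<Longrightarrow> (Y has_real_derivative Y' t) (at t within {0..})"
    "\<And>s t. 0 \<le> s \<Longrightarrow> s \<le> t \<Longrightarrow> Y' s \<le> Y' t" "filterlim Y' at_top at_top"
    using young_function_cases by metis
  have Y_nonneg: "0 \<le> Y t" if "0 \<le> t" for t using assms(1) that by (simp add: young_function_def)
  obtain z0 where z0: "\<And>t. z0 \<le> t \<Longrightarrow> L \<le> Y' t"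
    using Y'(3) by (auto simp: filterlim_at_top eventually_at_top_linorder)
  define z where "z = max 0 z0"
  have z: "0 \<le> z" "L \<le> Y' z" using z0[of z] by (auto simp: z_def)
  have "L * x \<le> L * z + Y x" if "0 \<le> x" for x
  proof (cases "x \<le> z")
    case True
    then have "L * x \<le> L * z" using assms(2) by simp
    then show ?thesis using Y_nonneg[OF that] by linarith
  next
    case False
    then have "Y' z * (x - z) \<le> Y x - Y z"
      using young_function_increment(1)[OF Y'(1,2), of z x] z by simp
    moreover have "L * (x - z) \<le> Y' z * (x - z)" using z False by (intro mult_right_mono) auto
    ultimately show ?thesis using Y_nonneg[OF z(1)] by (simp add: algebra_simps)
  qed
  moreover have "0 \<le> L * z" using z assms(2) by simp
  ultimately show ?thesis by blast
qed

text \<open>Nothing is known about \<open>Y\<close> at negative arguments;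
  \<open>Y (max 0 t)\<close> is monotone on the whole line and hence Borel.\<close>

lemma young_function_measurable:
  assumes "young_function Y" "f \<in> borel_measurable M" "\<And>\<omega>. \<omega> \<in> space M \<Longrightarrow> 0 \<le> f \<omega>"
  shows "(\<lambda>\<omega>. Y (f \<omega>)) \<in> borel_measurable M"
proof -
  have "mono (\<lambda>t. Y (max 0 t))"
    by (intro monoI young_function_mono[OF assms(1)]) auto
  then have [measurable]: "(\<lambda>t. Y (max 0 t)) \<in> borel_measurable borel" by (rule borel_measurable_mono)
  have "(\<lambda>\<omega>. Y (max 0 (f \<omega>))) \<in> borel_measurable M" using assms(2) by measurable
  then show ?thesis by (rule measurable_cong[THEN iffD1, rotated]) (simp add: assms(3) max_def)
qed

section \<open>Orlicz balls and their polars\<close>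

text \<open>The norm is an infimum that may equal 1 without being shown to be attained. Dividing by
  2 avoids the question: some admissible \<open>b\<close> lies below 2, and \<open>Y\<close> is
  monotone.\<close>

lemma orlicz_ball_nn_integral:
  assumes Y: "young_function Y" and h: "h \<in> orlicz_ball Y P"
  shows "(\<integral>\<^sup>+\<omega>. ennreal (Y (\<bar>h \<omega>\<bar> / 2)) \<partial>P) \<le> 1"
proof -
  let ?S = "{a. 0 < a \<and> (\<integral>\<^sup>+\<omega>. ennreal (Y (\<bar>h \<omega>\<bar> / a)) \<partial>P) \<le> 1}"
  from h have [measurable]: "h \<in> borel_measurable P" and le: "Inf ?S \<le> 1"
    and "\<exists>a>0. (\<integral>\<^sup>+\<omega>. ennreal (Y (a * \<bar>h \<omega>\<bar>)) \<partial>P) < \<infinity>"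
    by (auto simp: orlicz_ball_def orlicz_space_def orlicz_norm_def)
  then obtain a where a: "0 < a" "(\<integral>\<^sup>+\<omega>. ennreal (Y (a * \<bar>h \<omega>\<bar>)) \<partial>P) < \<infinity>" by blast
  define K where "K = enn2real (\<integral>\<^sup>+\<omega>. ennreal (Y (a * \<bar>h \<omega>\<bar>)) \<partial>P)"
  have K: "(\<integral>\<^sup>+\<omega>. ennreal (Y (a * \<bar>h \<omega>\<bar>)) \<partial>P) = ennreal K" "0 \<le> K"
    using a(2) by (auto simp: K_def)
  have m: "(\<lambda>\<omega>. Y (a * \<bar>h \<omega>\<bar>)) \<in> borel_measurable P"
    by (rule young_function_measurable[OF Y]) (use a in auto)
  \<comment> \<open>Shrinking the argument by \<open>c\<close> shrinks the integral \<open>K\<close>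
    below 1 by convexity. This exhibits an element of \<open>?S\<close>, without which its infimum
    would carry no information.\<close>
  define c where "c = 1 / (K + 1)"
  have c: "0 < c" "c \<le> 1" "c * K \<le> 1" using K(2) by (auto simp: c_def field_simps)
  have "(\<integral>\<^sup>+\<omega>. ennreal (Y (\<bar>h \<omega>\<bar> / (1 / (c * a)))) \<partial>P) \<le> (\<integral>\<^sup>+\<omega>. ennreal c * ennreal (Y (a * \<bar>h \<omega>\<bar>)) \<partial>P)"
  proof (intro nn_integral_mono)
    fix \<omega>
    have "Y (c * (a * \<bar>h \<omega>\<bar>)) \<le> c * Y (a * \<bar>h \<omega>\<bar>)"
      using young_function_scale[OF Y, of c] a c by simp
    then show "ennreal (Y (\<bar>h \<omega>\<bar> / (1 / (c * a)))) \<le> ennreal c * ennreal (Y (a * \<bar>h \<omega>\<bar>))"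
      using c by (simp add: ennreal_mult'[symmetric] mult_ac ennreal_leI)
  qed
  also have "\<dots> = ennreal (c * K)" using m K c by (simp add: nn_integral_cmult ennreal_mult)
  also have "\<dots> \<le> 1" using c by simp
  finally have "1 / (c * a) \<in> ?S" using a c by simp
  moreover have "Inf ?S < 2" using le by simp
  ultimately obtain b where b: "b \<in> ?S" "b < 2"
    using cInf_lessD[of ?S 2] by blast
  have "Y (\<bar>h \<omega>\<bar> / 2) \<le> Y (\<bar>h \<omega>\<bar> / b)" for \<omega>
    using b by (intro young_function_mono[OF Y] divide_left_mono) auto
  then have "(\<integral>\<^sup>+\<omega>. ennreal (Y (\<bar>h \<omega>\<bar> / 2)) \<partial>P) \<le> (\<integral>\<^sup>+\<omega>. ennreal (Y (\<bar>h \<omega>\<bar> / b)) \<partial>P)"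
    by (intro nn_integral_mono ennreal_leI)
  also have "\<dots> \<le> 1" using b by simp
  finally show ?thesis .
qed

lemma orlicz_ball_measurable: "h \<in> orlicz_ball Y P \<Longrightarrow> h \<in> borel_measurable P"
  by (simp add: orlicz_ball_def orlicz_space_def)

text \<open>\<open>T\<close> is determined by \<open>Y\<close> and \<open>e\<close> alone, before
  the measure is given; this is where all uniformity in \<open>n\<close> comes from on the way from
  NAFL to the separating measures. The slope \<open>2 / e\<close> in the superlinear bound
  compensates for the halved argument of \<open>Y\<close>.\<close>

lemma orlicz_ball_uniformly_integrable:
  assumes Y: "young_function Y" and e: "0 < e"
  shows "\<exists>T\<ge>0. \<forall>(P :: 'a measure) h A. prob_space P \<longrightarrow> h \<in> orlicz_ball Y P \<longrightarrow> A \<in> sets P \<longrightarrow>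
    integrable P h \<and> (LINT \<omega>|P. \<bar>h \<omega>\<bar> * indicator A \<omega>) \<le> T * measure P A + e"
proof -
  have "0 < 2 / e" using e by simp
  from young_function_superlinear[OF Y this] obtain T
    where T: "0 \<le> T" "\<And>x. 0 \<le> x \<Longrightarrow> 2 / e * x \<le> T + Y x" by blast
  have T': "\<bar>x\<bar> \<le> e * T + e * Y (\<bar>x\<bar> / 2)" for x
    using mult_left_mono[OF T(2)[of "\<bar>x\<bar> / 2"], of e] e by (simp add: distrib_left)
  have "integrable P h \<and> (LINT \<omega>|P. \<bar>h \<omega>\<bar> * indicator A \<omega>) \<le> e * T * measure P A + e"
    if P: "prob_space P" and h: "h \<in> orlicz_ball Y P" and A[measurable]: "A \<in> sets P"
    for P :: "'a measure" and h A
  proof -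
    interpret prob_space P by fact
    note [measurable] = orlicz_ball_measurable[OF h]
    have m[measurable]: "(\<lambda>\<omega>. Y (\<bar>h \<omega>\<bar> / 2)) \<in> borel_measurable P"
      by (rule young_function_measurable[OF Y]) auto
    have nn: "0 \<le> Y (\<bar>x\<bar> / 2)" for x using Y by (simp add: young_function_def)
    note le = orlicz_ball_nn_integral[OF Y h]
    have int: "integrable P (\<lambda>\<omega>. Y (\<bar>h \<omega>\<bar> / 2))"
      by (rule integrableI_nonneg) (use nn le in \<open>auto intro: le_less_trans\<close>)
    have "ennreal (LINT \<omega>|P. Y (\<bar>h \<omega>\<bar> / 2)) \<le> ennreal 1"
      using le nn_integral_eq_integral[OF int] nn by simp
    then have le1: "(LINT \<omega>|P. Y (\<bar>h \<omega>\<bar> / 2)) \<le> 1" by (simp add: ennreal_le_iff)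
    have inth: "integrable P h"
      by (rule Bochner_Integration.integrable_bound[of _ "\<lambda>\<omega>. e * T + e * Y (\<bar>h \<omega>\<bar> / 2)"])
        (use int T' in \<open>auto intro!: AE_I2 order_trans[OF _ abs_ge_self]\<close>)
    have intA: "integrable P (indicator A :: _ \<Rightarrow> real)"
      by (rule integrable_real_indicator) (auto simp: emeasure_eq_measure)
    have "(LINT \<omega>|P. \<bar>h \<omega>\<bar> * indicator A \<omega>) \<le> (LINT \<omega>|P. e * T * indicator A \<omega> + e * Y (\<bar>h \<omega>\<bar> / 2))"
    proof (rule integral_mono)
      show "integrable P (\<lambda>\<omega>. \<bar>h \<omega>\<bar> * indicator A \<omega>)"
        using integrable_real_mult_indicator[OF A, of "\<lambda>\<omega>. \<bar>h \<omega>\<bar>"] inth by simp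
      show "integrable P (\<lambda>\<omega>. e * T * indicator A \<omega> + e * Y (\<bar>h \<omega>\<bar> / 2))"
        using int intA by (intro Bochner_Integration.integrable_add integrable_mult_right) auto
      show "\<bar>h \<omega>\<bar> * indicator A \<omega> \<le> e * T * indicator A \<omega> + e * Y (\<bar>h \<omega>\<bar> / 2)" for \<omega>
        using T'[of "h \<omega>"] nn[of "h \<omega>"] e by (auto simp: indicator_def)
    qed
    also have "\<dots> = e * T * measure P A + e * (LINT \<omega>|P. Y (\<bar>h \<omega>\<bar> / 2))"
      using int intA by (subst Bochner_Integration.integral_add) auto
    also have "\<dots> \<le> e * T * measure P A + e"
      using le1 e by simp
    finally show ?thesis using inth by simp
  qed
  then show ?thesis using T(1) e by (intro exI[of _ "e * T"]) auto
qed

lemma scaled_indicator_in_orlicz_ball: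
  assumes Y: "young_function Y" and P: "prob_space P" and A[measurable]: "A \<in> sets P"
    and c: "0 \<le> c" "Y c * measure P A \<le> 1"
  shows "(\<lambda>\<omega>. c * indicator A \<omega>) \<in> orlicz_ball Y P"
proof -
  interpret prob_space P by fact
  have nn: "0 \<le> Y c" and Y0: "Y 0 = 0" using Y c by (auto simp: young_function_def)
  have "(\<integral>\<^sup>+\<omega>. ennreal (Y (\<bar>c * indicator A \<omega>\<bar> / 1)) \<partial>P) = (\<integral>\<^sup>+\<omega>. ennreal (Y c) * indicator A \<omega> \<partial>P)"
    using c Y0 by (intro nn_integral_cong) (auto simp: indicator_def)
  also have "\<dots> = ennreal (Y c * measure P A)"
    using nn by (simp add: nn_integral_cmult emeasure_eq_measure ennreal_mult)
  also have "\<dots> \<le> 1" using c(2) by simp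
  finally have le: "(\<integral>\<^sup>+\<omega>. ennreal (Y (\<bar>c * indicator A \<omega>\<bar> / 1)) \<partial>P) \<le> 1" .
  then have "(\<integral>\<^sup>+\<omega>. ennreal (Y (1 * \<bar>c * indicator A \<omega>\<bar>)) \<partial>P) < \<infinity>"
    by (simp add: le_less_trans)
  then have "(\<lambda>\<omega>. c * indicator A \<omega>) \<in> orlicz_space Y P"
    unfolding orlicz_space_def by (intro CollectI conjI exI[of _ "1::real"]) auto
  moreover have "orlicz_norm Y P (\<lambda>\<omega>. c * indicator A \<omega>) \<le> 1"
    unfolding orlicz_norm_def
    by (rule cInf_lower) (use le in \<open>auto intro!: bdd_belowI[of _ 0]\<close>)
  ultimately show ?thesis by (simp add: orlicz_ball_def)
qed

text \<open>Testing the polar against a multiple of the indicator of \<open>A = {v < - x}\<close>: the multiple is \<open>a\<close> if \<open>a 1\<^sub>A\<close>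
  lies in the ball, and \<open>a / (Y a P A)\<close> otherwise.\<close>

lemma orlicz_polar_tail:
  assumes Y: "young_function Y" and P: "prob_space P" and v: "v \<in> orlicz_polar Y P"
    and x: "0 < x" and a: "0 < a" "Y a < x * a"
  shows "measure P {\<omega> \<in> space P. x < - v \<omega>} \<le> 1 / (x * a)"
proof -
  interpret prob_space P by fact
  from v have [measurable]: "v \<in> borel_measurable P" and bdd: "\<exists>c. AE \<omega> in P. \<bar>v \<omega>\<bar> \<le> c"
    by (auto simp: orlicz_polar_def Linfty_def)
  then obtain K where K: "AE \<omega> in P. \<bar>v \<omega>\<bar> \<le> K" by blast
  define A where "A = {\<omega> \<in> space P. x < - v \<omega>}"
  have [measurable]: "A \<in> sets P" by (simp add: A_def)
  have intv: "integrable P (\<lambda>\<omega>. v \<omega> * indicator A \<omega>)"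
    by (rule integrable_const_bound[of _ "\<bar>K\<bar>"]) (use K in \<open>auto simp: indicator_def elim!: eventually_mono\<close>)
  have intA: "integrable P (indicator A :: _ \<Rightarrow> real)"
      by (rule integrable_real_indicator) (auto simp: emeasure_eq_measure)
  have key: "x * c * measure P A \<le> 1" if c: "0 \<le> c" "(\<lambda>\<omega>. c * indicator A \<omega>) \<in> orlicz_ball Y P" for c
  proof -
    have "\<bar>LINT \<omega>|P. v \<omega> * (c * indicator A \<omega>)\<bar> \<le> 1" using v c by (auto simp: orlicz_polar_def)
    moreover have "(LINT \<omega>|P. v \<omega> * (c * indicator A \<omega>)) = c * (LINT \<omega>|P. v \<omega> * indicator A \<omega>)"
      by (simp add: mult.left_commute)
    moreover have "(LINT \<omega>|P. v \<omega> * indicator A \<omega>) \<le> (LINT \<omega>|P. - x * indicator A \<omega>)"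
      by (intro integral_mono intv integrable_mult_right intA) (auto simp: A_def indicator_def)
    then have "(LINT \<omega>|P. v \<omega> * indicator A \<omega>) \<le> - (x * measure P A)" by simp
    then have "c * (LINT \<omega>|P. v \<omega> * indicator A \<omega>) \<le> c * - (x * measure P A)"
      using c by (intro mult_left_mono) auto
    ultimately show ?thesis by (simp add: algebra_simps)
  qed
  have Ya: "0 \<le> Y a" using Y a by (simp add: young_function_def)
  have "x * a * measure P A \<le> 1"
  proof (cases "Y a * measure P A \<le> 1")
    case True
    then show ?thesis using key[of a] scaled_indicator_in_orlicz_ball[OF Y P] a by simp
  next
    case False
    \<comment> \<open>This case is contradictory: the assumption \<open>Y a < x * a\<close> gives
      \<open>1 = \<theta> * (Y a * measure P A) < x * (\<theta> * a) * measure P A\<close>, while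
      testing with \<open>\<theta> * a\<close> bounds the right-hand side by 1.\<close>
    define \<theta> where "\<theta> = 1 / (Y a * measure P A)"
    have \<theta>: "0 < \<theta>" "\<theta> \<le> 1" "\<theta> * (Y a * measure P A) = 1" using False by (auto simp: \<theta>_def)
    have "Y (\<theta> * a) * measure P A \<le> \<theta> * Y a * measure P A"
      using young_function_scale[OF Y, of \<theta> a] \<theta> a by (intro mult_right_mono) auto
    then have "Y (\<theta> * a) * measure P A \<le> 1" using \<theta>(3) by (simp add: mult.assoc)
    then have "x * (\<theta> * a) * measure P A \<le> 1"
      using key[of "\<theta> * a"] scaled_indicator_in_orlicz_ball[OF Y P] a \<theta> by simp
    moreover have "\<theta> * (Y a * measure P A) < \<theta> * (x * a * measure P A)"
      using \<theta>(1) a False by (intro mult_strict_left_mono mult_strict_right_mono) (auto simp: zero_less_measure_iff)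
    ultimately show ?thesis using \<theta>(3) by (simp add: algebra_simps)
  qed
  then show ?thesis using x a unfolding A_def[symmetric] by (simp add: field_simps)
qed

section \<open>Linearity of the stochastic integral\<close>

text \<open>Linearity is needed for \<open>C_set\<close> to be a cone. As the integral is a relation
  built up by limits, linearity is carried through its stages: elementary, bounded, general.\<close>

locale usual_stochastic_basis = prob_space P for P :: "'a measure" +
  fixes F :: "real \<Rightarrow> 'a measure"
  assumes usual: "usual_filtration P F"
begin

lemma space_filtration: "0 \<le> t \<Longrightarrow> space (F t) = space P"
  using usual[unfolded usual_filtration_def, THEN conjunct1] by (simp add: subalgebra_def)

lemma measurable_filtration_mono:
  fixes f :: "'a \<Rightarrow> real"
  assumes "0 \<le> s" "s \<le> t" "f \<in> borel_measurable (F s)"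
  shows "f \<in> borel_measurable (F t)"
proof -
  have "sets (F s) \<subseteq> sets (F t)"
    using usual[unfolded usual_filtration_def, THEN conjunct2, THEN conjunct1] assms(1,2) by blast
  then have "subalgebra (F t) (F s)"
    using assms(1,2) by (simp add: subalgebra_def space_filtration)
  from measurable_from_subalg[OF this assms(3)] show ?thesis .
qed

lemma measurable_filtration_imp_measurable:
  fixes f :: "'a \<Rightarrow> real"
  assumes "0 \<le> t" "f \<in> borel_measurable (F t)"
  shows "f \<in> borel_measurable P"
proof -
  have "subalgebra P (F t)" using usual[unfolded usual_filtration_def, THEN conjunct1] assms(1) by blast
  from measurable_from_subalg[OF this assms(2)] show ?thesis .
qed

section \<open>Adapted cadlag processes and uniform convergence in probability\<close>

lemma adaptedD: "adapted F X \<Longrightarrow> 0 \<le> t \<Longrightarrow> X t \<in> borel_measurable (F t)"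
  by (simp add: adapted_def)

lemma adapted_lincomb:
  assumes "adapted F X" "adapted F Z"
  shows "adapted F (\<lambda>t \<omega>. a * X t \<omega> + b * Z t \<omega>)"
  using assms by (auto simp: adapted_def intro!: borel_measurable_add borel_measurable_times)

lemma cadlagI:
  assumes "\<And>\<omega> t. \<omega> \<in> space P \<Longrightarrow> 0 \<le> t \<Longrightarrow> ((\<lambda>s. X s \<omega>) \<longlongrightarrow> X t \<omega>) (at_right t)"
    and "\<And>\<omega> t. \<omega> \<in> space P \<Longrightarrow> 0 < t \<Longrightarrow> \<exists>l. ((\<lambda>s. X s \<omega>) \<longlongrightarrow> l) (at_left t)"
  shows "cadlag P X"
  using assms unfolding cadlag_def continuous_within by blast

lemma cadlagD:
  assumes "cadlag P X" "\<omega> \<in> space P"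
  shows "0 \<le> t \<Longrightarrow> ((\<lambda>s. X s \<omega>) \<longlongrightarrow> X t \<omega>) (at_right t)"
    and "0 < t \<Longrightarrow> \<exists>l. ((\<lambda>s. X s \<omega>) \<longlongrightarrow> l) (at_left t)"
  using assms unfolding cadlag_def continuous_within by blast+

text \<open>The coefficients may depend on the state, because elementary integrands have random
  heights \<open>Y i \<omega>\<close>.\<close>

lemma cadlag_lincomb:
  assumes "cadlag P X" "cadlag P Z"
  shows "cadlag P (\<lambda>t \<omega>. \<phi> \<omega> * X t \<omega> + \<psi> \<omega> * Z t \<omega>)"
proof (rule cadlagI)
  fix \<omega> and t :: real assume \<omega>: "\<omega> \<in> space P"
  note X = cadlagD[OF assms(1) \<omega>, of t] and Z = cadlagD[OF assms(2) \<omega>, of t]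
  show "((\<lambda>s. \<phi> \<omega> * X s \<omega> + \<psi> \<omega> * Z s \<omega>) \<longlongrightarrow> \<phi> \<omega> * X t \<omega> + \<psi> \<omega> * Z t \<omega>) (at_right t)" if "0 \<le> t"
    by (intro tendsto_add tendsto_mult tendsto_const X(1) Z(1) that)
  show "\<exists>l. ((\<lambda>s. \<phi> \<omega> * X s \<omega> + \<psi> \<omega> * Z s \<omega>) \<longlongrightarrow> l) (at_left t)" if "0 < t"
  proof -
    from X(2)[OF that] Z(2)[OF that] obtain l l'
      where "((\<lambda>s. X s \<omega>) \<longlongrightarrow> l) (at_left t)" "((\<lambda>s. Z s \<omega>) \<longlongrightarrow> l') (at_left t)" by blast
    then have "((\<lambda>s. \<phi> \<omega> * X s \<omega> + \<psi> \<omega> * Z s \<omega>) \<longlongrightarrow> \<phi> \<omega> * l + \<psi> \<omega> * l') (at_left t)"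
      by (intro tendsto_add tendsto_mult tendsto_const)
    then show ?thesis by blast
  qed
qed

lemma adapted_cadlag_zero: "adapted F (\<lambda>t \<omega>. 0)" "cadlag P (\<lambda>t \<omega>. 0)"
  by (auto simp: adapted_def intro: cadlagI)

lemma adapted_cadlag_sum:
  assumes "finite I" "\<And>i. i \<in> I \<Longrightarrow> adapted F (X i) \<and> cadlag P (X i)"
  shows "adapted F (\<lambda>t \<omega>. \<Sum>i\<in>I. X i t \<omega>) \<and> cadlag P (\<lambda>t \<omega>. \<Sum>i\<in>I. X i t \<omega>)"
  using assms
proof (induction I rule: finite_induct)
  case (insert i I)
  then have i: "adapted F (X i)" "cadlag P (X i)"
    and IH: "adapted F (\<lambda>t \<omega>. \<Sum>i\<in>I. X i t \<omega>)" "cadlag P (\<lambda>t \<omega>. \<Sum>i\<in>I. X i t \<omega>)" by auto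
  show ?case
    using adapted_lincomb[OF i(1) IH(1), of 1 1] cadlag_lincomb[OF i(2) IH(2), of "\<lambda>_. 1" "\<lambda>_. 1"] insert(1,2) by simp
qed (simp add: adapted_cadlag_zero)

lemma cadlag_stopped:
  assumes "cadlag P X" "0 \<le> b"
  shows "cadlag P (\<lambda>t. X (min t b))"
proof (rule cadlagI)
  fix \<omega> and t :: real assume \<omega>: "\<omega> \<in> space P"
  note X = cadlagD[OF assms(1) \<omega>, of t]
  show "((\<lambda>s. X (min s b) \<omega>) \<longlongrightarrow> X (min t b) \<omega>) (at_right t)" if "0 \<le> t"
  proof (cases "t < b")
    case True
    then have ev: "\<forall>\<^sub>F s in at_right t. X s \<omega> = X (min s b) \<omega>"
      by (auto simp: eventually_at_right[OF True])
    show ?thesis using Lim_transform_eventually[OF X(1)[OF that] ev] True by simp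
  next
    case False
    have ev: "\<forall>\<^sub>F s in at_right t. X b \<omega> = X (min s b) \<omega>"
      using False by (auto simp: eventually_at_right_field intro!: exI[of _ "t+1"])
    show ?thesis
      using Lim_transform_eventually[OF tendsto_const ev] False by (simp add: min.absorb2)
  qed
  show "\<exists>l. ((\<lambda>s. X (min s b) \<omega>) \<longlongrightarrow> l) (at_left t)" if "0 < t"
  proof (cases "t \<le> b")
    case True
    from X(2)[OF that] obtain l where l: "((\<lambda>s. X s \<omega>) \<longlongrightarrow> l) (at_left t)" by blast
    have ev: "\<forall>\<^sub>F s in at_left t. X s \<omega> = X (min s b) \<omega>"
      using True by (auto simp: eventually_at_left_field intro!: exI[of _ "t-1"])
    show ?thesis using Lim_transform_eventually[OF l ev] by blast
  next
    case False
    have ev: "\<forall>\<^sub>F s in at_left t. X b \<omega> = X (min s b) \<omega>"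
      using False by (auto simp: eventually_at_left_field intro!: exI[of _ b])
    show ?thesis using Lim_transform_eventually[OF tendsto_const ev] by blast
  qed
qed

text \<open>By right-continuity, rational times detect an exceedance before \<open>t\<close>; the
  endpoint \<open>t\<close> is added because no time of the interval lies to its right.
  Measurability matters since \<open>measure\<close> is 0 on nonmeasurable sets, which would break
  subadditivity.\<close>

lemma cadlag_sup_measurable:
  assumes X: "adapted F X" "cadlag P X" and t: "0 \<le> t"
  shows "{\<omega> \<in> space P. \<exists>s\<in>{0..t}. e < \<bar>X s \<omega>\<bar>} \<in> sets P"
proof -
  define D where "D = insert t {q \<in> \<rat>. 0 \<le> q \<and> q \<le> t}"
  have D: "countable D" unfolding D_def by (auto intro: countable_subset[OF _ countable_rat])
  have "{\<omega> \<in> space P. \<exists>s\<in>{0..t}. e < \<bar>X s \<omega>\<bar>} = (\<Union>s\<in>D. {\<omega> \<in> space P. e < \<bar>X s \<omega>\<bar>})"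
  proof (intro equalityI subsetI)
    fix \<omega> assume "\<omega> \<in> {\<omega> \<in> space P. \<exists>s\<in>{0..t}. e < \<bar>X s \<omega>\<bar>}"
    then obtain s where \<omega>: "\<omega> \<in> space P" and s: "0 \<le> s" "s \<le> t" "e < \<bar>X s \<omega>\<bar>" by auto
    show "\<omega> \<in> (\<Union>s\<in>D. {\<omega> \<in> space P. e < \<bar>X s \<omega>\<bar>})"
    proof (cases "s = t")
      case False
      then have st: "s < t" using s by simp
      have "((\<lambda>r. \<bar>X r \<omega>\<bar>) \<longlongrightarrow> \<bar>X s \<omega>\<bar>) (at_right s)"
        by (rule tendsto_rabs[OF cadlagD(1)[OF X(2) \<omega> s(1)]])
      then have "\<forall>\<^sub>F r in at_right s. e < \<bar>X r \<omega>\<bar>" using s(3) by (rule order_tendstoD)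
      then obtain u where u: "s < u" "\<And>r. s < r \<Longrightarrow> r < u \<Longrightarrow> e < \<bar>X r \<omega>\<bar>"
        using eventually_at_right[OF st] by auto
      obtain q where q: "q \<in> \<rat>" "s < q" "q < min u t"
        using Rats_dense_in_real[of s "min u t"] u st by auto
      then have "q \<in> D" "e < \<bar>X q \<omega>\<bar>" using s u(2)[of q] by (auto simp: D_def)
      then show ?thesis using \<omega> by blast
    qed (use s \<omega> in \<open>auto simp: D_def\<close>)
  qed (use t in \<open>auto simp: D_def\<close>)
  also have "\<dots> \<in> sets P"
  proof (rule sets.countable_UN''[OF D])
    show "{\<omega> \<in> space P. e < \<bar>X s \<omega>\<bar>} \<in> sets P" if "s \<in> D" for s
    proof -
      have s: "0 \<le> s" using that t by (auto simp: D_def)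
      have [measurable]: "X s \<in> borel_measurable P"
        by (rule measurable_filtration_imp_measurable[OF s adaptedD[OF X(1) s]])
      show ?thesis by measurable
    qed
  qed
  finally show ?thesis .
qed

text \<open>Below the smaller threshold each of the two terms is at most \<open>e / 2\<close>. The
  summand 1 in the denominator keeps it positive when both coefficients vanish.\<close>

lemma measure_sup_lincomb_le:
  assumes X: "adapted F X" "cadlag P X" and Z: "adapted F Z" "cadlag P Z" and t: "0 \<le> t" and e: "0 < e"
  shows "measure P {\<omega> \<in> space P. \<exists>s\<in>{0..t}. e < \<bar>a * X s \<omega> + b * Z s \<omega>\<bar>} \<le>
    measure P {\<omega> \<in> space P. \<exists>s\<in>{0..t}. e / (2 * (\<bar>a\<bar> + \<bar>b\<bar> + 1)) < \<bar>X s \<omega>\<bar>} +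
    measure P {\<omega> \<in> space P. \<exists>s\<in>{0..t}. e / (2 * (\<bar>a\<bar> + \<bar>b\<bar> + 1)) < \<bar>Z s \<omega>\<bar>}"
    (is "measure P ?L \<le> measure P ?A + measure P ?B")
proof -
  define c where "c = \<bar>a\<bar> + \<bar>b\<bar> + 1"
  have c: "0 < c" "\<bar>a\<bar> \<le> c" "\<bar>b\<bar> \<le> c" by (auto simp: c_def)
  have half: "\<bar>p * x\<bar> \<le> e / 2" if "\<bar>x\<bar> \<le> e / (2 * c)" "\<bar>p\<bar> \<le> c" for p x
  proof -
    have "\<bar>p\<bar> * \<bar>x\<bar> \<le> c * (e / (2 * c))" using that c by (intro mult_mono) auto
    then show ?thesis using c by (simp add: abs_mult)
  qed
  have "\<bar>a * x + b * z\<bar> \<le> e" if "\<bar>x\<bar> \<le> e / (2 * c)" "\<bar>z\<bar> \<le> e / (2 * c)" for x z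
    using half[OF that(1), of a] half[OF that(2), of b] c by linarith
  then have split: "e / (2 * c) < \<bar>x\<bar> \<or> e / (2 * c) < \<bar>z\<bar>" if "e < \<bar>a * x + b * z\<bar>" for x z
    using that by (meson not_less)
  have sub: "?L \<subseteq> ?A \<union> ?B"
    unfolding c_def[symmetric] using split by blast
  have "?A \<in> sets P" "?B \<in> sets P" using cadlag_sup_measurable[OF _ _ t] X Z by auto
  then show ?thesis
    using finite_measure_mono[OF sub] measure_Un_le[of ?A P ?B] by auto
qed

lemma ucp_limit_lincomb:
  assumes Xk: "\<And>k. adapted F (Xk k) \<and> cadlag P (Xk k)" and X: "adapted F X" "cadlag P X"
    and Zk: "\<And>k. adapted F (Zk k) \<and> cadlag P (Zk k)" and Z: "adapted F Z" "cadlag P Z"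
    and lim: "ucp_limit P Xk X" "ucp_limit P Zk Z"
  shows "ucp_limit P (\<lambda>k t \<omega>. a * Xk k t \<omega> + b * Zk k t \<omega>) (\<lambda>t \<omega>. a * X t \<omega> + b * Z t \<omega>)"
  unfolding ucp_limit_def
proof (intro allI impI)
  fix t e :: real assume t: "0 \<le> t" and e: "0 < e"
  let ?e = "e / (2 * (\<bar>a\<bar> + \<bar>b\<bar> + 1))"
  let ?A = "\<lambda>k. measure P {\<omega> \<in> space P. \<exists>s\<in>{0..t}. ?e < \<bar>Xk k s \<omega> - X s \<omega>\<bar>}"
  let ?B = "\<lambda>k. measure P {\<omega> \<in> space P. \<exists>s\<in>{0..t}. ?e < \<bar>Zk k s \<omega> - Z s \<omega>\<bar>}"
  have e': "0 < ?e" using e by (auto intro!: divide_pos_pos)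
  have "?A \<longlonglongrightarrow> 0" "?B \<longlonglongrightarrow> 0"
    using lim t e' unfolding ucp_limit_def by blast+
  then have AB: "(\<lambda>k. ?A k + ?B k) \<longlonglongrightarrow> 0" using tendsto_add[of ?A 0 _ ?B 0] by simp
  have le: "measure P {\<omega> \<in> space P. \<exists>s\<in>{0..t}. e < \<bar>(a * Xk k s \<omega> + b * Zk k s \<omega>) - (a * X s \<omega> + b * Z s \<omega>)\<bar>} \<le> ?A k + ?B k" for k
  proof -
    have "adapted F (\<lambda>t \<omega>. Xk k t \<omega> - X t \<omega>)" "cadlag P (\<lambda>t \<omega>. Xk k t \<omega> - X t \<omega>)"
      "adapted F (\<lambda>t \<omega>. Zk k t \<omega> - Z t \<omega>)" "cadlag P (\<lambda>t \<omega>. Zk k t \<omega> - Z t \<omega>)"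
      using adapted_lincomb[of "Xk k" X 1 "-1"] cadlag_lincomb[of "Xk k" X "\<lambda>_. 1" "\<lambda>_. - 1"] Xk X
        adapted_lincomb[of "Zk k" Z 1 "-1"] cadlag_lincomb[of "Zk k" Z "\<lambda>_. 1" "\<lambda>_. - 1"] Zk Z by auto
    from measure_sup_lincomb_le[OF this t e, of a b] show ?thesis by (simp add: algebra_simps)
  qed
  show "(\<lambda>k. measure P {\<omega> \<in> space P. \<exists>s\<in>{0..t}. e < \<bar>(a * Xk k s \<omega> + b * Zk k s \<omega>) - (a * X s \<omega> + b * Z s \<omega>)\<bar>}) \<longlonglongrightarrow> 0"
    by (rule tendsto_sandwich[OF _ _ tendsto_const AB]) (use le in auto)
qed

section \<open>Elementary integrals\<close>

lemma elementary_integral_scale: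
  assumes "elementary_integral F d S H X"
  shows "elementary_integral F d S (\<lambda>i t \<omega>. a * H i t \<omega>) (\<lambda>t \<omega>. a * X t \<omega>)"
  using assms
proof induction
  case (initial Y c)
  have "elementary_integral F d S (\<lambda>i t \<omega>. if t = 0 then a * Y i \<omega> else 0) (\<lambda>t \<omega>. 0)"
    by (rule elementary_integral.initial[where c = "\<bar>a\<bar> * c"])
      (use initial in \<open>auto simp: abs_mult intro: mult_left_mono\<close>)
  then show ?case by (simp add: if_distrib cong: if_cong)
next
  case (step s b Y c)
  have "elementary_integral F d S (\<lambda>i t \<omega>. if s < t \<and> t \<le> b then a * Y i \<omega> else 0)
      (\<lambda>t \<omega>. \<Sum>i<d. (a * Y i \<omega>) * (S i (min t b) \<omega> - S i (min t s) \<omega>))"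
    by (rule elementary_integral.step[where c = "\<bar>a\<bar> * c"])
      (use step in \<open>auto simp: abs_mult intro: mult_left_mono\<close>)
  then show ?case by (simp add: if_distrib sum_distrib_left mult.assoc cong: if_cong)
next
  case (add H X G Z)
  from elementary_integral.add[OF add.IH] show ?case by (simp add: distrib_left)
qed

lemma elementary_integral_lincomb:
  assumes "elementary_integral F d S H X" "elementary_integral F d S G Z"
  shows "elementary_integral F d S (\<lambda>i t \<omega>. a * H i t \<omega> + b * G i t \<omega>) (\<lambda>t \<omega>. a * X t \<omega> + b * Z t \<omega>)"
  using elementary_integral.add[OF elementary_integral_scale[OF assms(1), of a]
    elementary_integral_scale[OF assms(2), of b]] .

lemma elementary_integral_bounded:
  assumes "elementary_integral F d S H X"
  shows "\<exists>c. \<forall>i<d. \<forall>t\<ge>0. \<forall>\<omega>\<in>space P. \<bar>H i t \<omega>\<bar> \<le> c"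
  using assms
proof induction
  case (initial Y c)
  have "\<bar>if t = 0 then Y i \<omega> else 0\<bar> \<le> \<bar>c\<bar>" if "i < d" "\<omega> \<in> space P" for i \<omega> and t :: real
    using initial(2)[of i \<omega>] that space_filtration[of 0] by auto
  then show ?case by blast
next
  case (step a b Y c)
  have "\<bar>if a < t \<and> t \<le> b then Y i \<omega> else 0\<bar> \<le> \<bar>c\<bar>" if "i < d" "\<omega> \<in> space P" for i \<omega> and t :: real
    using step.hyps(4)[of i \<omega>] that space_filtration[OF step.hyps(1)] by auto
  then show ?case by blast
next
  case (add H X G Z)
  from add.IH obtain c c' where c: "\<forall>i<d. \<forall>t\<ge>0. \<forall>\<omega>\<in>space P. \<bar>H i t \<omega>\<bar> \<le> c" "\<forall>i<d. \<forall>t\<ge>0. \<forall>\<omega>\<in>space P. \<bar>G i t \<omega>\<bar> \<le> c'"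
    by blast
  have "\<bar>H i t \<omega> + G i t \<omega>\<bar> \<le> c + c'" if "i < d" "0 \<le> t" "\<omega> \<in> space P" for i t \<omega>
  proof -
    have "\<bar>H i t \<omega>\<bar> \<le> c" "\<bar>G i t \<omega>\<bar> \<le> c'" using c that by blast+
    then show ?thesis by linarith
  qed
  then show ?case by blast
qed

lemma elementary_integral_adapted_cadlag:
  assumes "elementary_integral F d S H X" and S: "\<And>i. i < d \<Longrightarrow> adapted F (S i) \<and> cadlag P (S i)"
  shows "adapted F X \<and> cadlag P X"
  using assms(1)
proof induction
  case (initial Y c)
  show ?case by (simp add: adapted_cadlag_zero)
next
  case (step a b Y c)
  show ?case
  proof (rule adapted_cadlag_sum)
    fix i assume "i \<in> {..<d}"
    then have i: "i < d" by simp
    have "(\<lambda>\<omega>. Y i \<omega> * (S i (min t b) \<omega> - S i (min t a) \<omega>)) \<in> borel_measurable (F t)"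
      if t: "0 \<le> t" for t
    proof (cases "t < a")
      case True
      then have "(\<lambda>\<omega>. Y i \<omega> * (S i (min t b) \<omega> - S i (min t a) \<omega>)) = (\<lambda>\<omega>. 0)"
        using step.hyps(2) by (simp add: min_def)
      then show ?thesis by simp
    next
      case False
      then have "a \<le> t" by simp
      have [measurable]: "S i (min t s) \<in> borel_measurable (F t)" if "0 \<le> s" for s
      proof (rule measurable_filtration_mono[of "min t s" t])
        show "0 \<le> min t s" using that t by simp
        then show "S i (min t s) \<in> borel_measurable (F (min t s))" using S[OF i] adaptedD by blast
      qed simp
      have [measurable]: "Y i \<in> borel_measurable (F t)"
        by (rule measurable_filtration_mono[OF step.hyps(1) \<open>a \<le> t\<close> step.hyps(3)[OF i]])
      have [simp]: "0 \<le> b" using step.hyps(1,2) by simp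
      show ?thesis using step.hyps(1) by measurable
    qed
    then have "adapted F (\<lambda>t \<omega>. Y i \<omega> * (S i (min t b) \<omega> - S i (min t a) \<omega>))"
      unfolding adapted_def by blast
    moreover have "cadlag P (\<lambda>t \<omega>. Y i \<omega> * (S i (min t b) \<omega> - S i (min t a) \<omega>))"
      using cadlag_lincomb[of "\<lambda>t. S i (min t b)" "\<lambda>t. S i (min t a)" "Y i" "\<lambda>\<omega>. - Y i \<omega>"]
        cadlag_stopped[of "S i"] S[OF i] step.hyps(1,2) by (simp add: right_diff_distrib)
    ultimately show "adapted F (\<lambda>t \<omega>. Y i \<omega> * (S i (min t b) \<omega> - S i (min t a) \<omega>)) \<and>
      cadlag P (\<lambda>t \<omega>. Y i \<omega> * (S i (min t b) \<omega> - S i (min t a) \<omega>))" by blast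
  qed simp
next
  case (add H X G Z)
  then show ?case using adapted_lincomb[of X Z 1 1] cadlag_lincomb[of X Z "\<lambda>_. 1" "\<lambda>_. 1"] by simp
qed

text \<open>Linearity in the integrator, needed for Emery convergence: there a test integrand is
  integrated against the difference of two processes. The integrand is the same in all three
  integrals, so its bound 1 is preserved by the splitting. The identity for \<open>Z\<close> is
  exact, since elementary integrals are explicit sums.\<close>

lemma elementary_integral_integrator_lincomb:
  assumes "elementary_integral F d (\<lambda>i t \<omega>. a * A i t \<omega> + b * B i t \<omega>) H Z"
  shows "\<exists>Z1 Z2. elementary_integral F d A H Z1 \<and> elementary_integral F d B H Z2 \<and>
    Z = (\<lambda>t \<omega>. a * Z1 t \<omega> + b * Z2 t \<omega>)"
  using assms
proof induction
  case (initial Y c)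
  then show ?case
    by (intro exI[of _ "\<lambda>t \<omega>. 0"] conjI elementary_integral.initial[where c = c]) auto
next
  case (step s u Y c)
  let ?Z = "\<lambda>S t \<omega>. \<Sum>i<d. Y i \<omega> * (S i (min t u) \<omega> - S i (min t s) \<omega>)"
  have "(\<lambda>t \<omega>. \<Sum>i<d. Y i \<omega> * (a * A i (min t u) \<omega> + b * B i (min t u) \<omega> -
      (a * A i (min t s) \<omega> + b * B i (min t s) \<omega>))) = (\<lambda>t \<omega>. a * ?Z A t \<omega> + b * ?Z B t \<omega>)"
    by (simp add: fun_eq_iff sum_distrib_left sum.distrib[symmetric] algebra_simps)
  moreover have "elementary_integral F d S (\<lambda>i t \<omega>. if s < t \<and> t \<le> u then Y i \<omega> else 0) (?Z S)" for S
    by (rule elementary_integral.step) (fact step.hyps)+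
  ultimately show ?case by blast
next
  case (add H X G Z)
  then obtain X1 X2 Z1 Z2 where
    A: "elementary_integral F d A H X1" "elementary_integral F d A G Z1" and
    B: "elementary_integral F d B H X2" "elementary_integral F d B G Z2" and
    eq: "X = (\<lambda>t \<omega>. a * X1 t \<omega> + b * X2 t \<omega>)" "Z = (\<lambda>t \<omega>. a * Z1 t \<omega> + b * Z2 t \<omega>)"
    by blast
  have "(\<lambda>t \<omega>. X t \<omega> + Z t \<omega>) = (\<lambda>t \<omega>. a * (X1 t \<omega> + Z1 t \<omega>) + b * (X2 t \<omega> + Z2 t \<omega>))"
    unfolding eq by (simp add: fun_eq_iff algebra_simps)
  with elementary_integral.add[OF A] elementary_integral.add[OF B] show ?case by blast
qed

section \<open>Integrals of bounded and of general integrands\<close>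

text \<open>A case distinction suffices, as a \<open>limit\<close> step carries its own bound
  \<open>c\<close>, which passes to the pointwise limit. The bound is required when an integral is
  used as a constant sequence in such a step.\<close>

lemma bounded_integral_bounded:
  assumes "bounded_integral P F d S H X"
  shows "\<exists>c. \<forall>i<d. \<forall>t\<ge>0. \<forall>\<omega>\<in>space P. \<bar>H i t \<omega>\<bar> \<le> c"
  using assms
proof cases
  case elementary
  then show ?thesis by (rule elementary_integral_bounded)
next
  case (limit Hk Xk c)
  have "\<bar>H i t \<omega>\<bar> \<le> c" if "i < d" "0 \<le> t" "\<omega> \<in> space P" for i t \<omega>
  proof (rule Lim_bounded)
    show "(\<lambda>k. \<bar>Hk k i t \<omega>\<bar>) \<longlonglongrightarrow> \<bar>H i t \<omega>\<bar>"
      using limit(3) that unfolding pointwise_limit_def by (intro tendsto_rabs) blast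
  qed (use limit(2) that in auto)
  then show ?thesis by blast
qed

lemma bounded_integral_adapted_cadlag:
  assumes "bounded_integral P F d S H X" "\<And>i. i < d \<Longrightarrow> adapted F (S i) \<and> cadlag P (S i)"
  shows "adapted F X \<and> cadlag P X"
  using assms(1) by cases (use elementary_integral_adapted_cadlag assms(2) in blast)+

lemma pointwise_limit_lincomb:
  assumes "pointwise_limit P d Hk H" "pointwise_limit P d Gk G"
  shows "pointwise_limit P d (\<lambda>k i t \<omega>. a * Hk k i t \<omega> + b * Gk k i t \<omega>) (\<lambda>i t \<omega>. a * H i t \<omega> + b * G i t \<omega>)"
  using assms unfolding pointwise_limit_def by (auto intro!: tendsto_intros)

lemma ucp_limit_const: "ucp_limit P (\<lambda>k. X) X"
  by (simp add: ucp_limit_def not_less_iff_gr_or_eq)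

lemma bounded_lincomb:
  fixes H G :: "nat \<Rightarrow> 'a process"
  assumes "\<bar>H i t \<omega>\<bar> \<le> c" "\<bar>G i t \<omega>\<bar> \<le> c'"
  shows "\<bar>a * H i t \<omega> + b * G i t \<omega>\<bar> \<le> \<bar>a\<bar> * c + \<bar>b\<bar> * c'"
  using assms
  by (intro order_trans[OF abs_triangle_ineq] add_mono) (auto simp: abs_mult intro: mult_left_mono)

text \<open>Common to both limit cases of the next lemma: the integral that is not being varied
  enters as a constant sequence.\<close>

lemma bounded_integral_limit_lincomb:
  assumes S: "\<And>i. i < d \<Longrightarrow> adapted F (S i) \<and> cadlag P (S i)"
    and int: "\<And>k. bounded_integral P F d S (\<lambda>i t \<omega>. a * Hk k i t \<omega> + b * Gk k i t \<omega>) (\<lambda>t \<omega>. a * Xk k t \<omega> + b * Zk k t \<omega>)"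
    and Hk: "\<And>k. bounded_integral P F d S (Hk k) (Xk k)" "\<And>k i t \<omega>. i < d \<Longrightarrow> 0 \<le> t \<Longrightarrow> \<omega> \<in> space P \<Longrightarrow> \<bar>Hk k i t \<omega>\<bar> \<le> c"
    and H: "pointwise_limit P d Hk H" "adapted F X" "cadlag P X" "ucp_limit P Xk X"
    and Gk: "\<And>k. bounded_integral P F d S (Gk k) (Zk k)" "\<And>k i t \<omega>. i < d \<Longrightarrow> 0 \<le> t \<Longrightarrow> \<omega> \<in> space P \<Longrightarrow> \<bar>Gk k i t \<omega>\<bar> \<le> c'"
    and G: "pointwise_limit P d Gk G" "adapted F Z" "cadlag P Z" "ucp_limit P Zk Z"
  shows "bounded_integral P F d S (\<lambda>i t \<omega>. a * H i t \<omega> + b * G i t \<omega>) (\<lambda>t \<omega>. a * X t \<omega> + b * Z t \<omega>)"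
proof (rule bounded_integral.limit[OF int])
  show "\<bar>a * Hk k i t \<omega> + b * Gk k i t \<omega>\<bar> \<le> \<bar>a\<bar> * c + \<bar>b\<bar> * c'"
    if "i < d" "0 \<le> t" "\<omega> \<in> space P" for k i t \<omega>
    using bounded_lincomb[of "Hk k"] Hk(2) Gk(2) that by blast
  show "ucp_limit P (\<lambda>k t \<omega>. a * Xk k t \<omega> + b * Zk k t \<omega>) (\<lambda>t \<omega>. a * X t \<omega> + b * Z t \<omega>)"
    using bounded_integral_adapted_cadlag[OF Hk(1) S] bounded_integral_adapted_cadlag[OF Gk(1) S] H G
    by (intro ucp_limit_lincomb) auto
qed (use H G in \<open>auto intro: pointwise_limit_lincomb adapted_lincomb cadlag_lincomb\<close>)

lemma pointwise_limit_const: "pointwise_limit P d (\<lambda>k. H) H"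
  by (simp add: pointwise_limit_def)

text \<open>Induction on the first integral and, within its elementary case, on the second; in every
  limit case the other integral stays fixed.\<close>

lemma bounded_integral_lincomb:
  assumes S: "\<And>i. i < d \<Longrightarrow> adapted F (S i) \<and> cadlag P (S i)"
    and "bounded_integral P F d S H X" and G: "bounded_integral P F d S G Z"
  shows "bounded_integral P F d S (\<lambda>i t \<omega>. a * H i t \<omega> + b * G i t \<omega>) (\<lambda>t \<omega>. a * X t \<omega> + b * Z t \<omega>)"
  using assms(2)
proof induction
  case (elementary H X)
  from G show ?case
  proof induction
    case (elementary G Z)
    then show ?case
      using elementary_integral_lincomb \<open>elementary_integral F d S H X\<close> by (blast intro: bounded_integral.elementary)
  next
    case (limit Gk Zk c G Z)
    note H = bounded_integral.elementary[OF \<open>elementary_integral F d S H X\<close>]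
    from bounded_integral_bounded[OF H] obtain c' where
      "\<forall>i<d. \<forall>t\<ge>0. \<forall>\<omega>\<in>space P. \<bar>H i t \<omega>\<bar> \<le> c'" by blast
    then have c': "\<bar>H i t \<omega>\<bar> \<le> c'" if "i < d" "0 \<le> t" "\<omega> \<in> space P" for i t \<omega>
      using that by blast
    have X: "adapted F X" "cadlag P X" using bounded_integral_adapted_cadlag[OF H S] by auto
    show ?case
    proof (rule bounded_integral_limit_lincomb)
      show "\<And>i. i < d \<Longrightarrow> adapted F (S i) \<and> cadlag P (S i)" by (fact S)
    qed (fact limit.IH H c' pointwise_limit_const X ucp_limit_const limit.hyps)+
  qed
next
  case (limit Hk Xk c H X)
  from bounded_integral_bounded[OF G] obtain c' where
    "\<forall>i<d. \<forall>t\<ge>0. \<forall>\<omega>\<in>space P. \<bar>G i t \<omega>\<bar> \<le> c'" by blast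
  then have c': "\<bar>G i t \<omega>\<bar> \<le> c'" if "i < d" "0 \<le> t" "\<omega> \<in> space P" for i t \<omega>
    using that by blast
  have Z: "adapted F Z" "cadlag P Z" using bounded_integral_adapted_cadlag[OF G S] by auto
  show ?case
  proof (rule bounded_integral_limit_lincomb)
    show "\<And>i. i < d \<Longrightarrow> adapted F (S i) \<and> cadlag P (S i)" by (fact S)
  qed (fact limit.IH G c' pointwise_limit_const Z ucp_limit_const limit.hyps)+
qed

lemma emery_limit_lincomb:
  assumes Xk: "\<And>k. adapted F (Xk k) \<and> cadlag P (Xk k)" and X: "adapted F X" "cadlag P X"
    and Zk: "\<And>k. adapted F (Zk k) \<and> cadlag P (Zk k)" and Z: "adapted F Z" "cadlag P Z"
    and lim: "emery_limit P F Xk X" "emery_limit P F Zk Z"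
  shows "emery_limit P F (\<lambda>k t \<omega>. a * Xk k t \<omega> + b * Zk k t \<omega>) (\<lambda>t \<omega>. a * X t \<omega> + b * Z t \<omega>)"
  unfolding emery_limit_def
proof (intro conjI allI impI)
  show "ucp_limit P (\<lambda>k t \<omega>. a * Xk k t \<omega> + b * Zk k t \<omega>) (\<lambda>t \<omega>. a * X t \<omega> + b * Z t \<omega>)"
    using lim by (intro ucp_limit_lincomb Xk X Zk Z) (auto simp: emery_limit_def)
  fix t e \<eta> :: real assume t: "0 \<le> t" and e: "0 < e" and \<eta>: "0 < \<eta>"
  let ?e = "e / (2 * (\<bar>a\<bar> + \<bar>b\<bar> + 1))"
  have e': "0 < ?e" using e by (auto intro!: divide_pos_pos)
  have "\<exists>k0. \<forall>k\<ge>k0. \<forall>\<theta> Z. elementary_integral F 1 (\<lambda>_ t \<omega>. Vk k t \<omega> - V t \<omega>) \<theta> Z \<longrightarrow>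
        (\<forall>t\<ge>0. \<forall>\<omega>\<in>space P. \<bar>\<theta> 0 t \<omega>\<bar> \<le> 1) \<longrightarrow>
        measure P {\<omega>\<in>space P. \<exists>s\<in>{0..t}. ?e < \<bar>Z s \<omega>\<bar>} \<le> \<eta> / 2" if "emery_limit P F Vk V" for Vk V
    using that t e' half_gt_zero[OF \<eta>] unfolding emery_limit_def by blast
  note half = this
  from half[OF lim(1)] obtain k1 where k1: "\<forall>k\<ge>k1. \<forall>\<theta> W. elementary_integral F 1 (\<lambda>_ t \<omega>. Xk k t \<omega> - X t \<omega>) \<theta> W \<longrightarrow>
        (\<forall>t\<ge>0. \<forall>\<omega>\<in>space P. \<bar>\<theta> 0 t \<omega>\<bar> \<le> 1) \<longrightarrow>
        measure P {\<omega>\<in>space P. \<exists>s\<in>{0..t}. ?e < \<bar>W s \<omega>\<bar>} \<le> \<eta> / 2" ..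
  from half[OF lim(2)] obtain k2 where k2: "\<forall>k\<ge>k2. \<forall>\<theta> W. elementary_integral F 1 (\<lambda>_ t \<omega>. Zk k t \<omega> - Z t \<omega>) \<theta> W \<longrightarrow>
        (\<forall>t\<ge>0. \<forall>\<omega>\<in>space P. \<bar>\<theta> 0 t \<omega>\<bar> \<le> 1) \<longrightarrow>
        measure P {\<omega>\<in>space P. \<exists>s\<in>{0..t}. ?e < \<bar>W s \<omega>\<bar>} \<le> \<eta> / 2" ..
  show "\<exists>k0. \<forall>k\<ge>k0. \<forall>\<theta> W. elementary_integral F 1
      (\<lambda>_ t \<omega>. (a * Xk k t \<omega> + b * Zk k t \<omega>) - (a * X t \<omega> + b * Z t \<omega>)) \<theta> W \<longrightarrow>
        (\<forall>t\<ge>0. \<forall>\<omega>\<in>space P. \<bar>\<theta> 0 t \<omega>\<bar> \<le> 1) \<longrightarrow>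
        measure P {\<omega>\<in>space P. \<exists>s\<in>{0..t}. e < \<bar>W s \<omega>\<bar>} \<le> \<eta>"
  proof (intro exI[of _ "max k1 k2"] allI impI)
    fix k \<theta> W assume k: "max k1 k2 \<le> k"
      and W: "elementary_integral F 1 (\<lambda>_ t \<omega>. (a * Xk k t \<omega> + b * Zk k t \<omega>) - (a * X t \<omega> + b * Z t \<omega>)) \<theta> W"
      and \<theta>: "\<forall>t\<ge>0. \<forall>\<omega>\<in>space P. \<bar>\<theta> 0 t \<omega>\<bar> \<le> 1"
    have "(\<lambda>(_::nat) t \<omega>. (a * Xk k t \<omega> + b * Zk k t \<omega>) - (a * X t \<omega> + b * Z t \<omega>)) =
      (\<lambda>_ t \<omega>. a * (Xk k t \<omega> - X t \<omega>) + b * (Zk k t \<omega> - Z t \<omega>))"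
      by (simp add: fun_eq_iff algebra_simps)
    with W have "elementary_integral F 1 (\<lambda>_ t \<omega>. a * (Xk k t \<omega> - X t \<omega>) + b * (Zk k t \<omega> - Z t \<omega>)) \<theta> W" by simp
    from elementary_integral_integrator_lincomb[OF this] obtain W1 W2 where
      W1: "elementary_integral F 1 (\<lambda>_ t \<omega>. Xk k t \<omega> - X t \<omega>) \<theta> W1" and
      W2: "elementary_integral F 1 (\<lambda>_ t \<omega>. Zk k t \<omega> - Z t \<omega>) \<theta> W2" and
      W: "W = (\<lambda>t \<omega>. a * W1 t \<omega> + b * W2 t \<omega>)" by blast
    have "adapted F W1 \<and> cadlag P W1" "adapted F W2 \<and> cadlag P W2"
      using elementary_integral_adapted_cadlag[OF W1] elementary_integral_adapted_cadlag[OF W2]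
        adapted_lincomb[of "Xk k" X 1 "-1"] cadlag_lincomb[of "Xk k" X "\<lambda>_. 1" "\<lambda>_. - 1"] Xk X
        adapted_lincomb[of "Zk k" Z 1 "-1"] cadlag_lincomb[of "Zk k" Z "\<lambda>_. 1" "\<lambda>_. - 1"] Zk Z by auto
    then have "measure P {\<omega>\<in>space P. \<exists>s\<in>{0..t}. e < \<bar>W s \<omega>\<bar>} \<le>
      measure P {\<omega>\<in>space P. \<exists>s\<in>{0..t}. ?e < \<bar>W1 s \<omega>\<bar>} + measure P {\<omega>\<in>space P. \<exists>s\<in>{0..t}. ?e < \<bar>W2 s \<omega>\<bar>}"
      unfolding W by (intro measure_sup_lincomb_le t e) auto
    also have "\<dots> \<le> \<eta> / 2 + \<eta> / 2"
      using k1[rule_format, OF _ W1] k2[rule_format, OF _ W2] \<theta> k by (intro add_mono) auto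
    finally show "measure P {\<omega>\<in>space P. \<exists>s\<in>{0..t}. e < \<bar>W s \<omega>\<bar>} \<le> \<eta>" by simp
  qed
qed

lemma stochastic_integral_lincomb:
  assumes S: "\<And>i. i < d \<Longrightarrow> adapted F (S i) \<and> cadlag P (S i)"
    and H: "stochastic_integral P F d S H X" and G: "stochastic_integral P F d S G Z"
  shows "stochastic_integral P F d S (\<lambda>i t \<omega>. a * H i t \<omega> + b * G i t \<omega>) (\<lambda>t \<omega>. a * X t \<omega> + b * Z t \<omega>)"
proof -
  from H obtain Hk Xk where Hk: "\<And>k. bounded_integral P F d S (Hk k) (Xk k)" "pointwise_limit P d Hk H"
    "emery_limit P F Xk X" and X: "adapted F X" "cadlag P X"
    and mH: "\<And>i. i < d \<Longrightarrow> (\<lambda>(t, \<omega>). H i t \<omega>) \<in> borel_measurable (predictable_sigma P F)"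
    unfolding stochastic_integral_def by blast
  from G obtain Gk Zk where Gk: "\<And>k. bounded_integral P F d S (Gk k) (Zk k)" "pointwise_limit P d Gk G"
    "emery_limit P F Zk Z" and Z: "adapted F Z" "cadlag P Z"
    and mG: "\<And>i. i < d \<Longrightarrow> (\<lambda>(t, \<omega>). G i t \<omega>) \<in> borel_measurable (predictable_sigma P F)"
    unfolding stochastic_integral_def by blast
  have "(\<lambda>(t, \<omega>). a * H i t \<omega> + b * G i t \<omega>) \<in> borel_measurable (predictable_sigma P F)" if "i < d" for i
  proof -
    have "(\<lambda>(t, \<omega>). a * H i t \<omega> + b * G i t \<omega>) = (\<lambda>p. a * (case p of (t, \<omega>) \<Rightarrow> H i t \<omega>) + b * (case p of (t, \<omega>) \<Rightarrow> G i t \<omega>))"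
      by (auto simp: fun_eq_iff)
    then show ?thesis using mH[OF that] mG[OF that] by simp
  qed
  moreover have "bounded_integral P F d S (\<lambda>i t \<omega>. a * Hk k i t \<omega> + b * Gk k i t \<omega>)
      (\<lambda>t \<omega>. a * Xk k t \<omega> + b * Zk k t \<omega>)" for k
    by (rule bounded_integral_lincomb[OF _ Hk(1) Gk(1)]) (rule S)
  moreover note pointwise_limit_lincomb[OF Hk(2) Gk(2), of a b]
  moreover have "adapted F (Xk k) \<and> cadlag P (Xk k)" "adapted F (Zk k) \<and> cadlag P (Zk k)" for k
    using bounded_integral_adapted_cadlag[OF Hk(1)] bounded_integral_adapted_cadlag[OF Gk(1)] S by blast+
  then have "emery_limit P F (\<lambda>k t \<omega>. a * Xk k t \<omega> + b * Zk k t \<omega>) (\<lambda>t \<omega>. a * X t \<omega> + b * Z t \<omega>)"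
    by (intro emery_limit_lincomb X Z Hk(3) Gk(3))
  moreover note adapted_lincomb[OF X(1) Z(1), of a b] cadlag_lincomb[OF X(2) Z(2), of "\<lambda>_. a" "\<lambda>_. b"]
  ultimately show ?thesis
    unfolding stochastic_integral_def
    by (intro conjI allI impI exI[of _ "\<lambda>k i t \<omega>. a * Hk k i t \<omega> + b * Gk k i t \<omega>"]
        exI[of _ "\<lambda>k t \<omega>. a * Xk k t \<omega> + b * Zk k t \<omega>"])
qed

lemma stochastic_integral_zero: "stochastic_integral P F d S (\<lambda>i t \<omega>. 0) (\<lambda>t \<omega>. 0)"
proof -
  have "elementary_integral F d S (\<lambda>i t \<omega>. if t = 0 then 0 else 0) (\<lambda>t \<omega>. 0)"
    by (rule elementary_integral.initial[where c = 0]) auto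
  then have int: "bounded_integral P F d S (\<lambda>i t \<omega>. 0) (\<lambda>t \<omega>. 0)"
    by (simp add: bounded_integral.elementary)
  \<comment> \<open>The zero integrator is \<open>0 * 0 + 0 * 0\<close>, so splitting it writes
    \<open>Z\<close> as \<open>0 * Z1 + 0 * Z2\<close>.\<close>
  have zero: "Z = (\<lambda>t \<omega>. 0)" if "elementary_integral F 1 (\<lambda>_ t \<omega>. 0 - 0) \<theta> Z" for \<theta> Z
    using elementary_integral_integrator_lincomb[of 1 0 "\<lambda>_ _ _. 0" 0 "\<lambda>_ _ _. 0" \<theta> Z] that by auto
  have small: "measure P {\<omega>\<in>space P. \<exists>s\<in>{0..t}. e < \<bar>Z s \<omega>\<bar>} \<le> \<eta>"
    if "elementary_integral F 1 (\<lambda>_ t \<omega>. 0 - 0) \<theta> Z" "0 < e" "0 < \<eta>" for \<theta> Z t e \<eta>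
    using zero[OF that(1)] that(2,3) by simp
  have "emery_limit P F (\<lambda>k t \<omega>. 0) (\<lambda>t \<omega>. 0)"
    unfolding emery_limit_def by (intro conjI ucp_limit_const allI impI exI[of _ "0::nat"] small)
  then show ?thesis
    unfolding stochastic_integral_def
    by (auto simp: adapted_cadlag_zero intro!: exI[of _ "\<lambda>k i t \<omega>. 0"] exI[of _ "\<lambda>k t \<omega>. 0"] int pointwise_limit_const)
qed

end

section \<open>The cones \<open>K_set\<close> and \<open>C_set\<close>\<close>

lemma market_basis:
  assumes "market P F d S"
  shows "usual_stochastic_basis P F" "\<And>i. i < d \<Longrightarrow> adapted F (S i) \<and> cadlag P (S i)"
  using assms
  by (auto simp: market_def usual_stochastic_basis_def usual_stochastic_basis_axioms_def semimartingale_def)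

lemma K_set_zero:
  assumes "market P F d S"
  shows "(\<lambda>\<omega>. 0) \<in> K_set P F d S"
proof -
  interpret usual_stochastic_basis P F by (rule market_basis[OF assms])
  show ?thesis
    unfolding K_set_def
    by (auto intro!: exI[of _ "\<lambda>i t \<omega>. 0"] exI[of _ "\<lambda>t \<omega>. 0"] exI[of _ "1::real"] stochastic_integral_zero)
qed

lemma K_set_lincomb:
  assumes M: "market P F d S" and f: "f \<in> K_set P F d S" and g: "g \<in> K_set P F d S"
    and ab: "0 \<le> a" "0 \<le> b"
  shows "(\<lambda>\<omega>. a * f \<omega> + b * g \<omega>) \<in> K_set P F d S"
proof -
  interpret usual_stochastic_basis P F by (rule market_basis[OF M])
  from f obtain H X c where f': "f \<in> borel_measurable P" "stochastic_integral P F d S H X"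
    "0 < c" "AE \<omega> in P. \<forall>t\<ge>0. - c \<le> X t \<omega>" "AE \<omega> in P. ((\<lambda>t. X t \<omega>) \<longlongrightarrow> f \<omega>) at_top"
    unfolding K_set_def by blast
  from g obtain G Z c' where g': "g \<in> borel_measurable P" "stochastic_integral P F d S G Z"
    "0 < c'" "AE \<omega> in P. \<forall>t\<ge>0. - c' \<le> Z t \<omega>" "AE \<omega> in P. ((\<lambda>t. Z t \<omega>) \<longlongrightarrow> g \<omega>) at_top"
    unfolding K_set_def by blast
  \<comment> \<open>The extra 1 keeps the admissibility bound strictly positive when
    \<open>a\<close> and \<open>b\<close> are both 0.\<close>
  have "AE \<omega> in P. \<forall>t\<ge>0. - (a * c + b * c' + 1) \<le> a * X t \<omega> + b * Z t \<omega>"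
    using f'(4) g'(4)
  proof eventually_elim
    case (elim \<omega>)
    have "- (a * c + b * c' + 1) \<le> a * X t \<omega> + b * Z t \<omega>" if "0 \<le> t" for t
    proof -
      have "- c \<le> X t \<omega>" "- c' \<le> Z t \<omega>" using elim that by auto
      then have "a * - c \<le> a * X t \<omega>" "b * - c' \<le> b * Z t \<omega>" using ab by (blast intro: mult_left_mono)+
      then show ?thesis by simp
    qed
    then show ?case by blast
  qed
  moreover have "0 < a * c + b * c' + 1" using ab f'(3) g'(3) by (simp add: add_nonneg_pos)
  moreover have "AE \<omega> in P. ((\<lambda>t. a * X t \<omega> + b * Z t \<omega>) \<longlongrightarrow> a * f \<omega> + b * g \<omega>) at_top"
    using f'(5) g'(5) by eventually_elim (intro tendsto_intros)
  moreover have "(\<lambda>\<omega>. a * f \<omega> + b * g \<omega>) \<in> borel_measurable P" using f'(1) g'(1) by simp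
  ultimately show ?thesis
    unfolding K_set_def
    using stochastic_integral_lincomb[OF market_basis(2)[OF M] f'(2) g'(2), of a b] by blast
qed

lemma Linfty_lincomb:
  assumes "f \<in> Linfty P" "g \<in> Linfty P"
  shows "(\<lambda>\<omega>. a * f \<omega> + b * g \<omega>) \<in> Linfty P"
proof -
  from assms obtain c c' where [measurable]: "f \<in> borel_measurable P" "g \<in> borel_measurable P"
    and "AE \<omega> in P. \<bar>f \<omega>\<bar> \<le> c" "AE \<omega> in P. \<bar>g \<omega>\<bar> \<le> c'"
    by (auto simp: Linfty_def)
  from this(3,4) have "AE \<omega> in P. \<bar>a * f \<omega> + b * g \<omega>\<bar> \<le> \<bar>a\<bar> * c + \<bar>b\<bar> * c'"
  proof eventually_elim
    case (elim \<omega>)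
    have "\<bar>a * f \<omega>\<bar> \<le> \<bar>a\<bar> * c" "\<bar>b * g \<omega>\<bar> \<le> \<bar>b\<bar> * c'"
      using elim by (auto simp: abs_mult intro: mult_left_mono)
    then show ?case by linarith
  qed
  then show ?thesis by (auto simp: Linfty_def)
qed

lemma C_set_lincomb:
  assumes M: "market P F d S" and f: "f \<in> C_set P F d S" and g: "g \<in> C_set P F d S"
    and ab: "0 \<le> a" "0 \<le> b"
  shows "(\<lambda>\<omega>. a * f \<omega> + b * g \<omega>) \<in> C_set P F d S"
proof -
  from f obtain k l where f': "f \<in> Linfty P" "k \<in> K_set P F d S" "l \<in> borel_measurable P"
    "AE \<omega> in P. 0 \<le> l \<omega>" "AE \<omega> in P. f \<omega> = k \<omega> - l \<omega>" unfolding C_set_def by blast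
  from g obtain k' l' where g': "g \<in> Linfty P" "k' \<in> K_set P F d S" "l' \<in> borel_measurable P"
    "AE \<omega> in P. 0 \<le> l' \<omega>" "AE \<omega> in P. g \<omega> = k' \<omega> - l' \<omega>" unfolding C_set_def by blast
  show ?thesis
    unfolding C_set_def
  proof (intro CollectI conjI bexI)
    show "AE \<omega> in P. 0 \<le> a * l \<omega> + b * l' \<omega>"
      using f'(4) g'(4) by eventually_elim (use ab in auto)
    show "AE \<omega> in P. a * f \<omega> + b * g \<omega> = (a * k \<omega> + b * k' \<omega>) - (a * l \<omega> + b * l' \<omega>)"
      using f'(5) g'(5) by eventually_elim (simp only: right_diff_distrib add_diff_add)
  qed (use f' g' ab in \<open>auto intro: Linfty_lincomb K_set_lincomb[OF M]\<close>)
qed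

text \<open>The zero strategy, with \<open>- f\<close> thrown away. These elements turn a functional
  that is nonpositive on the cone into a positive one.\<close>

lemma C_set_nonpos:
  assumes "market P F d S" "f \<in> Linfty P" "AE \<omega> in P. f \<omega> \<le> 0"
  shows "f \<in> C_set P F d S"
  unfolding C_set_def
proof (intro CollectI conjI bexI)
  show "(\<lambda>\<omega>. 0) \<in> K_set P F d S" by (rule K_set_zero[OF assms(1)])
  show "AE \<omega> in P. f \<omega> = 0 - (- f \<omega>)" by simp
  show "AE \<omega> in P. 0 \<le> - f \<omega>" using assms(3) by eventually_elim simp
qed (use assms in \<open>auto simp: Linfty_def\<close>)

section \<open>Separation\<close>

text \<open>Hahn--Banach: a maximal convex cone in \<open>X \<times> \<real>\<close> that contains the given epigraph \<open>E\<close> but not \<open>(0, - 1)\<close> is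
  a half-space, the epigraph of the required functional.\<close>

lemma epigraph_linear_minorant:
  fixes E :: "(('a \<Rightarrow> real) \<times> real) set"
  assumes zero: "(\<lambda>\<omega>. 0, 0) \<in> E" and up: "(\<lambda>\<omega>. 0, 1) \<in> E"
    and add: "\<And>x s y t. (x, s) \<in> E \<Longrightarrow> (y, t) \<in> E \<Longrightarrow> (\<lambda>\<omega>. x \<omega> + y \<omega>, s + t) \<in> E"
    and scale: "\<And>r x s. 0 < r \<Longrightarrow> (x, s) \<in> E \<Longrightarrow> (\<lambda>\<omega>. r * x \<omega>, r * s) \<in> E"
    and proper: "(\<lambda>\<omega>. 0, - 1) \<notin> E"
    and total: "\<And>x. x \<in> X \<Longrightarrow> \<exists>t. (x, t) \<in> E"
    and X: "\<And>x y. x \<in> X \<Longrightarrow> y \<in> X \<Longrightarrow> (\<lambda>\<omega>. x \<omega> + y \<omega>) \<in> X" "\<And>r x. x \<in> X \<Longrightarrow> (\<lambda>\<omega>. r * x \<omega>) \<in> X"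
  shows "\<exists>l. (\<forall>x\<in>X. \<forall>y\<in>X. l (\<lambda>\<omega>. x \<omega> + y \<omega>) = l x + l y) \<and> (\<forall>r. \<forall>x\<in>X. l (\<lambda>\<omega>. r * x \<omega>) = r * l x) \<and>
    (\<forall>x\<in>X. \<forall>t. (x, t) \<in> E \<longrightarrow> l x \<le> t)"
proof -
  define cone where "cone G \<longleftrightarrow>
    (\<forall>x s y t. (x, s) \<in> G \<longrightarrow> (y, t) \<in> G \<longrightarrow> (\<lambda>\<omega>. x \<omega> + y \<omega>, s + t) \<in> G) \<and>
    (\<forall>r x s. 0 < r \<longrightarrow> (x, s) \<in> G \<longrightarrow> (\<lambda>\<omega>. r * x \<omega>, r * s) \<in> G)" for G :: "(('a \<Rightarrow> real) \<times> real) set"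
  define \<A> where "\<A> = {G. E \<subseteq> G \<and> cone G \<and> (\<lambda>\<omega>. 0, - 1) \<notin> G}"
  have "E \<in> \<A>" using add scale proper by (auto simp: \<A>_def cone_def)
  moreover have "\<Union>\<C> \<in> \<A>" if ne: "\<C> \<noteq> {}" and ch: "subset.chain \<A> \<C>" for \<C>
  proof -
    have mem: "G \<in> \<A>" if "G \<in> \<C>" for G using ch that by (auto simp: subset.chain_def)
    have le: "G \<subseteq> G' \<or> G' \<subseteq> G" if "G \<in> \<C>" "G' \<in> \<C>" for G G'
      using ch that by (auto simp: subset.chain_def)
    have "cone (\<Union>\<C>)"
      unfolding cone_def
    proof (intro conjI allI impI)
      fix x y s t assume "(x, s) \<in> \<Union>\<C>" "(y, t) \<in> \<Union>\<C>"
      then obtain G G' where "G \<in> \<C>" "G' \<in> \<C>" "(x, s) \<in> G" "(y, t) \<in> G'" by blast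
      then obtain G'' where "G'' \<in> \<C>" "(x, s) \<in> G''" "(y, t) \<in> G''" using le by blast
      moreover from this have "(\<lambda>\<omega>. x \<omega> + y \<omega>, s + t) \<in> G''"
        using mem[of G''] by (simp add: \<A>_def cone_def)
      ultimately show "(\<lambda>\<omega>. x \<omega> + y \<omega>, s + t) \<in> \<Union>\<C>" by blast
    next
      fix r :: real and x s assume r: "0 < r" and "(x, s) \<in> \<Union>\<C>"
      then obtain G where G: "G \<in> \<C>" "(x, s) \<in> G" by blast
      then have "(\<lambda>\<omega>. r * x \<omega>, r * s) \<in> G" using mem[of G] r by (simp add: \<A>_def cone_def)
      with G show "(\<lambda>\<omega>. r * x \<omega>, r * s) \<in> \<Union>\<C>" by blast
    qed
    then show ?thesis using mem ne by (auto simp: \<A>_def)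
  qed
  ultimately have "\<exists>M\<in>\<A>. \<forall>G\<in>\<A>. M \<subseteq> G \<longrightarrow> G = M"
    by (intro subset_Zorn_nonempty) auto
  then obtain M where M: "M \<in> \<A>" and max: "\<And>G. G \<in> \<A> \<Longrightarrow> M \<subseteq> G \<Longrightarrow> G = M" by blast
  have EM: "E \<subseteq> M" and M_proper: "(\<lambda>\<omega>. 0, - 1) \<notin> M"
    and M_add: "\<And>x s y t. (x, s) \<in> M \<Longrightarrow> (y, t) \<in> M \<Longrightarrow> (\<lambda>\<omega>. x \<omega> + y \<omega>, s + t) \<in> M"
    and M_scale: "\<And>r x s. 0 < r \<Longrightarrow> (x, s) \<in> M \<Longrightarrow> (\<lambda>\<omega>. r * x \<omega>, r * s) \<in> M"
    using M by (auto simp: \<A>_def cone_def)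
  have M_up: "(x, t + r) \<in> M" if "(x, t) \<in> M" "0 \<le> r" for x t r
  proof (cases "r = 0")
    case False
    then have "(\<lambda>\<omega>. r * 0, r * 1) \<in> M" using EM up that by (intro M_scale) auto
    from M_add[OF that(1) this] show ?thesis by simp
  qed (use that in simp)
  have M_nonneg: "0 \<le> t" if "(\<lambda>\<omega>. 0, t) \<in> M" for t
  proof (rule ccontr)
    assume "\<not> 0 \<le> t"
    then have "(\<lambda>\<omega>. (1 / - t) * 0, (1 / - t) * t) \<in> M" using that by (intro M_scale) auto
    then show False using M_proper \<open>\<not> 0 \<le> t\<close> by simp
  qed
  \<comment> \<open>Adjoin the ray through \<open>(x, t)\<close>. By maximality the enlarged cone
    contains \<open>(0, - 1) = (y, s) + r * (x, t)\<close> with \<open>(y, s)\<close> in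
    \<open>M\<close>, and \<open>r > 0\<close> because \<open>M\<close> is proper. Division by
    \<open>r\<close> puts \<open>(- x, - t - 1 / r)\<close> into \<open>M\<close>, and
    \<open>M\<close> is closed upwards.\<close>
  have M_half: "(\<lambda>\<omega>. - x \<omega>, - t) \<in> M" if "(x, t) \<notin> M" for x t
  proof -
    define G where "G = {p. \<exists>y s r. p = (\<lambda>\<omega>. y \<omega> + r * x \<omega>, s + r * t) \<and> (y, s) \<in> M \<and> 0 \<le> r}"
    have MG: "M \<subseteq> G"
    proof
      fix p assume "p \<in> M"
      then show "p \<in> G" unfolding G_def by (intro CollectI exI[of _ "fst p"] exI[of _ "snd p"] exI[of _ 0]) simp
    qed
    have "(x, t) \<in> G"
      unfolding G_def using EM zero
      by (intro CollectI exI[of _ "\<lambda>\<omega>. 0"] exI[of _ 0] exI[of _ "1::real"]) auto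
    then have "G \<notin> \<A>" using max[OF _ MG] that by auto
    moreover have "cone G"
      unfolding cone_def
    proof (intro conjI allI impI)
      fix y1 y2 s1 s2 assume "(y1, s1) \<in> G" "(y2, s2) \<in> G"
      then obtain z1 u1 r1 z2 u2 r2 where
        *: "y1 = (\<lambda>\<omega>. z1 \<omega> + r1 * x \<omega>)" "s1 = u1 + r1 * t" "(z1, u1) \<in> M" "0 \<le> r1"
        "y2 = (\<lambda>\<omega>. z2 \<omega> + r2 * x \<omega>)" "s2 = u2 + r2 * t" "(z2, u2) \<in> M" "0 \<le> r2"
        unfolding G_def by auto
      show "(\<lambda>\<omega>. y1 \<omega> + y2 \<omega>, s1 + s2) \<in> G"
        unfolding G_def using M_add[OF *(3) *(7)] *
        by (intro CollectI exI[of _ "\<lambda>\<omega>. z1 \<omega> + z2 \<omega>"] exI[of _ "u1 + u2"] exI[of _ "r1 + r2"])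
          (auto simp: algebra_simps)
    next
      fix q :: real and y s assume "0 < q" "(y, s) \<in> G"
      then obtain z u r where *: "y = (\<lambda>\<omega>. z \<omega> + r * x \<omega>)" "s = u + r * t" "(z, u) \<in> M" "0 \<le> r"
        unfolding G_def by auto
      show "(\<lambda>\<omega>. q * y \<omega>, q * s) \<in> G"
        unfolding G_def using M_scale[OF \<open>0 < q\<close> *(3)] * \<open>0 < q\<close>
        by (intro CollectI exI[of _ "\<lambda>\<omega>. q * z \<omega>"] exI[of _ "q * u"] exI[of _ "q * r"])
          (auto simp: algebra_simps)
    qed
    ultimately have "(\<lambda>\<omega>. 0, - 1) \<in> G" using EM MG by (auto simp: \<A>_def)
    then obtain y s r where *: "(\<lambda>\<omega>. 0) = (\<lambda>\<omega>. y \<omega> + r * x \<omega>)" "- 1 = s + r * t" "(y, s) \<in> M" "0 \<le> r"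
      unfolding G_def by auto
    have y: "y = (\<lambda>\<omega>. - (r * x \<omega>))" using *(1) by (auto simp: fun_eq_iff add_eq_0_iff2)
    have "r \<noteq> 0" using * y M_proper by auto
    then have r: "0 < r" using *(4) by simp
    have s: "s = - 1 - r * t" using *(2) by simp
    have "(\<lambda>\<omega>. (1 / r) * y \<omega>, (1 / r) * s) \<in> M" using r *(3) by (intro M_scale) auto
    then have "(\<lambda>\<omega>. - x \<omega>, (1 / r) * s) \<in> M" using r by (simp add: y)
    from M_up[OF this, of "1 / r"] show ?thesis using r by (simp add: s field_simps)
  qed
  define l where "l x = Inf {t. (x, t) \<in> M}" for x
  have neg: "(\<lambda>\<omega>. - x \<omega>) \<in> X" if "x \<in> X" for x using X(2)[OF that, of "- 1"] by simp
  have ne: "{t. (x, t) \<in> M} \<noteq> {}" if "x \<in> X" for x using total[OF that] EM by auto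
  \<comment> \<open>A point of \<open>M\<close> over \<open>- x\<close> bounds the fibre over
    \<open>x\<close> from below, as their sum lies over 0, where \<open>M\<close> has no negative
    heights.\<close>
  have bdd: "bdd_below {t. (x, t) \<in> M}" if x: "x \<in> X" for x
  proof -
    obtain s where "(\<lambda>\<omega>. - x \<omega>, s) \<in> M" using ne[OF neg[OF x]] by auto
    then have "- s \<le> t" if "(x, t) \<in> M" for t
      using M_nonneg[of "t + s"] M_add[OF that, of "\<lambda>\<omega>. - x \<omega>" s] by simp
    then show ?thesis by (auto intro!: bdd_belowI)
  qed
  have l_le: "l x \<le> t" if "x \<in> X" "(x, t) \<in> M" for x t
    unfolding l_def using that bdd by (auto intro: cInf_lower)
  have l_ge: "c \<le> l x" if "x \<in> X" "\<And>t. (x, t) \<in> M \<Longrightarrow> c \<le> t" for x c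
    unfolding l_def by (rule cInf_greatest[OF ne[OF that(1)]]) (use that(2) in auto)
  have sub: "l (\<lambda>\<omega>. x \<omega> + y \<omega>) \<le> l x + l y" if xy: "x \<in> X" "y \<in> X" for x y
  proof -
    have "l (\<lambda>\<omega>. x \<omega> + y \<omega>) - l y \<le> l x"
    proof (rule l_ge[OF xy(1)])
      fix t assume t: "(x, t) \<in> M"
      have "l (\<lambda>\<omega>. x \<omega> + y \<omega>) - t \<le> l y"
        by (rule l_ge[OF xy(2)]) (use l_le[OF X(1)[OF xy] M_add[OF t]] in fastforce)
      then show "l (\<lambda>\<omega>. x \<omega> + y \<omega>) - l y \<le> t" by simp
    qed
    then show ?thesis by simp
  qed
  have l0: "l (\<lambda>\<omega>. 0) = 0" if "x \<in> X" for x
  proof (rule antisym)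
    have X0: "(\<lambda>\<omega>. 0) \<in> X" using X(2)[OF that, of 0] by simp
    show "l (\<lambda>\<omega>. 0) \<le> 0" using l_le[OF X0] EM zero by blast
    show "0 \<le> l (\<lambda>\<omega>. 0)" by (rule l_ge[OF X0 M_nonneg])
  qed
  have l_neg: "l (\<lambda>\<omega>. - x \<omega>) = - l x" if x: "x \<in> X" for x
  proof (rule antisym)
    \<comment> \<open>Heights below \<open>l x\<close> are outside \<open>M\<close>, so
      \<open>M_half\<close> puts their negatives into the fibre over \<open>- x\<close>. This is the
      step from sublinear to linear.\<close>
    have "l (\<lambda>\<omega>. - x \<omega>) \<le> - t" if "t < l x" for t
      using l_le[OF x, of t] that M_half[of x t] by (intro l_le[OF neg[OF x]]) auto
    then show "l (\<lambda>\<omega>. - x \<omega>) \<le> - l x"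
      by (metis dense_ge minus_less_iff neg_less_iff_less minus_minus)
    show "- l x \<le> l (\<lambda>\<omega>. - x \<omega>)" using sub[OF x neg[OF x]] l0[OF x] by simp
  qed
  have l_add: "l (\<lambda>\<omega>. x \<omega> + y \<omega>) = l x + l y" if xy: "x \<in> X" "y \<in> X" for x y
    using sub[OF xy] sub[OF neg[OF xy(1)] neg[OF xy(2)]] l_neg[OF X(1)[OF xy]] l_neg[OF xy(1)] l_neg[OF xy(2)]
    by (simp add: algebra_simps)
  have pos_le: "l (\<lambda>\<omega>. r * x \<omega>) \<le> r * l x" if x: "x \<in> X" and r: "0 < r" for r x
  proof -
    have "l (\<lambda>\<omega>. r * x \<omega>) / r \<le> l x"
      by (rule l_ge[OF x]) (use l_le[OF X(2)[OF x] M_scale[OF r]] r in \<open>auto simp: field_simps\<close>)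
    then show ?thesis using r by (simp add: field_simps)
  qed
  have pos: "l (\<lambda>\<omega>. r * x \<omega>) = r * l x" if x: "x \<in> X" and r: "0 < r" for r x
  proof (rule antisym)
    have "l (\<lambda>\<omega>. (1 / r) * (r * x \<omega>)) \<le> (1 / r) * l (\<lambda>\<omega>. r * x \<omega>)"
      by (rule pos_le) (use x r X(2) in auto)
    then show "r * l x \<le> l (\<lambda>\<omega>. r * x \<omega>)" using r by (simp add: field_simps)
  qed (rule pos_le[OF that])
  have l_scale: "l (\<lambda>\<omega>. r * x \<omega>) = r * l x" if x: "x \<in> X" for r x
  proof -
    consider "0 < r" | "r = 0" | "r < 0" by linarith
    then show ?thesis
    proof cases
      case 3
      then show ?thesis using pos[OF neg[OF x], of "- r"] l_neg[OF x] by simp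
    qed (use pos[OF x] l0[OF x] in auto)
  qed
  show ?thesis using l_add l_scale l_le EM by blast
qed

lemma Linfty_mult_integrable:
  fixes y h :: "'a \<Rightarrow> real"
  assumes P: "prob_space P" and y: "y \<in> borel_measurable P" "AE \<omega> in P. \<bar>y \<omega>\<bar> \<le> c" and h: "integrable P h"
  shows "integrable P (\<lambda>\<omega>. y \<omega> * h \<omega>)" "\<bar>LINT \<omega>|P. y \<omega> * h \<omega>\<bar> \<le> c * (LINT \<omega>|P. \<bar>h \<omega>\<bar>)"
proof -
  note [measurable] = y(1) borel_measurable_integrable[OF h]
  have le: "AE \<omega> in P. \<bar>y \<omega> * h \<omega>\<bar> \<le> c * \<bar>h \<omega>\<bar>"
    using y(2) by eventually_elim (unfold abs_mult, rule mult_right_mono, auto)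
  show int: "integrable P (\<lambda>\<omega>. y \<omega> * h \<omega>)"
    by (rule Bochner_Integration.integrable_bound[of _ "\<lambda>\<omega>. c * \<bar>h \<omega>\<bar>"])
      (use h le in \<open>auto elim!: eventually_mono\<close>)
  have "\<bar>LINT \<omega>|P. y \<omega> * h \<omega>\<bar> \<le> (LINT \<omega>|P. \<bar>y \<omega> * h \<omega>\<bar>)" by (rule integral_abs_bound)
  also have "\<dots> \<le> (LINT \<omega>|P. c * \<bar>h \<omega>\<bar>)"
    by (rule integral_mono_AE) (use int h le in auto)
  finally show "\<bar>LINT \<omega>|P. y \<omega> * h \<omega>\<bar> \<le> c * (LINT \<omega>|P. \<bar>h \<omega>\<bar>)" by simp
qed

lemma const_in_Linfty: "(\<lambda>\<omega>. c) \<in> Linfty P"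
  by (auto simp: Linfty_def)

text \<open>\<open>p a\<close> describes the dilate \<open>a V\<close> of the polar and
  \<open>q b\<close> the dilate \<open>b D\<close>, including \<open>b = 0\<close>. \<open>E\<close>
  is essentially the epigraph of the sublinear functional that takes \<open>x\<close> to the infimum
  of \<open>a - b\<close> over all decompositions of \<open>x\<close> in
  \<open>a V - b D + C\<close>. A linear minorant is at most 0 on \<open>C\<close>, at most 1 on
  \<open>V\<close> and at most \<open>- 1\<close> on \<open>- D\<close>. The functional is finite
  because \<open>V\<close> absorbs bounded functions, and it is not minus infinity because of
  \<open>disj\<close>.\<close>

lemma separating_functional:
  assumes P: "prob_space P" and Y: "young_function Y" and \<epsilon>: "0 < \<epsilon>"
    and C: "C \<subseteq> Linfty P" "\<And>f g a b. f \<in> C \<Longrightarrow> g \<in> C \<Longrightarrow> 0 \<le> a \<Longrightarrow> 0 \<le> b \<Longrightarrow> (\<lambda>\<omega>. a * f \<omega> + b * g \<omega>) \<in> C"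
      "(\<lambda>\<omega>. 0) \<in> C"
    and disj: "C \<inter> {\<lambda>\<omega>. w \<omega> + v \<omega> | w v. w \<in> D_set \<epsilon> P \<and> v \<in> orlicz_polar Y P} = {}"
  shows "\<exists>l. (\<forall>x\<in>Linfty P. \<forall>y\<in>Linfty P. l (\<lambda>\<omega>. x \<omega> + y \<omega>) = l x + l y) \<and>
    (\<forall>r. \<forall>x\<in>Linfty P. l (\<lambda>\<omega>. r * x \<omega>) = r * l x) \<and>
    (\<forall>f\<in>C. l f \<le> 0) \<and> (\<forall>w\<in>D_set \<epsilon> P. 1 \<le> l w) \<and> (\<forall>v\<in>orlicz_polar Y P. l v \<le> 1)"
proof -
  interpret prob_space P by fact
  define p where "p a y \<longleftrightarrow> y \<in> Linfty P \<and> (\<forall>h\<in>orlicz_ball Y P. \<bar>LINT \<omega>|P. y \<omega> * h \<omega>\<bar> \<le> a)" for a y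
  define q where "q b z \<longleftrightarrow> z \<in> Linfty P \<and> (AE \<omega> in P. 0 \<le> z \<omega> \<and> z \<omega> \<le> b) \<and> b * \<epsilon> \<le> integral\<^sup>L P z" for b z
  define E where "E = {(x, t). \<exists>a b y z c. p a y \<and> q b z \<and> c \<in> C \<and> x = (\<lambda>\<omega>. y \<omega> - z \<omega> + c \<omega>) \<and> a - b \<le> t}"
  from orlicz_ball_uniformly_integrable[OF Y, of 1] obtain T where
    T: "\<And>h A. h \<in> orlicz_ball Y P \<Longrightarrow> A \<in> sets P \<Longrightarrow>
      integrable P h \<and> (LINT \<omega>|P. \<bar>h \<omega>\<bar> * indicator A \<omega>) \<le> T * measure P A + 1" using P by auto
  have int_h: "integrable P h" "(LINT \<omega>|P. \<bar>h \<omega>\<bar>) \<le> T + 1" if "h \<in> orlicz_ball Y P" for h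
  proof -
    have "(LINT \<omega>|P. \<bar>h \<omega>\<bar> * indicator (space P) \<omega>) = (LINT \<omega>|P. \<bar>h \<omega>\<bar>)"
      by (intro Bochner_Integration.integral_cong) auto
    then show "integrable P h" "(LINT \<omega>|P. \<bar>h \<omega>\<bar>) \<le> T + 1"
      using T[OF that, of "space P"] by (auto simp: prob_space)
  qed
  have int_yh: "integrable P (\<lambda>\<omega>. y \<omega> * h \<omega>)" if "y \<in> Linfty P" "h \<in> orlicz_ball Y P" for y h
    using that Linfty_mult_integrable(1)[OF P _ _ int_h(1)] by (auto simp: Linfty_def)
  have int_z: "integrable P z" if "z \<in> Linfty P" for z
    using that Linfty_mult_integrable(1)[OF P, of z _ "\<lambda>\<omega>. 1"] by (auto simp: Linfty_def)
  have ball0: "(\<lambda>\<omega>. 0) \<in> orlicz_ball Y P"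
    using scaled_indicator_in_orlicz_ball[OF Y P, of "{}" 0] Y by (simp add: young_function_def)
  have p_nonneg: "0 \<le> a" if "p a y" for a y using that ball0 by (fastforce simp: p_def)
  have q_nonneg: "0 \<le> b" if "q b z" for b z
  proof -
    have "AE \<omega> in P. 0 \<le> z \<omega> \<and> z \<omega> \<le> b" using that by (simp only: q_def)
    then have "AE \<omega> in P. 0 \<le> b" by eventually_elim auto
    then show ?thesis by simp
  qed
  have p_add: "p (a + a') (\<lambda>\<omega>. y \<omega> + y' \<omega>)" if y: "p a y" "p a' y'" for a a' y y'
    unfolding p_def
  proof (intro conjI ballI)
    show "(\<lambda>\<omega>. y \<omega> + y' \<omega>) \<in> Linfty P" using Linfty_lincomb[of y P y' 1 1] y by (simp add: p_def)
    fix h assume h: "h \<in> orlicz_ball Y P"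
    have "(LINT \<omega>|P. (y \<omega> + y' \<omega>) * h \<omega>) = (LINT \<omega>|P. y \<omega> * h \<omega>) + (LINT \<omega>|P. y' \<omega> * h \<omega>)"
      using y by (simp add: distrib_right int_yh[OF _ h] p_def)
    moreover have "\<bar>LINT \<omega>|P. y \<omega> * h \<omega>\<bar> \<le> a" "\<bar>LINT \<omega>|P. y' \<omega> * h \<omega>\<bar> \<le> a'" using y h by (auto simp: p_def)
    ultimately show "\<bar>LINT \<omega>|P. (y \<omega> + y' \<omega>) * h \<omega>\<bar> \<le> a + a'" by linarith
  qed
  have p_scale: "p (r * a) (\<lambda>\<omega>. r * y \<omega>)" if y: "p a y" and r: "0 \<le> r" for a y r
    unfolding p_def
  proof (intro conjI ballI)
    show "(\<lambda>\<omega>. r * y \<omega>) \<in> Linfty P" using Linfty_lincomb[of y P y r 0] y by (simp add: p_def)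
    fix h assume h: "h \<in> orlicz_ball Y P"
    then have "\<bar>LINT \<omega>|P. y \<omega> * h \<omega>\<bar> \<le> a" using y by (simp add: p_def)
    then show "\<bar>LINT \<omega>|P. (r * y \<omega>) * h \<omega>\<bar> \<le> r * a" using r by (simp add: mult.assoc abs_mult mult_left_mono)
  qed
  have q_add: "q (b + b') (\<lambda>\<omega>. z \<omega> + z' \<omega>)" if z: "q b z" "q b' z'" for b b' z z'
    unfolding q_def
  proof (intro conjI)
    have zL: "z \<in> Linfty P" "z' \<in> Linfty P" using z by (auto simp: q_def)
    show "(\<lambda>\<omega>. z \<omega> + z' \<omega>) \<in> Linfty P" using Linfty_lincomb[OF zL, of 1 1] by simp
    have "AE \<omega> in P. 0 \<le> z \<omega> \<and> z \<omega> \<le> b" "AE \<omega> in P. 0 \<le> z' \<omega> \<and> z' \<omega> \<le> b'" using z by (simp_all only: q_def)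
    then show "AE \<omega> in P. 0 \<le> z \<omega> + z' \<omega> \<and> z \<omega> + z' \<omega> \<le> b + b'" by eventually_elim auto
    show "(b + b') * \<epsilon> \<le> (LINT \<omega>|P. z \<omega> + z' \<omega>)"
      using z int_z zL by (simp add: q_def distrib_right)
  qed
  have q_scale: "q (r * b) (\<lambda>\<omega>. r * z \<omega>)" if z: "q b z" and r: "0 \<le> r" for b z r
    unfolding q_def
  proof (intro conjI)
    have zL: "z \<in> Linfty P" using z by (auto simp: q_def)
    show "(\<lambda>\<omega>. r * z \<omega>) \<in> Linfty P" using Linfty_lincomb[OF zL zL, of r 0] by simp
    have "AE \<omega> in P. 0 \<le> z \<omega> \<and> z \<omega> \<le> b" using z by (simp only: q_def)
    then show "AE \<omega> in P. 0 \<le> r * z \<omega> \<and> r * z \<omega> \<le> r * b"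
      by eventually_elim (use r in \<open>auto intro: mult_left_mono\<close>)
    show "(r * b) * \<epsilon> \<le> (LINT \<omega>|P. r * z \<omega>)"
      using z r by (simp add: q_def mult.assoc mult_left_mono)
  qed
  have p0: "p 0 (\<lambda>\<omega>. 0)" and q0: "q 0 (\<lambda>\<omega>. 0)" by (auto simp: p_def q_def const_in_Linfty)
  have E_intro: "(\<lambda>\<omega>. y \<omega> - z \<omega> + c \<omega>, t) \<in> E" if "p a y" "q b z" "c \<in> C" "a - b \<le> t" for a b c y z t
    unfolding E_def using that by blast
  have "\<exists>l. (\<forall>x\<in>Linfty P. \<forall>y\<in>Linfty P. l (\<lambda>\<omega>. x \<omega> + y \<omega>) = l x + l y) \<and>
    (\<forall>r. \<forall>x\<in>Linfty P. l (\<lambda>\<omega>. r * x \<omega>) = r * l x) \<and> (\<forall>x\<in>Linfty P. \<forall>t. (x, t) \<in> E \<longrightarrow> l x \<le> t)"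
  proof (rule epigraph_linear_minorant)
    show "(\<lambda>\<omega>. 0, 0) \<in> E" "(\<lambda>\<omega>. 0, 1) \<in> E" using E_intro[OF p0 q0 C(3)] by auto
  next
    fix x s y t assume "(x, s) \<in> E" "(y, t) \<in> E"
    then obtain a b v z c a' b' v' z' c' where
      *: "p a v" "q b z" "c \<in> C" "x = (\<lambda>\<omega>. v \<omega> - z \<omega> + c \<omega>)" "a - b \<le> s"
      "p a' v'" "q b' z'" "c' \<in> C" "y = (\<lambda>\<omega>. v' \<omega> - z' \<omega> + c' \<omega>)" "a' - b' \<le> t"
      unfolding E_def by blast
    from E_intro[OF p_add[OF *(1,6)] q_add[OF *(2,7)] C(2)[OF *(3,8), of 1 1], of "s + t"]
    show "(\<lambda>\<omega>. x \<omega> + y \<omega>, s + t) \<in> E" using * by (simp add: algebra_simps)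
  next
    fix r :: real and x s assume r: "0 < r" and "(x, s) \<in> E"
    then obtain a b v z c where
      *: "p a v" "q b z" "c \<in> C" "x = (\<lambda>\<omega>. v \<omega> - z \<omega> + c \<omega>)" "a - b \<le> s"
      unfolding E_def by blast
    have "r * (a - b) \<le> r * s" using * r by simp
    with E_intro[OF p_scale[OF *(1), of r] q_scale[OF *(2), of r] C(2)[OF *(3,3), of r 0], of "r * s"]
    show "(\<lambda>\<omega>. r * x \<omega>, r * s) \<in> E" using * r by (simp add: algebra_simps)
  next
    show "(\<lambda>\<omega>. 0, - 1) \<notin> E"
    proof
      assume "(\<lambda>\<omega>. 0, - 1) \<in> E"
      then obtain a b v z c where
        *: "p a v" "q b z" "c \<in> C" "(\<lambda>\<omega>. 0) = (\<lambda>\<omega>. v \<omega> - z \<omega> + c \<omega>)" "a - b \<le> - 1"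
        unfolding E_def by blast
      \<comment> \<open>From \<open>0 = v - z + c\<close> with \<open>a \<le> b - 1\<close>,
        division by \<open>b\<close> gives \<open>c / b = z / b - v / b\<close>. The first term is
        in \<open>D\<close>, and the second is in \<open>V\<close> because
        \<open>a / b \<le> 1\<close>, which contradicts \<open>disj\<close>.\<close>
      have ab: "0 \<le> a" "a \<le> b" "0 < b" using p_nonneg[OF *(1)] *(5) by auto
      have "q 1 (\<lambda>\<omega>. (1 / b) * z \<omega>)" using q_scale[OF *(2), of "1 / b"] ab by simp
      then have w: "(\<lambda>\<omega>. (1 / b) * z \<omega>) \<in> D_set \<epsilon> P" by (simp add: q_def D_set_def)
      have "p (a / b) (\<lambda>\<omega>. - ((1 / b) * v \<omega>))"
      proof -
        have "p (a / b) (\<lambda>\<omega>. (1 / b) * v \<omega>)" using p_scale[OF *(1), of "1 / b"] ab by simp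
        then show ?thesis
          using Linfty_lincomb[of v P v "- (1 / b)" 0] *(1) by (simp add: p_def)
      qed
      moreover have "a / b \<le> 1" using ab by simp
      ultimately have v: "(\<lambda>\<omega>. - ((1 / b) * v \<omega>)) \<in> orlicz_polar Y P"
        unfolding p_def orlicz_polar_def using order_trans by blast
      have "(\<lambda>\<omega>. (1 / b) * c \<omega> + 0 * c \<omega>) \<in> C" using ab by (intro C(2) *(3)) auto
      moreover have "(\<lambda>\<omega>. (1 / b) * c \<omega> + 0 * c \<omega>) = (\<lambda>\<omega>. (1 / b) * z \<omega> + - ((1 / b) * v \<omega>))"
      proof
        fix \<omega>
        have "c \<omega> = z \<omega> - v \<omega>" using fun_cong[OF *(4), of \<omega>] by simp
        then show "(1 / b) * c \<omega> + 0 * c \<omega> = (1 / b) * z \<omega> + - ((1 / b) * v \<omega>)" by (simp add: diff_divide_distrib)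
      qed
      ultimately have "(\<lambda>\<omega>. (1 / b) * z \<omega> + - ((1 / b) * v \<omega>)) \<in> C" by metis
      moreover have "(\<lambda>\<omega>. (1 / b) * z \<omega> + - ((1 / b) * v \<omega>)) \<in>
          {\<lambda>\<omega>. w \<omega> + v \<omega> | w v. w \<in> D_set \<epsilon> P \<and> v \<in> orlicz_polar Y P}"
        by (intro CollectI exI[of _ "\<lambda>\<omega>. (1 / b) * z \<omega>"] exI[of _ "\<lambda>\<omega>. - ((1 / b) * v \<omega>)"] conjI refl w v)
      ultimately show False 
        by (rule disjoint_iff[THEN iffD1, OF disj, rule_format, THEN notE])
    qed
  next
    fix x assume x: "x \<in> Linfty P"
    then obtain c where c: "x \<in> borel_measurable P" "AE \<omega> in P. \<bar>x \<omega>\<bar> \<le> c" by (auto simp: Linfty_def)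
    have "AE \<omega> in P. 0 \<le> c" using c(2) by eventually_elim auto
    then have "0 \<le> c" by simp
    \<comment> \<open>This is the absorption property: the Orlicz ball is bounded in
      \<open>L^1\<close> by \<open>T + 1\<close>.\<close>
    have "p (c * (T + 1)) x"
      unfolding p_def
    proof (intro conjI ballI x)
      fix h assume h: "h \<in> orlicz_ball Y P"
      have "\<bar>LINT \<omega>|P. x \<omega> * h \<omega>\<bar> \<le> c * (LINT \<omega>|P. \<bar>h \<omega>\<bar>)"
        by (rule Linfty_mult_integrable(2)[OF P c int_h(1)[OF h]])
      also have "\<dots> \<le> c * (T + 1)" using int_h(2)[OF h] \<open>0 \<le> c\<close> by (intro mult_left_mono)
      finally show "\<bar>LINT \<omega>|P. x \<omega> * h \<omega>\<bar> \<le> c * (T + 1)" .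
    qed
    from E_intro[OF this q0 C(3) order_refl] show "\<exists>t. (x, t) \<in> E" by auto
  next
    show "(\<lambda>\<omega>. x \<omega> + y \<omega>) \<in> Linfty P" if "x \<in> Linfty P" "y \<in> Linfty P" for x y
      using Linfty_lincomb[OF that, of 1 1] by simp
    show "(\<lambda>\<omega>. r * x \<omega>) \<in> Linfty P" if "x \<in> Linfty P" for r x
      using Linfty_lincomb[OF that that, of r 0] by simp
  qed
  then obtain l where l: "\<forall>x\<in>Linfty P. \<forall>y\<in>Linfty P. l (\<lambda>\<omega>. x \<omega> + y \<omega>) = l x + l y"
    "\<forall>r. \<forall>x\<in>Linfty P. l (\<lambda>\<omega>. r * x \<omega>) = r * l x" "\<And>x t. x \<in> Linfty P \<Longrightarrow> (x, t) \<in> E \<Longrightarrow> l x \<le> t" by blast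
  have "l f \<le> 0" if "f \<in> C" for f
    using E_intro[OF p0 q0 that] that C(1) by (intro l(3)) auto
  moreover have "l v \<le> 1" if "v \<in> orlicz_polar Y P" for v
    using E_intro[OF _ q0 C(3), of 1 v 1] that by (intro l(3)) (auto simp: p_def orlicz_polar_def)
  moreover have "1 \<le> l w" if "w \<in> D_set \<epsilon> P" for w
  proof -
    have wL: "w \<in> Linfty P" using that by (simp add: D_set_def)
    have "(\<lambda>\<omega>. - w \<omega>, - 1) \<in> E"
      using E_intro[OF p0 _ C(3), of 1 w "- 1"] that by (auto simp: q_def D_set_def)
    then have "l (\<lambda>\<omega>. - w \<omega>) \<le> - 1" using Linfty_lincomb[OF wL wL, of "- 1" 0] by (intro l(3)) auto
    then show ?thesis using l(2)[rule_format, OF wL, of "- 1"] by simp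
  qed
  ultimately show ?thesis using l(1,2) by blast
qed

section \<open>States on bounded random variables and the measures they induce\<close>

text \<open>In other terms, a finitely additive probability absolutely continuous with respect to
  \<open>P\<close>. Positivity is required for almost surely nonnegative functions, so that
  \<open>l\<close> respects almost sure equality although it acts on functions rather than
  classes.\<close>

definition linfty_state :: "'a measure \<Rightarrow> (('a \<Rightarrow> real) \<Rightarrow> real) \<Rightarrow> bool" where
  "linfty_state P l \<longleftrightarrow>
     (\<forall>x\<in>Linfty P. \<forall>y\<in>Linfty P. l (\<lambda>\<omega>. x \<omega> + y \<omega>) = l x + l y) \<and>
     (\<forall>r. \<forall>x\<in>Linfty P. l (\<lambda>\<omega>. r * x \<omega>) = r * l x) \<and>
     (\<forall>x\<in>Linfty P. (AE \<omega> in P. 0 \<le> x \<omega>) \<longrightarrow> 0 \<le> l x) \<and> l (\<lambda>\<omega>. 1) = 1"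

lemma linfty_state_add: "linfty_state P l \<Longrightarrow> x \<in> Linfty P \<Longrightarrow> y \<in> Linfty P \<Longrightarrow> l (\<lambda>\<omega>. x \<omega> + y \<omega>) = l x + l y"
  and linfty_state_scale: "linfty_state P l \<Longrightarrow> x \<in> Linfty P \<Longrightarrow> l (\<lambda>\<omega>. r * x \<omega>) = r * l x"
  and linfty_state_nonneg: "linfty_state P l \<Longrightarrow> x \<in> Linfty P \<Longrightarrow> (AE \<omega> in P. 0 \<le> x \<omega>) \<Longrightarrow> 0 \<le> l x"
  and linfty_state_one: "linfty_state P l \<Longrightarrow> l (\<lambda>\<omega>. 1) = 1"
  by (auto simp: linfty_state_def)

lemma indicator_in_Linfty: "A \<in> sets P \<Longrightarrow> indicator A \<in> Linfty P"
  by (auto simp: Linfty_def indicator_def intro!: exI[of _ 1])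

lemma linfty_state_mono:
  assumes l: "linfty_state P l" and x: "x \<in> Linfty P" and y: "y \<in> Linfty P" and le: "AE \<omega> in P. x \<omega> \<le> y \<omega>"
  shows "l x \<le> l y"
proof -
  have "(\<lambda>\<omega>. y \<omega> + (- 1) * x \<omega>) \<in> Linfty P" using Linfty_lincomb[OF y x, of 1 "- 1"] by simp
  moreover have "AE \<omega> in P. 0 \<le> y \<omega> + (- 1) * x \<omega>" using le by eventually_elim simp
  ultimately have "0 \<le> l (\<lambda>\<omega>. y \<omega> + (- 1) * x \<omega>)" by (rule linfty_state_nonneg[OF l])
  also have "\<dots> = l y + (- 1) * l x"
    using linfty_state_add[OF l y, of "\<lambda>\<omega>. (- 1) * x \<omega>"] linfty_state_scale[OF l x, of "- 1"]
      Linfty_lincomb[OF x x, of "- 1" 0] by simp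
  finally show ?thesis by simp
qed

lemma linfty_state_const:
  assumes "linfty_state P l"
  shows "l (\<lambda>\<omega>. c) = c"
  using linfty_state_scale[OF assms const_in_Linfty[of 1], of c] linfty_state_one[OF assms] by simp

text \<open>Shift by the constant \<open>c\<close> and use monotonicity. With \<open>c = 0\<close>
  this identifies almost surely equal functions.\<close>

lemma linfty_state_close:
  assumes l: "linfty_state P l" and x: "x \<in> Linfty P" and y: "y \<in> Linfty P"
    and le: "AE \<omega> in P. \<bar>x \<omega> - y \<omega>\<bar> \<le> c"
  shows "\<bar>l x - l y\<bar> \<le> c"
proof -
  have shift: "l (\<lambda>\<omega>. z \<omega> + c) = l z + c" "(\<lambda>\<omega>. z \<omega> + c) \<in> Linfty P" if "z \<in> Linfty P" for z
    using linfty_state_add[OF l that const_in_Linfty[of c]] linfty_state_const[OF l]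
      Linfty_lincomb[OF that const_in_Linfty[of c], of 1 1] by auto
  have "l x \<le> l (\<lambda>\<omega>. y \<omega> + c)"
    by (rule linfty_state_mono[OF l x shift(2)[OF y]]) (use le in eventually_elim, auto)
  moreover have "l y \<le> l (\<lambda>\<omega>. x \<omega> + c)"
    by (rule linfty_state_mono[OF l y shift(2)[OF x]]) (use le in eventually_elim, auto)
  ultimately show ?thesis using shift(1)[OF x] shift(1)[OF y] by linarith
qed

lemma linfty_state_sum:
  assumes l: "linfty_state P l" and "finite I" "\<And>i. i \<in> I \<Longrightarrow> x i \<in> Linfty P"
  shows "(\<lambda>\<omega>. \<Sum>i\<in>I. x i \<omega>) \<in> Linfty P \<and> l (\<lambda>\<omega>. \<Sum>i\<in>I. x i \<omega>) = (\<Sum>i\<in>I. l (x i))"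
  using assms(2,3)
proof (induction I rule: finite_induct)
  case empty
  then show ?case using linfty_state_const[OF l, of 0] const_in_Linfty[of 0] by simp
next
  case (insert i I)
  then have IH: "(\<lambda>\<omega>. \<Sum>i\<in>I. x i \<omega>) \<in> Linfty P" "l (\<lambda>\<omega>. \<Sum>i\<in>I. x i \<omega>) = (\<Sum>i\<in>I. l (x i))"
    and i: "x i \<in> Linfty P" by auto
  show ?case
    using linfty_state_add[OF l i IH(1)] Linfty_lincomb[OF i IH(1), of 1 1] IH(2) insert(1,2) by simp
qed

lemma linfty_state_indicator_bounds:
  assumes l: "linfty_state P l" and A: "A \<in> sets P"
  shows "0 \<le> l (indicator A)" "l (indicator A) \<le> 1"
proof -
  show "0 \<le> l (indicator A)" by (rule linfty_state_nonneg[OF l indicator_in_Linfty[OF A]]) simp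
  have "l (indicator A) \<le> l (\<lambda>\<omega>. 1)"
    by (rule linfty_state_mono[OF l indicator_in_Linfty[OF A] const_in_Linfty]) (simp add: indicator_def)
  then show "l (indicator A) \<le> 1" using linfty_state_one[OF l] by simp
qed

text \<open>\<open>cont\<close> is continuity at the empty set, which upgrades finite to countable
  additivity. The integral agrees with \<open>l\<close> on step functions by construction, and on
  all bounded functions because both are contractions for the essential supremum distance.\<close>

lemma linfty_state_measure:
  assumes P: "prob_space P" and l: "linfty_state P l"
    and cont: "\<And>A. range A \<subseteq> sets P \<Longrightarrow> decseq A \<Longrightarrow> (\<Inter>i. A i) = {} \<Longrightarrow> (\<lambda>i. l (indicator (A i))) \<longlonglongrightarrow> 0"
  obtains R where "prob_space R" "sets R = sets P" "absolutely_continuous P R"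
    "\<And>f. f \<in> Linfty P \<Longrightarrow> integrable R f \<and> integral\<^sup>L R f = l f"
proof -
  interpret P: prob_space P by fact
  define R where "R = measure_of (space P) (sets P) (\<lambda>A. ennreal (l (indicator A)))"
  have sp: "space R = space P" and sets_R: "sets R = sets P" by (auto simp: R_def)
  note bounds = linfty_state_indicator_bounds[OF l]
  have "(indicator {} :: 'a \<Rightarrow> real) = (\<lambda>\<omega>. 0)" by (simp add: fun_eq_iff)
  then have empty: "l (indicator {}) = 0" using linfty_state_const[OF l, of 0] by simp
  have "countably_additive (sets P) (\<lambda>A. ennreal (l (indicator A)))"
  proof (rule sets.empty_continuous_imp_countably_additive)
    show "positive (sets P) (\<lambda>A. ennreal (l (indicator A)))"
      using empty by (simp add: positive_def)
    show "additive (sets P) (\<lambda>A. ennreal (l (indicator A)))"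
      unfolding additive_def
    proof (intro ballI impI)
      fix A B assume AB: "A \<in> sets P" "B \<in> sets P" "A \<inter> B = {}"
      have "indicator (A \<union> B) = (\<lambda>\<omega>. indicator A \<omega> + indicator B \<omega> :: real)"
        using AB(3) by (auto simp: indicator_def fun_eq_iff)
      then have "l (indicator (A \<union> B)) = l (indicator A) + l (indicator B)"
        using linfty_state_add[OF l indicator_in_Linfty[OF AB(1)] indicator_in_Linfty[OF AB(2)]] by simp
      then show "ennreal (l (indicator (A \<union> B))) = ennreal (l (indicator A)) + ennreal (l (indicator B))"
        using bounds AB by simp
    qed
    show "\<forall>A\<in>sets P. ennreal (l (indicator A)) \<noteq> \<infinity>" by simp
    show "(\<lambda>i. ennreal (l (indicator (A i)))) \<longlonglongrightarrow> 0"
      if "range A \<subseteq> sets P" "decseq A" "(\<Inter>i. A i) = {}" for A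
      using tendsto_ennrealI[OF cont[OF that]] by simp
  qed
  then have em: "emeasure R A = ennreal (l (indicator A))" if "A \<in> sets P" for A
    using emeasure_measure_of_sigma[OF sets.sigma_algebra_axioms _ _ that, of "\<lambda>A. ennreal (l (indicator A))"]
      empty by (simp add: R_def positive_def)
  have meas: "measure R A = l (indicator A)" if "A \<in> sets P" for A
    using em[OF that] bounds[OF that] by (simp add: measure_def)
  have R_null: "A \<in> null_sets R" if "A \<in> null_sets P" for A
  proof -
    have A: "A \<in> sets P" using that by auto
    have "l (indicator A) \<le> l (\<lambda>\<omega>. 0)"
      by (rule linfty_state_mono[OF l indicator_in_Linfty[OF A] const_in_Linfty])
        (use AE_not_in[OF that] in \<open>auto simp: indicator_def elim!: eventually_mono\<close>)
    then have "l (indicator A) = 0" using bounds[OF A] linfty_state_const[OF l, of 0] by simp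
    then show ?thesis using em[OF A] A sets_R by (simp add: null_sets_def)
  qed
  then have ac: "absolutely_continuous P R" by (auto simp: absolutely_continuous_def)
  have "l (indicator (space P)) = 1"
  proof -
    have "\<bar>l (indicator (space P)) - l (\<lambda>\<omega>. 1)\<bar> \<le> 0"
      by (rule linfty_state_close[OF l indicator_in_Linfty const_in_Linfty]) auto
    then show ?thesis using linfty_state_one[OF l] by simp
  qed
  then have R: "prob_space R"
    by (intro prob_spaceI) (simp add: sp em)
  interpret R: prob_space R by (rule R)
  have integral: "integrable R f \<and> integral\<^sup>L R f = l f" if f: "f \<in> Linfty P" for f
  proof -
    have [measurable]: "f \<in> borel_measurable P" using f by (simp add: Linfty_def)
    have [measurable]: "f \<in> borel_measurable R" 
      using measurable_cong_sets[OF sets_R refl, of borel] \<open>f \<in> borel_measurable P\<close> by blast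
    have AE_R: "AE \<omega> in R. Q \<omega>" if "AE \<omega> in P. Q \<omega>" for Q
      using absolutely_continuous_AE[OF sets_R ac that] .
    obtain c where c: "AE \<omega> in P. \<bar>f \<omega>\<bar> \<le> c" using f by (auto simp: Linfty_def)
    have int_f: "integrable R f"
      by (rule R.integrable_const_bound[of _ c]) (use AE_R[OF c] in auto)
    have "\<bar>integral\<^sup>L R f - l f\<bar> \<le> 2 / real (Suc n)" for n
    proof -
      define N where "N = real (Suc n)"
      have N: "0 < N" by (simp add: N_def)
      define m where "m = \<lceil>N * c\<rceil> + 1"
      define B where "B j = {\<omega> \<in> space P. \<lfloor>N * f \<omega>\<rfloor> = j}" for j :: int
      \<comment> \<open>\<open>f\<close> rounded down to the grid of mesh \<open>1 / N\<close>; the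
        essential bound \<open>c\<close> leaves finitely many values. Integral and functional each
        contribute an error \<open>1 / N\<close>.\<close>
      define g where "g \<omega> = (\<Sum>j\<in>{- m..m}. (of_int j / N) * indicator (B j) \<omega>)" for \<omega>
      have B[measurable]: "B j \<in> sets P" for j unfolding B_def by measurable
      have BL: "(\<lambda>\<omega>. (of_int j / N) * indicator (B j) \<omega>) \<in> Linfty P" for j
        using Linfty_lincomb[OF indicator_in_Linfty[OF B] const_in_Linfty, of "of_int j / N" _ 0] by simp
      have gL: "g \<in> Linfty P" and lg: "l g = (\<Sum>j\<in>{- m..m}. (of_int j / N) * l (indicator (B j)))"
        using linfty_state_sum[OF l, of "{- m..m}" "\<lambda>j \<omega>. (of_int j / N) * indicator (B j) \<omega>"] BL
        by (simp_all only: g_def[abs_def] linfty_state_scale[OF l indicator_in_Linfty[OF B]]) auto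
      have int_B: "integrable R (\<lambda>\<omega>. (of_int j / N) * indicator (B j) \<omega>)" for j
        using B sets_R by (intro integrable_mult_right integrable_real_indicator) (auto simp: R.emeasure_eq_measure)
      have int_g: "integrable R g" and "integral\<^sup>L R g = (\<Sum>j\<in>{- m..m}. (of_int j / N) * measure R (B j))"
        using int_B B sets_R sets.sets_into_space[OF B] sp unfolding g_def[abs_def]
        by (auto intro!: Bochner_Integration.integrable_sum sum.cong simp: Int_absorb2)
      then have eq: "integral\<^sup>L R g = l g" using lg meas B by simp
      have close: "AE \<omega> in P. \<bar>f \<omega> - g \<omega>\<bar> \<le> 1 / N"
        using c AE_space
      proof eventually_elim
        case (elim \<omega>)
        define i where "i = \<lfloor>N * f \<omega>\<rfloor>"
        have "\<bar>N * f \<omega>\<bar> \<le> N * c" using elim N by (simp add: abs_mult)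
        then have "i \<in> {- m..m}" unfolding i_def m_def by simp linarith
        then have "g \<omega> = of_int i / N"
          unfolding g_def using elim
          by (subst sum.mono_neutral_right[of _ "{i}"]) (auto simp: B_def i_def indicator_def)
        moreover have "of_int i \<le> N * f \<omega>" "N * f \<omega> \<le> of_int i + 1" unfolding i_def by linarith+
        then have "of_int i / N \<le> f \<omega>" "f \<omega> \<le> of_int i / N + 1 / N" using N by (auto simp: field_simps)
        ultimately show ?case by linarith
      qed
      have "\<bar>l f - l g\<bar> \<le> 1 / N" by (rule linfty_state_close[OF l f gL close])
      moreover have "\<bar>integral\<^sup>L R f - integral\<^sup>L R g\<bar> \<le> 1 / N"
      proof -
        have "\<bar>integral\<^sup>L R f - integral\<^sup>L R g\<bar> = \<bar>LINT \<omega>|R. f \<omega> - g \<omega>\<bar>" using int_f int_g by simp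
        also have "\<dots> \<le> (LINT \<omega>|R. \<bar>f \<omega> - g \<omega>\<bar>)" by (rule integral_abs_bound)
        also have "\<dots> \<le> (LINT \<omega>|R. 1 / N)"
          by (rule integral_mono_AE) (use int_f int_g AE_R[OF close] in auto)
        finally show ?thesis by (simp add: R.prob_space)
      qed
      ultimately show ?thesis unfolding eq N_def[symmetric] by (simp add: field_simps)
    qed
    then have "\<bar>integral\<^sup>L R f - l f\<bar> \<le> 0"
      by (intro LIMSEQ_le_const[OF LIMSEQ_Suc[OF lim_const_over_n[of 2]]]) auto
    then show ?thesis using int_f by simp
  qed
  show thesis by (rule that[OF R sets_R ac integral])
qed

section \<open>Countable mixtures of states\<close>

lemma geometric_sums_one: "(\<lambda>k. (1/2::real) ^ Suc k) sums 1"
  using power_half_series by simp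

lemma geometric_mixture_summable:
  assumes "\<And>k. \<bar>a k\<bar> \<le> c"
  shows "summable (\<lambda>k. (1/2::real) ^ Suc k * a k)"
proof (rule summable_comparison_test'[of "\<lambda>k. c * (1/2) ^ Suc k" 0])
  show "summable (\<lambda>k. c * (1/2) ^ Suc k)"
    by (intro summable_mult sums_summable[OF geometric_sums_one])
  show "norm ((1/2) ^ Suc k * a k) \<le> c * (1/2) ^ Suc k" for k
    using assms[of k] by (simp add: abs_mult mult.commute mult_right_mono)
qed

lemma geometric_mixture_tendsto_zero:
  fixes a :: "nat \<Rightarrow> nat \<Rightarrow> real"
  assumes "\<And>k n. \<bar>a k n\<bar> \<le> 1" "\<And>k. a k \<longlonglongrightarrow> 0"
  shows "(\<lambda>n. \<Sum>k. (1/2) ^ Suc k * a k n) \<longlonglongrightarrow> 0"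
proof -
  have "(\<lambda>n. \<Sum>k. (1/2) ^ Suc k * a k n) \<longlonglongrightarrow> (\<Sum>k. (0::real))"
  proof (rule tannerys_theorem[THEN conjunct2, THEN conjunct2])
    show "(\<lambda>n. (1/2) ^ Suc k * a k n) \<longlonglongrightarrow> 0" for k
      using tendsto_mult_right_zero[OF assms(2)] by simp
    show "\<forall>\<^sub>F (k, n) in sequentially \<times>\<^sub>F sequentially. norm ((1/2) ^ Suc k * a k n) \<le> (1/2) ^ Suc k"
      using assms(1) by (intro always_eventually) (auto simp: abs_mult intro!: mult_left_le)
    show "summable (\<lambda>k. (1/2::real) ^ Suc k)" by (rule sums_summable[OF geometric_sums_one])
  qed simp
  then show ?thesis by simp
qed

lemma linfty_state_bounded:
  assumes l: "linfty_state P l" and x: "x \<in> Linfty P" and c: "AE \<omega> in P. \<bar>x \<omega>\<bar> \<le> c"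
  shows "\<bar>l x\<bar> \<le> c"
  using linfty_state_close[OF l x const_in_Linfty[of 0], of c] c linfty_state_const[OF l, of 0] by simp

lemma linfty_state_mixture_summable:
  assumes l: "\<And>k. linfty_state P (l k)" and x: "x \<in> Linfty P"
  shows "summable (\<lambda>k. (1/2) ^ Suc k * l k x)"
proof -
  obtain c where c: "AE \<omega> in P. \<bar>x \<omega>\<bar> \<le> c" using x by (auto simp: Linfty_def)
  show ?thesis by (rule geometric_mixture_summable) (rule linfty_state_bounded[OF l x c])
qed

lemma linfty_state_mixture:
  assumes l: "\<And>k. linfty_state P (l k)"
  shows "linfty_state P (\<lambda>x. \<Sum>k. (1/2) ^ Suc k * l k x)"
  unfolding linfty_state_def
proof (intro conjI ballI allI impI)
  note sm = linfty_state_mixture_summable[of P l, OF l]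
  fix x y assume x: "x \<in> Linfty P" and y: "y \<in> Linfty P"
  show "(\<Sum>k. (1/2) ^ Suc k * l k (\<lambda>\<omega>. x \<omega> + y \<omega>)) = (\<Sum>k. (1/2) ^ Suc k * l k x) + (\<Sum>k. (1/2) ^ Suc k * l k y)"
    by (subst suminf_add[OF sm[OF x] sm[OF y]]) (simp add: linfty_state_add[OF l x y] distrib_left)
next
  note sm = linfty_state_mixture_summable[of P l, OF l]
  fix r x assume x: "x \<in> Linfty P"
  show "(\<Sum>k. (1/2) ^ Suc k * l k (\<lambda>\<omega>. r * x \<omega>)) = r * (\<Sum>k. (1/2) ^ Suc k * l k x)"
    by (subst suminf_mult[OF sm[OF x], symmetric]) (simp add: linfty_state_scale[OF l x] mult_ac)
next
  note sm = linfty_state_mixture_summable[of P l, OF l]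
  fix x assume x: "x \<in> Linfty P" "AE \<omega> in P. 0 \<le> x \<omega>"
  show "0 \<le> (\<Sum>k. (1/2) ^ Suc k * l k x)"
    by (rule suminf_nonneg[OF sm[OF x(1)]]) (simp add: linfty_state_nonneg[OF l x])
next
  show "(\<Sum>k. (1/2) ^ Suc k * l k (\<lambda>\<omega>. 1)) = 1"
    using geometric_sums_one by (simp add: linfty_state_one[OF l] sums_iff)
qed

text \<open>The order of quantifiers is the point: \<open>K\<close> and \<open>\<kappa>\<close> are
  chosen before \<open>P\<close> and \<open>C\<close>, so the same constants serve all markets. The
  condition \<open>\<epsilon> \<le> 1\<close> puts the constant 1 into \<open>D_set\<close>, which
  allows normalization.\<close>

lemma separating_state:
  assumes Y: "young_function Y" and \<epsilon>: "0 < \<epsilon>" "\<epsilon> \<le> 1"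
  shows "\<exists>K>0. \<exists>\<kappa>. (\<forall>e>0. 0 < \<kappa> e) \<and> (\<forall>(P :: 'a measure) C. prob_space P \<longrightarrow> C \<subseteq> Linfty P \<longrightarrow>
    (\<forall>f\<in>C. \<forall>g\<in>C. \<forall>a\<ge>0. \<forall>b\<ge>0. (\<lambda>\<omega>. a * f \<omega> + b * g \<omega>) \<in> C) \<longrightarrow>
    (\<forall>f\<in>Linfty P. (AE \<omega> in P. f \<omega> \<le> 0) \<longrightarrow> f \<in> C) \<longrightarrow>
    C \<inter> {\<lambda>\<omega>. w \<omega> + v \<omega> | w v. w \<in> D_set \<epsilon> P \<and> v \<in> orlicz_polar Y P} = {} \<longrightarrow>
    (\<exists>l. linfty_state P l \<and> (\<forall>f\<in>C. l f \<le> 0) \<and> (\<forall>w\<in>D_set \<epsilon> P. 1 / K \<le> l w) \<and>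
      (\<forall>e>0. \<forall>A\<in>sets P. measure P A \<le> \<kappa> e \<longrightarrow> l (indicator A) \<le> e)))"
proof -
  have "\<exists>T\<ge>0. \<forall>(P :: 'a measure) h A. prob_space P \<longrightarrow> h \<in> orlicz_ball Y P \<longrightarrow> A \<in> sets P \<longrightarrow>
    integrable P h \<and> (LINT \<omega>|P. \<bar>h \<omega>\<bar> * indicator A \<omega>) \<le> T * measure P A + e" if "0 < e" for e
    using orlicz_ball_uniformly_integrable[OF Y that] .
  then obtain T where T0: "\<And>e. 0 < e \<Longrightarrow> 0 \<le> T e" and T: "\<And>e (P :: 'a measure) h A. 0 < e \<Longrightarrow> prob_space P \<Longrightarrow>
    h \<in> orlicz_ball Y P \<Longrightarrow> A \<in> sets P \<Longrightarrow>
    integrable P h \<and> (LINT \<omega>|P. \<bar>h \<omega>\<bar> * indicator A \<omega>) \<le> T e * measure P A + e"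
    by metis
  \<comment> \<open>\<open>K\<close> bounds the \<open>L^1\<close> norm on the Orlicz ball, so that
    \<open>1 / K\<close> on the whole space belongs to the polar.\<close>
  define K where "K = T 1 + 1"
  have K: "0 < K" using T0[of 1] by (simp add: K_def)
  \<comment> \<open>Chosen so that \<open>measure P A \<le> \<kappa> e\<close> implies
    \<open>T (e / 2) * measure P A + e / 2 \<le> e\<close>, which places \<open>1 / e\<close> times
    the indicator of \<open>A\<close> in the polar.\<close>
  define \<kappa> where "\<kappa> e = e / (2 * (T (e / 2) + 1))" for e
  have \<kappa>: "0 < \<kappa> e" if "0 < e" for e
    using T0[of "e / 2"] that by (auto simp: \<kappa>_def intro!: divide_pos_pos)
  have "\<exists>l. linfty_state P l \<and> (\<forall>f\<in>C. l f \<le> 0) \<and> (\<forall>w\<in>D_set \<epsilon> P. 1 / K \<le> l w) \<and>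
      (\<forall>e>0. \<forall>A\<in>sets P. measure P A \<le> \<kappa> e \<longrightarrow> l (indicator A) \<le> e)"
    if P: "prob_space P" and C: "C \<subseteq> Linfty P"
      "\<forall>f\<in>C. \<forall>g\<in>C. \<forall>a\<ge>0. \<forall>b\<ge>0. (\<lambda>\<omega>. a * f \<omega> + b * g \<omega>) \<in> C"
      "\<forall>f\<in>Linfty P. (AE \<omega> in P. f \<omega> \<le> 0) \<longrightarrow> f \<in> C"
      and disj: "C \<inter> {\<lambda>\<omega>. w \<omega> + v \<omega> | w v. w \<in> D_set \<epsilon> P \<and> v \<in> orlicz_polar Y P} = {}"
    for P :: "'a measure" and C
  proof -
    interpret prob_space P by fact
    obtain l where l: "\<forall>x\<in>Linfty P. \<forall>y\<in>Linfty P. l (\<lambda>\<omega>. x \<omega> + y \<omega>) = l x + l y"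
      "\<forall>r. \<forall>x\<in>Linfty P. l (\<lambda>\<omega>. r * x \<omega>) = r * l x" and lC: "\<And>f. f \<in> C \<Longrightarrow> l f \<le> 0"
      and lD: "\<And>w. w \<in> D_set \<epsilon> P \<Longrightarrow> 1 \<le> l w" and lV: "\<And>v. v \<in> orlicz_polar Y P \<Longrightarrow> l v \<le> 1"
      using separating_functional[OF P Y \<epsilon>(1) C(1) _ _ disj] C(2,3) const_in_Linfty[of 0 P] by auto
    have polar: "(\<lambda>\<omega>. (1 / c) * indicator A \<omega>) \<in> orlicz_polar Y P"
      if A: "A \<in> sets P" and c: "0 < c" "0 < e" "T e * measure P A + e \<le> c" for A c e
      unfolding orlicz_polar_def
    proof (intro CollectI conjI ballI)
      show "(\<lambda>\<omega>. (1 / c) * indicator A \<omega>) \<in> Linfty P"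
        using Linfty_lincomb[OF indicator_in_Linfty[OF A] const_in_Linfty, of "1 / c" _ 0] by simp
      fix h assume h: "h \<in> orlicz_ball Y P"
      have "\<bar>LINT \<omega>|P. (1 / c) * indicator A \<omega> * h \<omega>\<bar> \<le> (LINT \<omega>|P. \<bar>(1 / c) * indicator A \<omega> * h \<omega>\<bar>)"
        by (rule integral_abs_bound)
      also have "\<dots> = (LINT \<omega>|P. (1 / c) * (\<bar>h \<omega>\<bar> * indicator A \<omega>))"
        using c by (intro Bochner_Integration.integral_cong) (auto simp: abs_mult)
      also have "\<dots> = (1 / c) * (LINT \<omega>|P. \<bar>h \<omega>\<bar> * indicator A \<omega>)" by simp
      also have "\<dots> \<le> (1 / c) * c"
        using T[OF c(2) P h A] c by (intro mult_left_mono) auto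
      finally show "\<bar>LINT \<omega>|P. (1 / c) * indicator A \<omega> * h \<omega>\<bar> \<le> 1" using c by simp
    qed
    define L where "L = l (\<lambda>\<omega>. 1)"
    have oneL: "(\<lambda>\<omega>. 1) \<in> Linfty P" by (rule const_in_Linfty)
    have "(\<lambda>\<omega>. 1) \<in> D_set \<epsilon> P" using \<epsilon> oneL by (simp add: D_set_def prob_space)
    then have L1: "1 \<le> L" using lD by (simp add: L_def)
    \<comment> \<open>The indicator of \<open>space P\<close> and the constant 1 differ off the
      space, and \<open>l\<close> is not yet known to ignore this. Their difference and its negative
      are both almost surely nonpositive, hence in \<open>C\<close>, and so \<open>l\<close>
      vanishes on the difference.\<close>
    have eq_one: "l (\<lambda>\<omega>. (1 / K) * indicator (space P) \<omega>) = (1 / K) * L"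
    proof -
      have sp: "(indicator (space P) :: 'a \<Rightarrow> real) \<in> Linfty P" by (rule indicator_in_Linfty) simp
      have d: "(\<lambda>\<omega>. indicator (space P) \<omega> + - 1 :: real) \<in> Linfty P"
        using Linfty_lincomb[OF sp oneL, of 1 "- 1"] by simp
      then have d': "(\<lambda>\<omega>. - 1 * (indicator (space P) \<omega> + - 1) :: real) \<in> Linfty P"
        using Linfty_lincomb[OF d d, of "- 1" 0] by simp
      have "l (\<lambda>\<omega>. indicator (space P) \<omega> + - 1) \<le> 0"
        by (rule lC) (use C(3) d in \<open>auto simp: indicator_def\<close>)
      moreover have "l (\<lambda>\<omega>. - 1 * (indicator (space P) \<omega> + - 1)) \<le> 0"
        by (rule lC) (use C(3) d' in \<open>auto simp: indicator_def\<close>)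
      then have "0 \<le> l (\<lambda>\<omega>. indicator (space P) \<omega> + - 1)" using l(2)[rule_format, OF d, of "- 1"] by simp
      moreover have "l (\<lambda>\<omega>. indicator (space P) \<omega> + - 1) = l (indicator (space P)) + - 1 * L"
        using l(1)[rule_format, OF sp const_in_Linfty[of "- 1"]] l(2)[rule_format, OF oneL, of "- 1"]
        by (simp add: L_def)
      ultimately show ?thesis using l(2)[rule_format, OF sp, of "1 / K"] by simp
    qed
    have "l (\<lambda>\<omega>. (1 / K) * indicator (space P) \<omega>) \<le> 1"
      by (rule lV, rule polar[of "space P" K 1]) (use K in \<open>auto simp: prob_space K_def\<close>)
    then have "(1 / K) * L \<le> 1" unfolding eq_one .
    then have LK: "L \<le> K" using K by (simp add: field_simps)
    have nonneg: "0 \<le> l x" if x: "x \<in> Linfty P" "AE \<omega> in P. 0 \<le> x \<omega>" for x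
    proof -
      have "(\<lambda>\<omega>. - 1 * x \<omega>) \<in> Linfty P" using Linfty_lincomb[OF x(1) x(1), of "- 1" 0] by simp
      moreover have "AE \<omega> in P. - 1 * x \<omega> \<le> 0" using x(2) by eventually_elim simp
      ultimately have "l (\<lambda>\<omega>. - 1 * x \<omega>) \<le> 0" by (intro lC C(3)[rule_format])
      then show ?thesis using l(2)[rule_format, OF x(1), of "- 1"] by simp
    qed
    \<comment> \<open>Normalization costs at most the factor \<open>K\<close>, because
      \<open>1 \<le> L \<le> K\<close>.\<close>
    have "linfty_state P (\<lambda>x. l x / L)"
      unfolding linfty_state_def using l nonneg L1
      by (auto simp: add_divide_distrib L_def[symmetric])
    moreover have "l f / L \<le> 0" if "f \<in> C" for f
      using lC[OF that] L1 by (simp add: divide_nonpos_pos)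
    moreover have "1 / K \<le> l w / L" if "w \<in> D_set \<epsilon> P" for w
      using lD[OF that] L1 LK K by (intro frac_le) auto
    moreover have "l (indicator A) / L \<le> e" if e: "0 < e" and A: "A \<in> sets P" "measure P A \<le> \<kappa> e" for e A
    proof -
      have t: "0 \<le> T (e / 2)" using T0 e by simp
      have "T (e / 2) * measure P A \<le> T (e / 2) * \<kappa> e" using A t by (intro mult_left_mono)
      also have "\<dots> \<le> e / 2" using t e by (simp add: \<kappa>_def field_simps)
      finally have "T (e / 2) * measure P A + e / 2 \<le> e" by simp
      then have "l (\<lambda>\<omega>. (1 / e) * indicator A \<omega>) \<le> 1" using e by (intro lV polar[OF A(1) e, of "e / 2"]) auto
      then have "(1 / e) * l (indicator A) \<le> 1"
        unfolding l(2)[rule_format, OF indicator_in_Linfty[OF A(1)], of "1 / e"] .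
      then have "l (indicator A) \<le> e" using e by (simp add: field_simps)
      also have "e \<le> e * L" using L1 e by simp
      finally show ?thesis using L1 by (simp add: field_simps)
    qed
    ultimately show ?thesis by (intro exI[of _ "\<lambda>x. l x / L"]) blast
  qed
  then show ?thesis using K \<kappa> by (intro exI[of _ K] exI[of _ \<kappa>] conjI allI impI) auto
qed

section \<open>Bicontiguous separating measures\<close>

text \<open>Smallness on small sets holds at every level \<open>k\<close> and survives the mixture
  by dominated summation; a lower bound on \<open>D_set\<close> needs just one level and survives
  with the weight of that level.\<close>

lemma NAFL_imp_separating_measures:
  fixes P :: "nat \<Rightarrow> 'a measure"
  assumes M: "\<And>n. market (P n) (F n) (d n) (S n)" and NAFL: "NAFL P F d S"
  obtains R where "\<And>n. R n \<in> equivalent_measures (P n)" "bicontiguous R P"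
    "\<And>n f. f \<in> Linfty (P n) \<Longrightarrow> integrable (R n) f"
    "\<And>n f. f \<in> C_set (P n) (F n) (d n) (S n) \<Longrightarrow> integral\<^sup>L (R n) f \<le> 0"
    "\<And>\<epsilon>. 0 < \<epsilon> \<Longrightarrow> \<exists>c>0. \<forall>n. \<forall>w\<in>D_set \<epsilon> (P n). c \<le> integral\<^sup>L (R n) w"
proof -
  let ?C = "\<lambda>n. C_set (P n) (F n) (d n) (S n)"
  have P: "prob_space (P n)" for n using M[of n] by (simp add: market_def)
  have "\<exists>K>0. \<exists>\<kappa>. (\<forall>e>0. 0 < \<kappa> e) \<and> (\<forall>n. \<exists>l. linfty_state (P n) l \<and> (\<forall>f\<in>?C n. l f \<le> 0) \<and>
      (\<forall>w\<in>D_set ((1/2) ^ k) (P n). 1 / K \<le> l w) \<and>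
      (\<forall>e>0. \<forall>A\<in>sets (P n). measure (P n) A \<le> \<kappa> e \<longrightarrow> l (indicator A) \<le> e))" for k :: nat
  proof -
    have \<epsilon>: "0 < (1/2::real) ^ k" "(1/2::real) ^ k \<le> 1" by (auto intro: power_le_one)
    from NAFL[unfolded NAFL_def, THEN spec, THEN mp, OF \<epsilon>(1)] obtain Y where Y: "young_function Y" and
      disj: "\<forall>n. ?C n \<inter> {\<lambda>\<omega>. w \<omega> + v \<omega> | w v. w \<in> D_set ((1/2) ^ k) (P n) \<and> v \<in> orlicz_polar Y (P n)} = {}"
      by (elim exE conjE) (rule that)
    from separating_state[OF Y \<epsilon>] obtain K \<kappa> where K: "0 < K" "\<forall>e>0. 0 < \<kappa> e" and
      sep: "\<forall>(P :: 'a measure) C. prob_space P \<longrightarrow> C \<subseteq> Linfty P \<longrightarrow>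
        (\<forall>f\<in>C. \<forall>g\<in>C. \<forall>a\<ge>0. \<forall>b\<ge>0. (\<lambda>\<omega>. a * f \<omega> + b * g \<omega>) \<in> C) \<longrightarrow>
        (\<forall>f\<in>Linfty P. (AE \<omega> in P. f \<omega> \<le> 0) \<longrightarrow> f \<in> C) \<longrightarrow>
        C \<inter> {\<lambda>\<omega>. w \<omega> + v \<omega> | w v. w \<in> D_set ((1/2) ^ k) P \<and> v \<in> orlicz_polar Y P} = {} \<longrightarrow>
        (\<exists>l. linfty_state P l \<and> (\<forall>f\<in>C. l f \<le> 0) \<and> (\<forall>w\<in>D_set ((1/2) ^ k) P. 1 / K \<le> l w) \<and>
          (\<forall>e>0. \<forall>A\<in>sets P. measure P A \<le> \<kappa> e \<longrightarrow> l (indicator A) \<le> e))"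
      by (elim exE conjE) (rule that)
    have "\<exists>l. linfty_state (P n) l \<and> (\<forall>f\<in>?C n. l f \<le> 0) \<and>
      (\<forall>w\<in>D_set ((1/2) ^ k) (P n). 1 / K \<le> l w) \<and>
      (\<forall>e>0. \<forall>A\<in>sets (P n). measure (P n) A \<le> \<kappa> e \<longrightarrow> l (indicator A) \<le> e)" for n
    proof (rule sep[rule_format, OF P _ _ _ disj[THEN spec]])
      show "?C n \<subseteq> Linfty (P n)" by (auto simp: C_set_def)
    qed (auto intro: C_set_lincomb[OF M] C_set_nonpos[OF M])
    with K show ?thesis by blast
  qed
  then obtain K \<kappa> where K: "\<And>k. 0 < K k" and \<kappa>: "\<And>k e. 0 < e \<Longrightarrow> 0 < \<kappa> k e" and
    ex: "\<And>k n. \<exists>l. linfty_state (P n) l \<and> (\<forall>f\<in>?C n. l f \<le> 0) \<and>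
      (\<forall>w\<in>D_set ((1/2) ^ k) (P n). 1 / K k \<le> l w) \<and>
      (\<forall>e>0. \<forall>A\<in>sets (P n). measure (P n) A \<le> \<kappa> k e \<longrightarrow> l (indicator A) \<le> e)" by metis
  define Q where "Q k n l \<longleftrightarrow> linfty_state (P n) l \<and> (\<forall>f\<in>?C n. l f \<le> 0) \<and>
      (\<forall>w\<in>D_set ((1/2) ^ k) (P n). 1 / K k \<le> l w) \<and>
      (\<forall>e>0. \<forall>A\<in>sets (P n). measure (P n) A \<le> \<kappa> k e \<longrightarrow> l (indicator A) \<le> e)" for k n l
  have "\<forall>k n. \<exists>l. Q k n l" unfolding Q_def using ex by blast
  then obtain l where l: "\<And>k n. Q k n (l k n)" by metis
  have st: "linfty_state (P n) (l k n)" and lC: "f \<in> ?C n \<Longrightarrow> l k n f \<le> 0" and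
    lD: "w \<in> D_set ((1/2) ^ k) (P n) \<Longrightarrow> 1 / K k \<le> l k n w" and
    small: "0 < e \<Longrightarrow> A \<in> sets (P n) \<Longrightarrow> measure (P n) A \<le> \<kappa> k e \<Longrightarrow> l k n (indicator A) \<le> e" for k n f w e A
    using l[of k n] unfolding Q_def by blast+
  define L where "L n x = (\<Sum>k. (1/2) ^ Suc k * l k n x)" for n x
  have L: "linfty_state (P n) (L n)" for n
    unfolding L_def by (rule linfty_state_mixture[OF st])
  have L_summable: "summable (\<lambda>k. (1/2) ^ Suc k * l k n x)" if "x \<in> Linfty (P n)" for n x
    by (rule linfty_state_mixture_summable[OF st that])
  \<comment> \<open>Stated along an arbitrary sequence \<open>m\<close> of markets, since it is used
    twice: a constant \<open>m\<close> yields countable additivity in one market, and the identity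
    yields contiguity of \<open>R\<close> with respect to \<open>P\<close>.\<close>
  have tends: "(\<lambda>i. L (m i) (indicator (A i))) \<longlonglongrightarrow> 0"
    if A: "\<And>i. A i \<in> sets (P (m i))" and lim: "(\<lambda>i. measure (P (m i)) (A i)) \<longlonglongrightarrow> 0" for m :: "nat \<Rightarrow> nat" and A
    unfolding L_def
  proof (rule geometric_mixture_tendsto_zero)
    note bounds = linfty_state_indicator_bounds[OF st A]
    show "\<bar>l k (m i) (indicator (A i))\<bar> \<le> 1" for k i using bounds[of k i] by simp
    show "(\<lambda>i. l k (m i) (indicator (A i))) \<longlonglongrightarrow> 0" for k
    proof (rule LIMSEQ_I)
      fix e :: real assume "0 < e"
      then have e: "0 < e / 2" by simp
      obtain i0 where "\<And>i. i0 \<le> i \<Longrightarrow> measure (P (m i)) (A i) < \<kappa> k (e / 2)"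
        using order_tendstoD(2)[OF lim \<kappa>[OF e, of k]] by (auto simp: eventually_sequentially)
      then have "l k (m i) (indicator (A i)) \<le> e / 2" if "i0 \<le> i" for i
        using small[OF e A, of i k] that by (simp add: less_imp_le)
      then have "norm (l k (m i) (indicator (A i)) - 0) < e" if "i0 \<le> i" for i
        using bounds(1)[of k i] that \<open>0 < e\<close> by fastforce
      then show "\<exists>i0. \<forall>i\<ge>i0. norm (l k (m i) (indicator (A i)) - 0) < e" by blast
    qed
  qed
  have "\<exists>R. prob_space R \<and> sets R = sets (P n) \<and> absolutely_continuous (P n) R \<and>
    (\<forall>f\<in>Linfty (P n). integrable R f \<and> integral\<^sup>L R f = L n f)" for n
  proof -
    interpret prob_space "P n" by (rule P)
    have cont: "(\<lambda>i. L n (indicator (A i))) \<longlonglongrightarrow> 0"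
      if A: "range A \<subseteq> sets (P n)" "decseq A" "(\<Inter>i. A i) = {}" for A
    proof (rule tends[of A "\<lambda>_. n"])
      show "(\<lambda>i. measure (P n) (A i)) \<longlonglongrightarrow> 0"
        using finite_Lim_measure_decseq[OF A(1,2)] A(3) by simp
    qed (use A(1) in auto)
    show ?thesis by (rule linfty_state_measure[OF P L cont]) blast+
  qed
  then obtain R where R: "\<And>n. prob_space (R n)" "\<And>n. sets (R n) = sets (P n)" "\<And>n. absolutely_continuous (P n) (R n)"
    and RL: "\<And>n f. f \<in> Linfty (P n) \<Longrightarrow> integrable (R n) f \<and> integral\<^sup>L (R n) f = L n f" by metis
  have R_meas: "measure (R n) A = L n (indicator A)" if "A \<in> sets (P n)" for n A
  proof -
    have "integral\<^sup>L (R n) (indicator A) = measure (R n) (A \<inter> space (R n))" by simp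
    also have "A \<inter> space (R n) = A" using sets.sets_into_space[OF that] sets_eq_imp_space_eq[OF R(2)] by auto
    finally show ?thesis using RL[OF indicator_in_Linfty[OF that]] by simp
  qed
  \<comment> \<open>One summand suffices, at a level with \<open>(1/2) ^ k < \<epsilon>\<close>; the
    other summands are nonnegative on \<open>w\<close>.\<close>
  have low: "\<exists>c>0. \<forall>n. \<forall>w\<in>D_set \<epsilon> (P n). c \<le> integral\<^sup>L (R n) w" if "0 < \<epsilon>" for \<epsilon>
  proof -
    obtain k where k: "(1/2) ^ k < \<epsilon>" using real_arch_pow_inv[OF \<open>0 < \<epsilon>\<close>, of "1/2"] by auto
    have "(1/2) ^ Suc k * (1 / K k) \<le> integral\<^sup>L (R n) w" if w: "w \<in> D_set \<epsilon> (P n)" for n w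
    proof -
      have wL: "w \<in> Linfty (P n)" and w0: "AE \<omega> in P n. 0 \<le> w \<omega>" using w by (auto simp: D_set_def)
      have "w \<in> D_set ((1/2) ^ k) (P n)" using w k by (auto simp: D_set_def)
      then have "(1/2) ^ Suc k * (1 / K k) \<le> (1/2) ^ Suc k * l k n w" by (intro mult_left_mono lD) auto
      also have "\<dots> \<le> L n w"
        unfolding L_def
        using sum_le_suminf[OF L_summable[OF wL], of "{k}"] linfty_state_nonneg[OF st wL w0] by simp
      finally show ?thesis using RL[OF wL] by simp
    qed
    moreover have "0 < (1/2) ^ Suc k * (1 / K k)" using K[of k] by simp
    ultimately show ?thesis by blast
  qed
  have ind_D: "indicator A \<in> D_set e (P n)" if "A \<in> sets (P n)" "e \<le> measure (P n) A" for A e n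
    using that indicator_in_Linfty[OF that(1)] sets.sets_into_space[OF that(1)]
    by (auto simp: D_set_def indicator_def Int_absorb2)
  \<comment> \<open>With \<open>e\<close> the probability of a given set, this shows that
    \<open>R n\<close>-null sets are \<open>P n\<close>-null; with \<open>e\<close> fixed, it gives
    contiguity of \<open>P\<close> with respect to \<open>R\<close>.\<close>
  have low': "\<exists>c>0. \<forall>n. \<forall>A\<in>sets (P n). e \<le> measure (P n) A \<longrightarrow> c \<le> measure (R n) A" if "0 < e" for e
  proof -
    from low[OF that] obtain c where c: "0 < c" "\<And>n w. w \<in> D_set e (P n) \<Longrightarrow> c \<le> integral\<^sup>L (R n) w" by blast
    have "c \<le> measure (R n) A" if "A \<in> sets (P n)" "e \<le> measure (P n) A" for n A
      using c(2)[OF ind_D[OF that]] RL[OF indicator_in_Linfty[OF that(1)]] R_meas[OF that(1)] by simp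
    with c(1) show ?thesis by blast
  qed
  have "R n \<in> equivalent_measures (P n)" for n
  proof -
    interpret prob_space "P n" by (rule P)
    interpret R: prob_space "R n" by (rule R)
    have "A \<in> null_sets (P n)" if A: "A \<in> null_sets (R n)" for A
    proof (rule ccontr)
      have sA: "A \<in> sets (P n)" using A R(2) by auto
      assume "A \<notin> null_sets (P n)"
      then have pos: "0 < measure (P n) A" using sA by (simp add: null_sets_def emeasure_eq_measure zero_less_measure_iff)
      from low'[OF pos] obtain c where "0 < c" "c \<le> measure (R n) A" using sA by blast
      moreover have "measure (R n) A = 0" using A by (simp add: measure_eq_0_null_sets)
      ultimately show False by simp
    qed
    then show ?thesis using R[of n] by (auto simp: equivalent_measures_def absolutely_continuous_def)
  qed
  moreover have "bicontiguous R P"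
    unfolding bicontiguous_def contiguous_def
  proof (intro conjI allI impI)
    fix A assume A: "\<forall>n. A n \<in> sets (P n)" "(\<lambda>n. measure (P n) (A n)) \<longlonglongrightarrow> 0"
    then show "(\<lambda>n. measure (R n) (A n)) \<longlonglongrightarrow> 0" using tends[of A "\<lambda>i. i"] R_meas by simp
  next
    fix A assume A: "\<forall>n. A n \<in> sets (R n)" "(\<lambda>n. measure (R n) (A n)) \<longlonglongrightarrow> 0"
    show "(\<lambda>n. measure (P n) (A n)) \<longlonglongrightarrow> 0"
    proof (rule LIMSEQ_I)
      fix e :: real assume "0 < e"
      from low'[OF this] obtain c where c: "0 < c" "\<And>n. e \<le> measure (P n) (A n) \<Longrightarrow> c \<le> measure (R n) (A n)"
        using A(1) R(2) by blast
      obtain n0 where "\<And>n. n0 \<le> n \<Longrightarrow> measure (R n) (A n) < c"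
        using order_tendstoD(2)[OF A(2) c(1)] by (auto simp: eventually_sequentially)
      then have "measure (P n) (A n) < e" if "n0 \<le> n" for n using c(2)[of n] that by fastforce
      then show "\<exists>n0. \<forall>n\<ge>n0. norm (measure (P n) (A n) - 0) < e" by auto
    qed
  qed
  moreover have "integral\<^sup>L (R n) f \<le> 0" if f: "f \<in> ?C n" for n f
  proof -
    have fL: "f \<in> Linfty (P n)" using f by (simp add: C_set_def)
    have "L n f \<le> (\<Sum>k. (0::real))"
      unfolding L_def
      by (rule suminf_le[OF _ L_summable[OF fL]]) (use lC[OF f] in \<open>auto simp: mult_nonneg_nonpos\<close>)
    then show ?thesis using RL[OF fL] by simp
  qed
  ultimately show thesis using that[of R] RL low by blast
qed

section \<open>Contiguity and small losses\<close>

text \<open>Sets violating the claim with probabilities \<open>(1/2) ^ k\<close> would have a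
  \<open>P\<close>-null limsup by Borel-Cantelli, while its \<open>R\<close>-measure would be at
  least \<theta> by continuity from above.\<close>

lemma absolutely_continuous_uniform:
  assumes P: "prob_space P" and R: "prob_space R" and sets: "sets R = sets P"
    and ac: "absolutely_continuous P R" and \<theta>: "0 < \<theta>"
  shows "\<exists>\<kappa>>0. \<forall>A\<in>sets P. measure P A \<le> \<kappa> \<longrightarrow> measure R A \<le> \<theta>"
proof (rule ccontr)
  assume neg: "\<not> ?thesis"
  interpret P: prob_space P by (rule P)
  interpret R: prob_space R by (rule R)
  have "\<exists>A\<in>sets P. measure P A \<le> (1/2) ^ k \<and> \<theta> < measure R A" for k :: nat
  proof -
    have "0 < (1/2::real) ^ k" by simp
    then show ?thesis using neg by (meson not_le)
  qed
  then obtain A where A: "\<And>k. A k \<in> sets P" "\<And>k. measure P (A k) \<le> (1/2) ^ k" "\<And>k. \<theta> < measure R (A k)"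
    by metis
  define B where "B n = (\<Union>k\<in>{n..}. A k)" for n
  have B: "B n \<in> sets P" for n unfolding B_def using A(1) by auto
  have "limsup A \<in> null_sets P"
  proof (rule borel_cantelli_limsup1[OF A(1)])
    show "summable (\<lambda>k. measure P (A k))"
      by (rule summable_comparison_test'[of "\<lambda>k. (1/2) ^ k" 0]) (use A(2) in \<open>auto intro: summable_geometric\<close>)
  qed (simp add: P.emeasure_eq_measure)
  moreover have "limsup A = (\<Inter>n. B n)" by (simp add: limsup_INF_SUP B_def)
  ultimately have "(\<Inter>n. B n) \<in> null_sets R" using ac by (auto simp: absolutely_continuous_def)
  then have zero: "measure R (\<Inter>n. B n) = 0" by (simp add: measure_eq_0_null_sets)
  have "(\<lambda>n. measure R (B n)) \<longlonglongrightarrow> measure R (\<Inter>n. B n)"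
  proof (rule R.finite_Lim_measure_decseq)
    show "range B \<subseteq> sets R" using B sets by auto
    show "decseq B" unfolding decseq_def B_def by (intro allI impI UN_mono) auto
  qed
  moreover have "\<theta> \<le> measure R (B n)" for n
  proof -
    have "measure R (A n) \<le> measure R (B n)"
      by (rule R.finite_measure_mono) (use B sets in \<open>auto simp: B_def\<close>)
    then show ?thesis using A(3)[of n] by simp
  qed
  ultimately have "\<theta> \<le> measure R (\<Inter>n. B n)" by (intro LIMSEQ_le_const) auto
  then show False using zero \<theta> by simp
qed

text \<open>Contiguity controls late markets and absolute continuity each of the finitely many early
  ones. If no common constant existed, violations would therefore occur in arbitrarily late markets,
  and one sequence of sets would collect them.\<close>

lemma contiguous_uniform:
  assumes P: "\<And>n. prob_space (P n)" and R: "\<And>n. prob_space (R n)" and sets: "\<And>n. sets (R n) = sets (P n)"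
    and ac: "\<And>n. absolutely_continuous (P n) (R n)" and cont: "contiguous R P" and \<theta>: "0 < \<theta>"
  shows "\<exists>\<kappa>>0. \<forall>n. \<forall>A\<in>sets (P n). measure (P n) A \<le> \<kappa> \<longrightarrow> measure (R n) A \<le> \<theta>"
proof (rule ccontr)
  assume neg: "\<not> ?thesis"
  from absolutely_continuous_uniform[OF P R sets ac \<theta>]
  obtain \<kappa> where \<kappa>: "\<And>n. 0 < \<kappa> n" "\<And>n A. A \<in> sets (P n) \<Longrightarrow> measure (P n) A \<le> \<kappa> n \<Longrightarrow> measure (R n) A \<le> \<theta>"
    by metis
  define bad where "bad n k \<longleftrightarrow> (\<exists>A\<in>sets (P n). measure (P n) A \<le> (1/2) ^ k \<and> \<theta> < measure (R n) A)" for n and k :: nat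
  have bad_ex: "\<exists>n>N. bad n k" for N k
  proof -
    \<comment> \<open>So small that none of the markets up to \<open>N\<close> can violate the
      bound; the violating market must come later.\<close>
    define e where "e = Min (insert ((1/2) ^ k) (\<kappa> ` {..N}))"
    have e: "0 < e" "e \<le> (1/2) ^ k" "\<And>n. n \<le> N \<Longrightarrow> e \<le> \<kappa> n" 
      unfolding e_def using \<kappa>(1) by (auto intro!: Min_le simp del: Min_insert simp: Min_gr_iff)
    from neg e(1) obtain n A where A: "A \<in> sets (P n)" "measure (P n) A \<le> e" "\<theta> < measure (R n) A"
      by (meson not_le)
    then have "\<not> n \<le> N" using \<kappa>(2)[of A n] e(3)[of n] by fastforce
    moreover have "bad n k" unfolding bad_def using A e(2) by (intro bexI[of _ A]) auto
    ultimately show ?thesis by (meson not_le)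
  qed
  have "\<exists>r. \<forall>k. bad (r k) k \<and> r k < r (Suc k)"
    by (rule dependent_nat_choice) (use bad_ex in blast)+
  then obtain r where r: "\<And>k. bad (r k) k" "strict_mono r"
    unfolding strict_mono_Suc_iff by blast
  obtain A where A: "\<And>k. A k \<in> sets (P (r k))" "\<And>k. measure (P (r k)) (A k) \<le> (1/2) ^ k"
    "\<And>k. \<theta> < measure (R (r k)) (A k)"
    using r(1) unfolding bad_def by metis
  \<comment> \<open>Violating sets along the markets \<open>r k\<close>, and the empty set
    elsewhere, as contiguity concerns sequences over all \<open>n\<close>.\<close>
  define B where "B n = (if n \<in> range r then A (inv r n) else {})" for n
  have inj: "inj r" using r(2) by (rule strict_mono_imp_inj_on)
  have Br: "B (r k) = A k" for k by (simp add: B_def inv_f_f[OF inj])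
  have Bs: "\<forall>n. B n \<in> sets (P n)" using A(1) Br by (auto simp: B_def inv_f_f[OF inj])
  have "(\<lambda>n. measure (P n) (B n)) \<longlonglongrightarrow> 0"
  proof (rule LIMSEQ_I)
    fix e :: real assume "0 < e"
    then obtain K where K: "(1/2) ^ K < e" using real_arch_pow_inv[of e "1/2"] by auto
    have "measure (P n) (B n) < e" if "r K \<le> n" for n
    proof (cases "n \<in> range r")
      case True
      then obtain k where k: "n = r k" by blast
      then have "K \<le> k" using that strict_mono_less_eq[OF r(2)] by simp
      then have "(1/2::real) ^ k \<le> (1/2) ^ K" by (intro power_decreasing) auto
      with A(2)[of k] K have "measure (P (r k)) (A k) < e" by (meson le_less_trans order_trans)
      then show ?thesis by (simp add: k Br)
    qed (use \<open>0 < e\<close> in \<open>simp add: B_def\<close>)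
    then show "\<exists>n0. \<forall>n\<ge>n0. norm (measure (P n) (B n) - 0) < e" by auto
  qed
  then have "(\<lambda>n. measure (R n) (B n)) \<longlonglongrightarrow> 0" using cont Bs unfolding contiguous_def by blast
  from LIMSEQ_subseq_LIMSEQ[OF this r(2)] have "(\<lambda>k. measure (R (r k)) (A k)) \<longlonglongrightarrow> 0" by (simp add: o_def Br)
  then have "\<theta> \<le> 0" by (rule LIMSEQ_le_const) (use A(3) in \<open>auto intro: less_imp_le\<close>)
  then show False using \<theta> by simp
qed

text \<open>The tails of the negative part of \<open>v\<close> are controlled at the levels \<open>\<eta> (j + 1)\<close> by the Young function, and
  \<open>\<phi>\<close> is bounded by a step function with jumps at these levels.\<close>

lemma orlicz_polar_small_loss:
  fixes P R :: "nat \<Rightarrow> 'a measure" and \<phi> :: "real \<Rightarrow> real"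
  assumes P: "\<And>n. prob_space (P n)" and R: "\<And>n. prob_space (R n)" and sets: "\<And>n. sets (R n) = sets (P n)"
    and ac: "\<And>n. absolutely_continuous (P n) (R n)" and cont: "contiguous R P"
    and \<phi>: "mono_on {0..} \<phi>" "\<phi> 0 = 0" "(\<phi> \<longlongrightarrow> 0) (at_right 0)" and \<delta>: "0 < \<delta>"
  shows "\<exists>Y. young_function Y \<and> (\<forall>n. \<forall>v\<in>orlicz_polar Y (P n).
    integrable (R n) (\<lambda>\<omega>. \<phi> (max 0 (- v \<omega>))) \<and> (LINT \<omega>|R n. \<phi> (max 0 (- v \<omega>))) \<le> \<delta>)"
proof -
  have \<phi>_mono: "\<phi> s \<le> \<phi> t" if "0 \<le> s" "s \<le> t" for s t using \<phi>(1) that by (auto simp: mono_on_def)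
  have \<phi>_nonneg: "0 \<le> \<phi> t" if "0 \<le> t" for t using \<phi>_mono[of 0 t] \<phi>(2) that by simp
  have [measurable]: "(\<lambda>t. \<phi> (max 0 t)) \<in> borel_measurable borel"
    by (rule borel_measurable_mono) (auto intro!: monoI \<phi>_mono)
  obtain \<eta> where \<eta>: "0 < \<eta>" "\<phi> \<eta> \<le> \<delta> / 2"
  proof -
    have "\<forall>\<^sub>F t in at_right 0. \<phi> t < \<delta> / 2" using order_tendstoD(2)[OF \<phi>(3), of "\<delta> / 2"] \<delta> by simp
    then obtain b where b: "0 < b" "\<And>t. 0 < t \<Longrightarrow> t < b \<Longrightarrow> \<phi> t < \<delta> / 2"
      by (auto simp: eventually_at_right_field)
    show thesis by (rule that[of "b / 2"]) (use b(1) b(2)[of "b / 2"] in auto)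
  qed
  define x where "x j = \<eta> * (real j + 1)" for j
  have x: "0 < x j" for j using \<eta>(1) by (simp add: x_def add_nonneg_pos)
  \<comment> \<open>The jumps of the step function then cost at most \<open>\<delta> / 2\<close> in
    total, the other half being reserved for \<open>\<phi> \<eta>\<close>. The summand 1 prevents
    division by 0.\<close>
  define \<theta> where "\<theta> j = \<delta> / 2 * (1/2) ^ Suc j / (\<phi> (x (Suc j)) + 1)" for j
  have den: "0 < \<phi> (x (Suc j)) + 1" for j using \<phi>_nonneg[OF less_imp_le[OF x[of "Suc j"]]] by simp
  have "0 < \<theta> j" for j unfolding \<theta>_def using den[of j] \<delta> by simp
  from contiguous_uniform[OF P R sets ac cont this]
  obtain \<kappa> where \<kappa>: "\<And>j. 0 < \<kappa> j"
    "\<And>j n A. A \<in> sets (P n) \<Longrightarrow> measure (P n) A \<le> \<kappa> j \<Longrightarrow> measure (R n) A \<le> \<theta> j" by metis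
  \<comment> \<open>The cumulative sum is increasing and dominates
    \<open>1 / (x j * \<kappa> j)\<close>, which brings the tail bound
    \<open>1 / (x j * b j)\<close> below \<open>\<kappa> j\<close>.\<close>
  define b where "b j = 1 + (\<Sum>i\<le>j. 1 / (x i * \<kappa> i))" for j
  have weight: "0 < 1 / (x i * \<kappa> i)" for i using x \<kappa>(1) by simp
  have b: "0 < b j" for j unfolding b_def using weight by (intro add_pos_nonneg sum_nonneg) (auto intro: less_imp_le)
  have b_inc: "incseq b" unfolding b_def using weight by (intro incseq_SucI) (simp add: less_imp_le)
  from slow_young_function[OF \<eta>(1) b b_inc] obtain Y where Y: "young_function Y" and
    Yb: "\<And>j. Y (b j) < x j * b j" unfolding x_def by blast
  have tail: "1 / (x j * b j) \<le> \<kappa> j" for j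
  proof -
    have "1 / (x j * \<kappa> j) \<le> (\<Sum>i\<le>j. 1 / (x i * \<kappa> i))"
      by (rule member_le_sum) (use weight in \<open>auto intro: less_imp_le\<close>)
    then have "1 / (x j * \<kappa> j) \<le> b j" by (simp add: b_def)
    then show ?thesis using x[of j] \<kappa>(1)[of j] b[of j] by (simp add: field_simps)
  qed
  have "integrable (R n) (\<lambda>\<omega>. \<phi> (max 0 (- v \<omega>))) \<and> (LINT \<omega>|R n. \<phi> (max 0 (- v \<omega>))) \<le> \<delta>"
    if v: "v \<in> orlicz_polar Y (P n)" for n v
  proof -
    interpret R: prob_space "R n" by (rule R)
    have vP: "v \<in> borel_measurable (P n)" using v by (simp add: orlicz_polar_def Linfty_def)
    have [measurable]: "v \<in> borel_measurable (R n)" by (subst measurable_cong_sets[OF sets refl]) (rule vP)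
    have sp: "space (R n) = space (P n)" by (rule sets_eq_imp_space_eq[OF sets])
    obtain c where "AE \<omega> in P n. \<bar>v \<omega>\<bar> \<le> c" using v by (auto simp: orlicz_polar_def Linfty_def)
    then have c: "AE \<omega> in R n. \<bar>v \<omega>\<bar> \<le> c" by (rule absolutely_continuous_AE[OF sets ac])
    \<comment> \<open>\<open>J\<close> depends on \<open>v\<close> through its essential bound; the
      final estimate does not, since it bounds all partial sums of the geometric series.\<close>
    obtain J where J: "c < \<eta> * real J" using reals_Archimedean3[OF \<eta>(1)] by (auto simp: mult.commute)
    define A where "A j = {\<omega> \<in> space (P n). x j < - v \<omega>}" for j
    have AP: "A j \<in> sets (P n)" for j unfolding A_def using vP by measurable
    then have [measurable]: "A j \<in> sets (R n)" for j by (simp add: sets)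
    have A_small: "measure (R n) (A j) \<le> \<theta> j" for j
    proof (rule \<kappa>(2)[OF AP])
      have "measure (P n) (A j) \<le> 1 / (x j * b j)"
        unfolding A_def by (rule orlicz_polar_tail[OF Y P v x b Yb])
      then show "measure (P n) (A j) \<le> \<kappa> j" using tail[of j] by linarith
    qed
    define g where "g \<omega> = \<phi> \<eta> + (\<Sum>j<J. \<phi> (x (Suc j)) * indicator (A j) \<omega>)" for \<omega>
    have le: "AE \<omega> in R n. \<phi> (max 0 (- v \<omega>)) \<le> g \<omega>"
      using c AE_space
    proof eventually_elim
      case (elim \<omega>)
      have nn: "0 \<le> \<phi> (x (Suc j)) * indicator (A j) \<omega>" for j
        using \<phi>_nonneg[OF less_imp_le[OF x]] by simp
      show ?case
      proof (cases "- v \<omega> \<le> \<eta>")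
        case True
        then have "\<phi> (max 0 (- v \<omega>)) \<le> \<phi> \<eta>" using \<eta>(1) by (intro \<phi>_mono) auto
        moreover have "0 \<le> (\<Sum>j<J. \<phi> (x (Suc j)) * indicator (A j) \<omega>)" by (intro sum_nonneg nn)
        ultimately show ?thesis unfolding g_def by linarith
      next
        case False
        \<comment> \<open>\<open>- v \<omega>\<close> lies above
          \<open>\<eta> * (i - 1) = x (i - 2)\<close> and is at most
          \<open>\<eta> * i = x (i - 1)\<close>; hence the shift by 2 in \<open>j\<close>.\<close>
        define i where "i = nat \<lceil>- v \<omega> / \<eta>\<rceil>"
        have q: "1 < - v \<omega> / \<eta>" using False \<eta>(1) by (simp add: field_simps)
        then have i: "real i - 1 < - v \<omega> / \<eta>" "- v \<omega> / \<eta> \<le> real i" "2 \<le> i" unfolding i_def by linarith+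
        define j where "j = i - 2"
        have ij: "real i = real j + 2" using i(3) by (simp add: j_def)
        have xj: "x j < - v \<omega>" "- v \<omega> \<le> x (Suc j)"
          using i(1,2) \<eta>(1) by (auto simp: ij x_def field_simps)
        have "x j < \<eta> * real J" using xj(1) elim(1) J by linarith
        then have "j < J" using \<eta>(1) by (simp add: x_def)
        have "\<phi> (max 0 (- v \<omega>)) \<le> \<phi> (x (Suc j))" using xj x[of "Suc j"] by (intro \<phi>_mono) auto
        also have "\<dots> = \<phi> (x (Suc j)) * indicator (A j) \<omega>" using xj(1) elim(2) by (simp add: A_def sp)
        also have "\<dots> \<le> (\<Sum>j<J. \<phi> (x (Suc j)) * indicator (A j) \<omega>)"
          by (rule member_le_sum) (use \<open>j < J\<close> nn in auto)
        finally show ?thesis unfolding g_def using \<phi>_nonneg[of \<eta>] \<eta>(1) by linarith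
      qed
    qed
    have int_A: "integrable (R n) (\<lambda>\<omega>. \<phi> (x (Suc j)) * indicator (A j) \<omega>)" for j
      by (intro integrable_mult_right integrable_real_indicator) (auto simp: R.emeasure_eq_measure)
    have int_g: "integrable (R n) g"
      unfolding g_def by (intro Bochner_Integration.integrable_add Bochner_Integration.integrable_sum int_A) simp
    have int: "integrable (R n) (\<lambda>\<omega>. \<phi> (max 0 (- v \<omega>)))"
    proof (rule Bochner_Integration.integrable_bound[OF int_g])
      show "AE \<omega> in R n. norm (\<phi> (max 0 (- v \<omega>))) \<le> norm (g \<omega>)"
        using le by eventually_elim (use \<phi>_nonneg in \<open>simp add: abs_le_iff\<close>)
    qed measurable
    have "(LINT \<omega>|R n. \<phi> (max 0 (- v \<omega>))) \<le> integral\<^sup>L (R n) g"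
      by (rule integral_mono_AE[OF int int_g le])
    also have "integral\<^sup>L (R n) g = \<phi> \<eta> + (\<Sum>j<J. \<phi> (x (Suc j)) * measure (R n) (A j))"
    proof -
      have "(LINT \<omega>|R n. \<phi> (x (Suc j)) * indicator (A j) \<omega>) = \<phi> (x (Suc j)) * measure (R n) (A j)" for j
        using sets.sets_into_space[OF AP[of j]] sp by (simp add: Int_absorb2)
      then have "(LINT \<omega>|R n. (\<Sum>j<J. \<phi> (x (Suc j)) * indicator (A j) \<omega>)) = (\<Sum>j<J. \<phi> (x (Suc j)) * measure (R n) (A j))"
        by (subst Bochner_Integration.integral_sum[OF int_A]) simp
      moreover have "integral\<^sup>L (R n) g = (LINT \<omega>|R n. \<phi> \<eta>) + (LINT \<omega>|R n. (\<Sum>j<J. \<phi> (x (Suc j)) * indicator (A j) \<omega>))"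
        unfolding g_def
        by (rule Bochner_Integration.integral_add[OF _ Bochner_Integration.integrable_sum[OF int_A]]) simp
      ultimately show ?thesis by (simp add: R.prob_space)
    qed
    also have "\<dots> \<le> \<delta> / 2 + (\<Sum>j<J. \<delta> / 2 * (1/2) ^ Suc j)"
    proof (intro add_mono \<eta>(2) sum_mono)
      fix j
      have "\<phi> (x (Suc j)) * measure (R n) (A j) \<le> (\<phi> (x (Suc j)) + 1) * \<theta> j"
        using A_small[of j] \<phi>_nonneg[OF less_imp_le[OF x[of "Suc j"]]] by (intro mult_mono) auto
      also have "\<dots> = \<delta> / 2 * (1/2) ^ Suc j" 
          unfolding \<theta>_def times_divide_eq_right
          by (rule nonzero_mult_div_cancel_left) (use den[of j] in simp)
      finally show "\<phi> (x (Suc j)) * measure (R n) (A j) \<le> \<delta> / 2 * (1/2) ^ Suc j" .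
    qed
    also have "(\<Sum>j<J. \<delta> / 2 * (1/2) ^ Suc j) = \<delta> / 2 * (\<Sum>j<J. (1/2) ^ Suc j)"
      by (simp add: sum_distrib_left)
    also have "(\<Sum>j<J. (1/2::real) ^ Suc j) \<le> 1"
      using sum_le_suminf[OF sums_summable[OF geometric_sums_one], of "{..<J}"] sums_unique[OF geometric_sums_one] by simp
    finally show ?thesis using int \<delta> by simp
  qed
  with Y show ?thesis by blast
qed

text \<open>As \<open>w \<le> 1\<close> has mean at least \<epsilon>, it is at least
  \<open>\<epsilon> / 2\<close> on a set of \<open>P n\<close>-probability at least
  \<open>\<epsilon> / 2\<close>. This exceeds \<open>\<epsilon> / 4\<close>, so contiguity of
  \<open>P\<close> with respect to \<open>R\<close> bounds the \<open>R n\<close>-measure of the set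
  below by \<kappa>.\<close>

lemma D_set_uniformly_positive:
  assumes P: "\<And>n. prob_space (P n)" and R: "\<And>n. prob_space (R n)" and sets: "\<And>n. sets (R n) = sets (P n)"
    and ac: "\<And>n. absolutely_continuous (P n) (R n)" "\<And>n. absolutely_continuous (R n) (P n)"
    and cont: "contiguous P R" and \<epsilon>: "0 < \<epsilon>"
  shows "\<exists>c>0. \<forall>n. \<forall>w\<in>D_set \<epsilon> (P n). c \<le> integral\<^sup>L (R n) w"
proof -
  have "0 < \<epsilon> / 4" using \<epsilon> by simp
  from contiguous_uniform[OF R P sets[symmetric] ac(2) cont this] obtain \<kappa> where
    \<kappa>: "0 < \<kappa>" "\<And>n A. A \<in> sets (R n) \<Longrightarrow> measure (R n) A \<le> \<kappa> \<Longrightarrow> measure (P n) A \<le> \<epsilon> / 4" by blast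
  have "\<kappa> * (\<epsilon> / 2) \<le> integral\<^sup>L (R n) w" if w: "w \<in> D_set \<epsilon> (P n)" for n w
  proof -
    interpret P: prob_space "P n" by (rule P)
    interpret R: prob_space "R n" by (rule R)
    have wP[measurable]: "w \<in> borel_measurable (P n)" and bnd: "AE \<omega> in P n. 0 \<le> w \<omega> \<and> w \<omega> \<le> 1"
      and low: "\<epsilon> \<le> integral\<^sup>L (P n) w" using w by (auto simp: D_set_def Linfty_def)
    have wR[measurable]: "w \<in> borel_measurable (R n)" by (subst measurable_cong_sets[OF sets refl]) (rule wP)
    have bndR: "AE \<omega> in R n. 0 \<le> w \<omega> \<and> w \<omega> \<le> 1" by (rule absolutely_continuous_AE[OF sets ac(1) bnd])
    define A where "A = {\<omega> \<in> space (P n). \<epsilon> / 2 \<le> w \<omega>}"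
    have AP[measurable]: "A \<in> sets (P n)" unfolding A_def by measurable
    have AR[measurable]: "A \<in> sets (R n)" by (simp add: sets)
    have intP: "integrable (P n) w" by (rule P.integrable_const_bound[of _ 1]) (use bnd in auto)
    have intR: "integrable (R n) w" by (rule R.integrable_const_bound[of _ 1]) (use bndR in auto)
    have iP: "integrable (P n) (indicator A :: _ \<Rightarrow> real)" and iR: "integrable (R n) (indicator A :: _ \<Rightarrow> real)"
      by (auto intro!: integrable_real_indicator simp: P.emeasure_eq_measure R.emeasure_eq_measure)
    have "integral\<^sup>L (P n) w \<le> (LINT \<omega>|P n. indicator A \<omega> + \<epsilon> / 2)"
    proof (rule integral_mono_AE[OF intP])
      show "AE \<omega> in P n. w \<omega> \<le> indicator A \<omega> + \<epsilon> / 2"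
        using bnd AE_space by eventually_elim (use \<epsilon> in \<open>auto simp: A_def indicator_def\<close>)
    qed (use iP in auto)
    also have "\<dots> = measure (P n) A + \<epsilon> / 2"
      using iP sets.sets_into_space[OF AP] by (simp add: P.prob_space Int_absorb2)
    finally have "\<epsilon> / 2 \<le> measure (P n) A" using low by simp
    then have "\<kappa> \<le> measure (R n) A" using \<kappa>(2)[OF AR] \<epsilon> by fastforce
    then have "\<kappa> * (\<epsilon> / 2) \<le> measure (R n) A * (\<epsilon> / 2)" using \<epsilon> by (intro mult_right_mono) auto
    also have "\<dots> = (LINT \<omega>|R n. \<epsilon> / 2 * indicator A \<omega>)"
      using sets.sets_into_space[OF AR] by (simp add: Int_absorb2)
    also have "\<dots> \<le> integral\<^sup>L (R n) w"
    proof (rule integral_mono_AE[OF _ intR])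
      show "AE \<omega> in R n. \<epsilon> / 2 * indicator A \<omega> \<le> w \<omega>"
        using bndR by eventually_elim (auto simp: A_def indicator_def)
    qed (use iR in auto)
    finally show ?thesis .
  qed
  moreover have "0 < \<kappa> * (\<epsilon> / 2)" using \<kappa>(1) \<epsilon> by simp
  ultimately show ?thesis by blast
qed

section \<open>The equivalence\<close>

text \<open>Levels above 1 are treated separately: there is nothing to show for them, but neither a
  nonempty net nor a sequence of members exists.\<close>

lemma D_set_empty:
  assumes P: "prob_space P" and \<epsilon>: "1 < \<epsilon>"
  shows "D_set \<epsilon> P = {}"
proof -
  interpret prob_space P by fact
  have "integral\<^sup>L P w \<le> 1" if "w \<in> borel_measurable P" "AE \<omega> in P. 0 \<le> w \<omega> \<and> w \<omega> \<le> 1" for w :: "'a \<Rightarrow> real"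
  proof -
    have "integrable P w" by (rule integrable_const_bound[of _ 1]) (use that in auto)
    then have "integral\<^sup>L P w \<le> (LINT \<omega>|P. 1)" by (rule integral_mono_AE) (use that(2) in auto)
    then show ?thesis by (simp add: prob_space)
  qed
  then show ?thesis using \<epsilon> by (fastforce simp: D_set_def Linfty_def)
qed

lemma one_in_D_set:
  assumes "prob_space P" "\<epsilon> \<le> 1"
  shows "(\<lambda>\<omega>. 1) \<in> D_set \<epsilon> P"
  using assms const_in_Linfty[of 1 P] by (simp add: D_set_def prob_space.prob_space)

lemma id_in_U2: "(\<lambda>x. x) \<in> U2"
  by (auto simp: U2_def mono_def concave_on_def convex_on_def algebra_simps)

lemma self_in_equivalent_measures: "prob_space P \<Longrightarrow> P \<in> equivalent_measures P"
  by (simp add: equivalent_measures_def absolutely_continuous_def)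

lemma bicontiguous_refl: "bicontiguous P P"
  by (simp add: bicontiguous_def contiguous_def)

lemma NAMFL_imp_NAMFL_uniform:
  fixes P :: "nat \<Rightarrow> 'a measure"
  assumes P: "\<And>n. prob_space (P n)" and N: "NAMFL P F d S"
  shows "NAMFL_uniform P F d S"
  unfolding NAMFL_uniform_def
proof (intro allI impI)
  fix \<epsilon> :: real assume \<epsilon>: "0 < \<epsilon>"
  let ?g = "\<lambda>u R n w. SUP f \<in> C_set (P n) (F n) (d n) (S n). ereal (LINT \<omega>|R n. u (f \<omega> - w \<omega>))"
  show "\<exists>\<delta>>0. \<exists>u\<in>U2. \<exists>R. (\<forall>n. R n \<in> equivalent_measures (P n)) \<and> bicontiguous R P \<and>
    (\<forall>w. (\<forall>n. w n \<in> D_set \<epsilon> (P n)) \<longrightarrow> limsup (\<lambda>n. ?g u R n (w n)) < ereal (u 0 - \<delta>))"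
  proof (cases "\<epsilon> \<le> 1")
    case False
    then have "D_set \<epsilon> (P n) = {}" for n using D_set_empty[OF P] by simp
    then show ?thesis
      using id_in_U2 self_in_equivalent_measures[OF P] bicontiguous_refl
      by (intro exI[of _ "1::real"] conjI bexI[of _ "\<lambda>x. x"] exI[of _ P]) auto
  next
    case True
    define \<Gamma> where "\<Gamma> = {(n, w). w \<in> D_set \<epsilon> (P n)}"
    have "(0, \<lambda>\<omega>. 1) \<in> \<Gamma>" using one_in_D_set[OF P True] by (simp add: \<Gamma>_def)
    then have "directed_set \<Gamma> (\<lambda>_ _. True)" by (auto simp: directed_set_def)
    moreover have "\<forall>\<gamma>\<in>\<Gamma>. snd \<gamma> \<in> D_set \<epsilon> (P (fst \<gamma>))" by (auto simp: \<Gamma>_def)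
    ultimately have "\<exists>u\<in>U2. \<exists>R. (\<forall>n. R n \<in> equivalent_measures (P n)) \<and> bicontiguous R P \<and>
      (\<forall>\<gamma> :: nat \<Rightarrow> nat \<times> ('a \<Rightarrow> real). range \<gamma> \<subseteq> \<Gamma> \<longrightarrow>
        limsup (\<lambda>k. ?g u R (fst (\<gamma> k)) (snd (\<gamma> k))) < ereal (u 0))"
      by (rule N[unfolded NAMFL_def NAMFL_nets_def, THEN spec, THEN mp, OF \<epsilon>, THEN spec, THEN spec, THEN spec,
            THEN spec, THEN mp, THEN mp])
    then obtain u R where u: "u \<in> U2" and R: "\<forall>n. R n \<in> equivalent_measures (P n)" "bicontiguous R P" and
      lim: "\<And>\<gamma>. range \<gamma> \<subseteq> \<Gamma> \<Longrightarrow> limsup (\<lambda>k. ?g u R (fst (\<gamma> k)) (snd (\<gamma> k))) < ereal (u 0)"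
      by blast
    \<comment> \<open>Otherwise a sequence of pairs with suprema above
      \<open>u 0 - 2 / (k + 1)\<close> would have limsup at least \<open>u 0\<close>. Such a
      sequence may revisit or stay in one market, so the bound holds for every \<open>n\<close>. The
      factor 2 leaves room for the strict inequality with \<delta>.\<close>
    have "\<exists>\<delta>>0. \<forall>n. \<forall>w\<in>D_set \<epsilon> (P n). ?g u R n w \<le> ereal (u 0 - 2 * \<delta>)"
    proof (rule ccontr)
      assume neg: "\<not> ?thesis"
      have "\<exists>p. p \<in> \<Gamma> \<and> ereal (u 0 - 2 * (1 / real (Suc k))) < ?g u R (fst p) (snd p)" for k
      proof -
        have "0 < 1 / real (Suc k)" by simp
        with neg obtain n w where "w \<in> D_set \<epsilon> (P n)" "\<not> ?g u R n w \<le> ereal (u 0 - 2 * (1 / real (Suc k)))"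
          by blast
        then show ?thesis by (intro exI[of _ "(n, w)"]) (auto simp: \<Gamma>_def not_le)
      qed
      then have "\<exists>\<gamma>. \<forall>k. \<gamma> k \<in> \<Gamma> \<and> ereal (u 0 - 2 * (1 / real (Suc k))) < ?g u R (fst (\<gamma> k)) (snd (\<gamma> k))"
        by (intro choice allI)
      then obtain \<gamma> where \<gamma>: "\<And>k. \<gamma> k \<in> \<Gamma>"
        "\<And>k. ereal (u 0 - 2 * (1 / real (Suc k))) < ?g u R (fst (\<gamma> k)) (snd (\<gamma> k))" by blast
      have "(\<lambda>k. 1 / real (Suc k)) \<longlonglongrightarrow> 0" by (rule LIMSEQ_Suc[OF lim_const_over_n])
      then have "(\<lambda>k. u 0 - 2 * (1 / real (Suc k))) \<longlonglongrightarrow> u 0 - 2 * 0" by (intro tendsto_intros)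
      then have "(\<lambda>k. ereal (u 0 - 2 * (1 / real (Suc k)))) \<longlonglongrightarrow> ereal (u 0)" by simp
      then have "limsup (\<lambda>k. ereal (u 0 - 2 * (1 / real (Suc k)))) = ereal (u 0)"
        by (intro lim_imp_Limsup) auto
      moreover have "limsup (\<lambda>k. ereal (u 0 - 2 * (1 / real (Suc k)))) \<le> limsup (\<lambda>k. ?g u R (fst (\<gamma> k)) (snd (\<gamma> k)))"
        by (rule Limsup_mono) (use \<gamma>(2) in \<open>auto intro!: always_eventually less_imp_le\<close>)
      ultimately show False using lim[of \<gamma>] \<gamma>(1) by (auto simp: image_subset_iff)
    qed
    then obtain \<delta> where \<delta>: "0 < \<delta>" "\<And>n w. w \<in> D_set \<epsilon> (P n) \<Longrightarrow> ?g u R n w \<le> ereal (u 0 - 2 * \<delta>)" by blast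
    have "limsup (\<lambda>n. ?g u R n (w n)) < ereal (u 0 - \<delta>)" if w: "\<forall>n. w n \<in> D_set \<epsilon> (P n)" for w
    proof -
      have "limsup (\<lambda>n. ?g u R n (w n)) \<le> ereal (u 0 - 2 * \<delta>)"
        by (rule Limsup_bounded) (use \<delta>(2) w in \<open>auto intro!: always_eventually\<close>)
      also have "\<dots> < ereal (u 0 - \<delta>)" using \<delta>(1) by simp
      finally show ?thesis .
    qed
    then show ?thesis using \<delta>(1) u R by blast
  qed
qed

text \<open>One sequence \<open>R\<close> and the identity as utility serve all levels and all nets:
  every claim has mean at most 0 under \<open>R n\<close>, and every \<open>w\<close> has mean at
  least a \<open>c\<close> that depends only on the level.\<close>

lemma NAFL_imp_NAMFL:
  fixes P :: "nat \<Rightarrow> 'a measure"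
  assumes M: "\<And>n. market (P n) (F n) (d n) (S n)" and N: "NAFL P F d S"
  shows "NAMFL P F d S"
proof -
  let ?C = "\<lambda>n. C_set (P n) (F n) (d n) (S n)"
  from NAFL_imp_separating_measures[OF M N] obtain R where
    R: "\<And>n. R n \<in> equivalent_measures (P n)" "bicontiguous R P"
    and int: "\<And>n f. f \<in> Linfty (P n) \<Longrightarrow> integrable (R n) f"
    and sep: "\<And>n f. f \<in> ?C n \<Longrightarrow> integral\<^sup>L (R n) f \<le> 0"
    and low: "\<And>\<epsilon>. 0 < \<epsilon> \<Longrightarrow> \<exists>c>0. \<forall>n. \<forall>w\<in>D_set \<epsilon> (P n). c \<le> integral\<^sup>L (R n) w"
    by blast
  show ?thesis
    unfolding NAMFL_def NAMFL_nets_def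
  proof (intro allI impI bexI[OF _ id_in_U2] exI[of _ R] conjI R)
    fix \<epsilon> :: real and \<Gamma> :: "(nat \<times> ('a \<Rightarrow> real)) set" and le m w and \<gamma> :: "nat \<Rightarrow> nat \<times> ('a \<Rightarrow> real)"
    assume \<epsilon>: "0 < \<epsilon>" and w: "\<forall>\<gamma>\<in>\<Gamma>. w \<gamma> \<in> D_set \<epsilon> (P (m \<gamma>))" and \<gamma>: "range \<gamma> \<subseteq> \<Gamma>"
    from low[OF \<epsilon>] obtain c where c: "0 < c" "\<And>n w. w \<in> D_set \<epsilon> (P n) \<Longrightarrow> c \<le> integral\<^sup>L (R n) w" by blast
    have wk: "w (\<gamma> k) \<in> D_set \<epsilon> (P (m (\<gamma> k)))" for k using w \<gamma> by blast
    have "(SUP f \<in> ?C (m (\<gamma> k)). ereal (LINT \<omega>|R (m (\<gamma> k)). f \<omega> - w (\<gamma> k) \<omega>)) \<le> ereal (- c)" for k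
    proof (rule SUP_least)
      fix f assume f: "f \<in> ?C (m (\<gamma> k))"
      have "f \<in> Linfty (P (m (\<gamma> k)))" "w (\<gamma> k) \<in> Linfty (P (m (\<gamma> k)))"
        using f wk[of k] by (auto simp: C_set_def D_set_def)
      then have "(LINT \<omega>|R (m (\<gamma> k)). f \<omega> - w (\<gamma> k) \<omega>) = integral\<^sup>L (R (m (\<gamma> k))) f - integral\<^sup>L (R (m (\<gamma> k))) (w (\<gamma> k))"
        by (intro Bochner_Integration.integral_diff int)
      also have "\<dots> \<le> - c" using sep[OF f] c(2)[OF wk[of k]] by linarith
      finally show "ereal (LINT \<omega>|R (m (\<gamma> k)). f \<omega> - w (\<gamma> k) \<omega>) \<le> ereal (- c)" by simp
    qed
    then have "limsup (\<lambda>k. SUP f \<in> ?C (m (\<gamma> k)). ereal (LINT \<omega>|R (m (\<gamma> k)). f \<omega> - w (\<gamma> k) \<omega>)) \<le> ereal (- c)"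
      by (intro Limsup_bounded always_eventually allI)
    also have "\<dots> < ereal 0" using c(1) by simp
    finally show "limsup (\<lambda>k. SUP f \<in> ?C (m (\<gamma> k)). ereal (LINT \<omega>|R (m (\<gamma> k)). f \<omega> - w (\<gamma> k) \<omega>)) < ereal 0" .
  qed
qed

section \<open>From the uniform condition to NAFL\<close>

lemma C_set_separating:
  assumes Q: "Q \<in> separating_measures P F d S" and f: "f \<in> C_set P F d S" and int: "integrable Q f"
  shows "integral\<^sup>L Q f \<le> 0"
proof -
  from f obtain g l where g: "g \<in> K_set P F d S" and l: "AE \<omega> in P. 0 \<le> l \<omega>" "AE \<omega> in P. f \<omega> = g \<omega> - l \<omega>"
    by (auto simp: C_set_def)
  from l have "AE \<omega> in P. f \<omega> \<le> g \<omega>" by eventually_elim simp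
  then have "AE \<omega> in Q. f \<omega> \<le> g \<omega>"
    using Q by (intro absolutely_continuous_AE[of Q P]) (auto simp: separating_measures_def)
  then have "integral\<^sup>L Q f \<le> integral\<^sup>L Q g"
    using Q g by (intro integral_mono_AE int) (auto simp: separating_measures_def)
  also have "\<dots> \<le> 0" using Q g by (auto simp: separating_measures_def)
  finally show ?thesis .
qed

lemma Linfty_integrable:
  assumes "prob_space R" "sets R = sets P" "absolutely_continuous P R" "f \<in> Linfty P"
  shows "integrable R f"
proof -
  interpret prob_space R by fact
  from assms(4) obtain c where f: "f \<in> borel_measurable P" and c: "AE \<omega> in P. \<bar>f \<omega>\<bar> \<le> c" by (auto simp: Linfty_def)
  have "f \<in> borel_measurable R" by (subst measurable_cong_sets[OF assms(2) refl]) (rule f)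
  moreover have "AE \<omega> in R. \<bar>f \<omega>\<bar> \<le> c" by (rule absolutely_continuous_AE[OF assms(2,3) c])
  ultimately show ?thesis by (intro integrable_const_bound[of _ c]) auto
qed

text \<open>Permits the exchange of finitely many of the measures.\<close>

lemma contiguous_eventually_cong:
  assumes "\<And>n. n \<ge> (N::nat) \<Longrightarrow> R n = R' n" "\<And>n. sets (R n) = sets (R' n)"
    "\<And>n. n \<ge> N \<Longrightarrow> P n = P' n" "\<And>n. sets (P n) = sets (P' n)" and cont: "contiguous R P"
  shows "contiguous R' P'"
  unfolding contiguous_def
proof (intro allI impI)
  fix A assume A: "\<forall>n. A n \<in> sets (P' n)" "(\<lambda>n. measure (P' n) (A n)) \<longlonglongrightarrow> 0"
  have "\<forall>\<^sub>F n in sequentially. measure (P' n) (A n) = measure (P n) (A n)"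
    using eventually_ge_at_top[of N] by eventually_elim (simp add: assms(3))
  with A(2) have "(\<lambda>n. measure (P n) (A n)) \<longlonglongrightarrow> 0" by (rule Lim_transform_eventually)
  then have "(\<lambda>n. measure (R n) (A n)) \<longlonglongrightarrow> 0"
    by (intro cont[unfolded contiguous_def, rule_format]) (use A(1) assms(4) in auto)
  moreover have "\<forall>\<^sub>F n in sequentially. measure (R n) (A n) = measure (R' n) (A n)"
    using eventually_ge_at_top[of N] by eventually_elim (simp add: assms(1))
  ultimately show "(\<lambda>n. measure (R' n) (A n)) \<longlonglongrightarrow> 0" by (rule Lim_transform_eventually)
qed

text \<open>The hypothesis says nothing about finitely many of the \<open>R n\<close>; these are replaced by equivalent separating
  measures.  The loss function \<open>x \<mapsto> u 0 - u (- x) + x\<close> dominates both the loss of utility and the loss itself.\<close>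

lemma NAMFL_uniform_imp_NAFL:
  fixes P :: "nat \<Rightarrow> 'a measure"
  assumes M: "\<And>n. market (P n) (F n) (d n) (S n)"
    and sep: "\<And>n. separating_measures (P n) (F n) (d n) (S n) \<inter> equivalent_measures (P n) \<noteq> {}"
    and N: "NAMFL_uniform P F d S"
  shows "NAFL P F d S"
  unfolding NAFL_def
proof (intro allI impI)
  let ?C = "\<lambda>n. C_set (P n) (F n) (d n) (S n)"
  have P: "prob_space (P n)" for n using M[of n] by (simp add: market_def)
  fix \<epsilon> :: real assume \<epsilon>: "0 < \<epsilon>"
  show "\<exists>Y. young_function Y \<and> (\<forall>n. ?C n \<inter>
    {\<lambda>\<omega>. w \<omega> + v \<omega> | w v. w \<in> D_set \<epsilon> (P n) \<and> v \<in> orlicz_polar Y (P n)} = {})"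
  proof (cases "\<epsilon> \<le> 1")
    case False
    then have "D_set \<epsilon> (P n) = {}" for n using D_set_empty[OF P] by simp
    moreover obtain Y where "young_function Y"
      using slow_young_function[of 1 "\<lambda>_. 1"] by (auto simp: incseq_def)
    ultimately show ?thesis by auto
  next
    case True
    from N[unfolded NAMFL_uniform_def, THEN spec, THEN mp, OF \<epsilon>] obtain \<delta> u R where \<delta>: "0 < \<delta>" and u: "u \<in> U2"
      and R: "\<And>n. R n \<in> equivalent_measures (P n)" "bicontiguous R P" and
      lim: "\<And>w. \<forall>n. w n \<in> D_set \<epsilon> (P n) \<Longrightarrow>
        limsup (\<lambda>n. SUP f \<in> ?C n. ereal (LINT \<omega>|R n. u (f \<omega> - w n \<omega>))) < ereal (u 0 - \<delta>)"
      by blast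
    let ?g = "\<lambda>n w. SUP f \<in> ?C n. ereal (LINT \<omega>|R n. u (f \<omega> - w \<omega>))"
    have "\<exists>N. \<forall>n\<ge>N. \<forall>w\<in>D_set \<epsilon> (P n). ?g n w < ereal (u 0 - \<delta>)"
    proof -
      \<comment> \<open>A violating member wherever there is one, and the constant 1 elsewhere. The
        limsup bound for this single sequence excludes violations in all late markets, uniformly
        over \<open>w\<close>.\<close>
      define w where "w n = (if \<exists>w\<in>D_set \<epsilon> (P n). \<not> ?g n w < ereal (u 0 - \<delta>)
        then SOME w. w \<in> D_set \<epsilon> (P n) \<and> \<not> ?g n w < ereal (u 0 - \<delta>) else (\<lambda>\<omega>. 1))" for n
      have w: "w n \<in> D_set \<epsilon> (P n) \<and> ((\<exists>w\<in>D_set \<epsilon> (P n). \<not> ?g n w < ereal (u 0 - \<delta>)) \<longrightarrow> \<not> ?g n (w n) < ereal (u 0 - \<delta>))" for n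
      proof (cases "\<exists>w\<in>D_set \<epsilon> (P n). \<not> ?g n w < ereal (u 0 - \<delta>)")
        case bad: True
        then have "\<exists>w. w \<in> D_set \<epsilon> (P n) \<and> \<not> ?g n w < ereal (u 0 - \<delta>)" by blast
        from someI_ex[OF this] show ?thesis unfolding w_def if_P[OF bad] by blast
      next
        case False
        then show ?thesis unfolding w_def if_not_P[OF False] using one_in_D_set[OF P True] by blast
      qed
      have "\<forall>\<^sub>F n in sequentially. ?g n (w n) < ereal (u 0 - \<delta>)"
        by (rule Limsup_lessD[OF lim]) (use w in blast)
      then show ?thesis using w unfolding eventually_sequentially by meson
    qed
    then obtain N where bound: "\<And>n w. N \<le> n \<Longrightarrow> w \<in> D_set \<epsilon> (P n) \<Longrightarrow> ?g n w < ereal (u 0 - \<delta>)" by blast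
    have "\<exists>Q. \<forall>n. Q n \<in> separating_measures (P n) (F n) (d n) (S n) \<inter> equivalent_measures (P n)"
      by (intro choice allI) (use sep in blast)
    then obtain Q where Q: "\<And>n. Q n \<in> separating_measures (P n) (F n) (d n) (S n)" "\<And>n. Q n \<in> equivalent_measures (P n)"
      by blast
    define R' where "R' n = (if n < N then Q n else R n)" for n
    have R': "R' n \<in> equivalent_measures (P n)" for n unfolding R'_def using Q R by simp
    have R'_prob: "\<And>n. prob_space (R' n)" and R'_sets: "\<And>n. sets (R' n) = sets (P n)" and
      R'_ac: "\<And>n. absolutely_continuous (P n) (R' n)" "\<And>n. absolutely_continuous (R' n) (P n)"
      using R' by (auto simp: equivalent_measures_def)
    have R_sets: "sets (R n) = sets (P n)" for n using R(1)[of n] by (simp add: equivalent_measures_def)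
    have R'_cont: "contiguous R' P" "contiguous P R'"
      using R(2) R_sets R'_sets unfolding bicontiguous_def
      by (auto intro: contiguous_eventually_cong[of N R R' P P] contiguous_eventually_cong[of N P P R R'] simp: R'_def)
    from D_set_uniformly_positive[OF P R'_prob R'_sets R'_ac R'_cont(2) \<epsilon>] obtain c where
      c: "0 < c" "\<And>n w. w \<in> D_set \<epsilon> (P n) \<Longrightarrow> c \<le> integral\<^sup>L (R' n) w" by blast
    \<comment> \<open>\<open>\<delta>' \<le> \<delta>\<close> contradicts the utility bound in the
      markets from \<open>N\<close> on; \<open>\<delta>' < c\<close> contradicts the separating
      property in the earlier ones.\<close>
    define \<delta>' where "\<delta>' = min \<delta> (c / 2)"
    have \<delta>': "0 < \<delta>'" "\<delta>' \<le> \<delta>" "\<delta>' < c" using \<delta> c(1) by (auto simp: \<delta>'_def)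
    \<comment> \<open>A finite concave function on the line is continuous; at 0 this makes the loss
      of a small negative part small.\<close>
    have u_mono: "mono u" and "convex_on UNIV (\<lambda>x. - u x)" using u by (auto simp: U2_def concave_on_def)
    then have "continuous_on UNIV (\<lambda>x. - (- u x))"
      by (intro continuous_on_minus convex_on_continuous) auto
    then have u_cont: "isCont u x" for x by (simp add: continuous_on_eq_continuous_at)
    define \<phi> where "\<phi> x = u 0 - u (- x) + x" for x
    have \<phi>_mono: "mono_on {0..} \<phi>"
      unfolding \<phi>_def mono_on_def using monoD[OF u_mono] by (auto intro!: add_mono diff_mono)
    have "((\<lambda>x::real. - x) \<longlongrightarrow> - 0) (at_right 0)" by (intro tendsto_minus tendsto_ident_at)
    then have "((\<lambda>x. u (- x)) \<longlongrightarrow> u (- 0)) (at_right 0)" by (rule isCont_tendsto_compose[OF u_cont])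
    then have "((\<lambda>x. u 0 - u (- x) + x) \<longlongrightarrow> u 0 - u (- 0) + 0) (at_right 0)"
      by (intro tendsto_add tendsto_diff tendsto_const tendsto_ident_at)
    then have \<phi>_lim: "(\<phi> \<longlongrightarrow> 0) (at_right 0)" by (simp add: \<phi>_def[abs_def])
    from orlicz_polar_small_loss[OF P R'_prob R'_sets R'_ac(1) R'_cont(1) \<phi>_mono _ \<phi>_lim \<delta>'(1)] obtain Y where
      Y: "young_function Y" and loss: "\<And>n v. v \<in> orlicz_polar Y (P n) \<Longrightarrow>
        integrable (R' n) (\<lambda>\<omega>. \<phi> (max 0 (- v \<omega>))) \<and> (LINT \<omega>|R' n. \<phi> (max 0 (- v \<omega>))) \<le> \<delta>'"
      by (auto simp: \<phi>_def)
    have False if w: "w \<in> D_set \<epsilon> (P n)" and v: "v \<in> orlicz_polar Y (P n)" and f: "(\<lambda>\<omega>. w \<omega> + v \<omega>) \<in> ?C n" for n w v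
    proof -
      interpret R': prob_space "R' n" by (rule R'_prob)
      note Linfty_R' = Linfty_integrable[OF R'_prob R'_sets R'_ac(1)]
      have wL: "w \<in> Linfty (P n)" and vL: "v \<in> Linfty (P n)" using w v by (auto simp: D_set_def orlicz_polar_def)
      show False
      proof (cases "n < N")
        case True
        \<comment> \<open>Under a separating measure the claim \<open>w + v\<close> has mean at most
          0, whereas \<open>w\<close> contributes at least \<open>c\<close> and \<open>v\<close> at
          least \<open>- \<delta>'\<close>.\<close>
        have "(LINT \<omega>|R' n. w \<omega> + v \<omega>) \<le> 0"
        proof (rule C_set_separating[OF _ f])
          show "R' n \<in> separating_measures (P n) (F n) (d n) (S n)" using Q(1) True by (simp add: R'_def)
          show "integrable (R' n) (\<lambda>\<omega>. w \<omega> + v \<omega>)" using Linfty_R'[OF wL] Linfty_R'[OF vL] by simp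
        qed
        then have "integral\<^sup>L (R' n) w + integral\<^sup>L (R' n) v \<le> 0" using Linfty_R'[OF wL] Linfty_R'[OF vL] by simp
        moreover have "(LINT \<omega>|R' n. - \<phi> (max 0 (- v \<omega>))) \<le> integral\<^sup>L (R' n) v"
        proof (rule integral_mono[OF _ Linfty_R'[OF vL]])
          fix \<omega>
          have "u (- max 0 (- v \<omega>)) \<le> u 0" by (rule monoD[OF u_mono]) simp
          then show "- \<phi> (max 0 (- v \<omega>)) \<le> v \<omega>" by (simp add: \<phi>_def)
        qed (use loss[OF v] in simp)
        then have "- (LINT \<omega>|R' n. \<phi> (max 0 (- v \<omega>))) \<le> integral\<^sup>L (R' n) v" by simp
        ultimately show False using loss[OF v] c(2)[OF w] \<delta>'(3) by linarith
      next
        case False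
        then have RR: "R' n = R n" by (simp add: R'_def)
        \<comment> \<open>The claim \<open>w + v\<close> is itself a competitor in the supremum, and
          subtracting \<open>w\<close> leaves \<open>v\<close>, whose expected utility is at least
          \<open>u 0 - \<delta>'\<close>.\<close>
        have "ereal (LINT \<omega>|R n. u ((w \<omega> + v \<omega>) - w \<omega>)) \<le> ?g n w"
          by (rule SUP_upper2[OF f]) simp
        also have "\<dots> < ereal (u 0 - \<delta>)" using bound[OF _ w] False by simp
        finally have lt: "(LINT \<omega>|R' n. u (v \<omega>)) < u 0 - \<delta>" by (simp add: RR)
        have "(\<lambda>\<omega>. u (v \<omega>)) \<in> Linfty (P n)"
        proof -
          obtain K where [measurable]: "v \<in> borel_measurable (P n)" and K: "AE \<omega> in P n. \<bar>v \<omega>\<bar> \<le> K"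
            using vL by (auto simp: Linfty_def)
          have [measurable]: "u \<in> borel_measurable borel" by (rule borel_measurable_mono[OF u_mono])
          have "AE \<omega> in P n. \<bar>u (v \<omega>)\<bar> \<le> \<bar>u K\<bar> + \<bar>u (- K)\<bar>"
            using K
          proof eventually_elim
            case (elim \<omega>)
            then have "u (- K) \<le> u (v \<omega>)" "u (v \<omega>) \<le> u K" by (auto intro!: monoD[OF u_mono])
            then show ?case by linarith
          qed
          then show ?thesis by (auto simp: Linfty_def)
        qed
        note int_u = Linfty_R'[OF this]
        have "(LINT \<omega>|R' n. u 0 - \<phi> (max 0 (- v \<omega>))) \<le> (LINT \<omega>|R' n. u (v \<omega>))"
        proof (rule integral_mono[OF _ int_u])
          fix \<omega>
          have "u (- max 0 (- v \<omega>)) \<le> u (v \<omega>)" by (rule monoD[OF u_mono]) simp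
          moreover have "0 \<le> max 0 (- v \<omega>)" by simp
          ultimately show "u 0 - \<phi> (max 0 (- v \<omega>)) \<le> u (v \<omega>)" unfolding \<phi>_def by linarith
        qed (use loss[OF v] in simp)
        then have "u 0 - (LINT \<omega>|R' n. \<phi> (max 0 (- v \<omega>))) \<le> (LINT \<omega>|R' n. u (v \<omega>))"
          using loss[OF v] by (simp add: R'.prob_space)
        then show False using lt loss[OF v] \<delta>'(2) by linarith
      qed
    qed
    then show ?thesis using Y by blast
  qed
qed

theorem proposition5p2:
  fixes P :: "nat \<Rightarrow> 'a measure"
    and F :: "nat \<Rightarrow> real \<Rightarrow> 'a measure"
    and d :: "nat \<Rightarrow> nat"
    and S :: "nat \<Rightarrow> nat \<Rightarrow> 'a process"
  assumes "\<And>n. market (P n) (F n) (d n) (S n)"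
    and "\<And>n. separating_measures (P n) (F n) (d n) (S n) \<inter> equivalent_measures (P n) \<noteq> {}"
  shows "(NAMFL P F d S \<longleftrightarrow> NAMFL_uniform P F d S) \<and>
         (NAMFL_uniform P F d S \<longleftrightarrow> NAFL P F d S)"
proof -
  have "prob_space (P n)" for n using assms(1)[of n] by (simp add: market_def)
  then have "NAMFL P F d S \<Longrightarrow> NAMFL_uniform P F d S" by (rule NAMFL_imp_NAMFL_uniform)
  moreover have "NAMFL_uniform P F d S \<Longrightarrow> NAFL P F d S" by (rule NAMFL_uniform_imp_NAFL[OF assms])
  moreover have "NAFL P F d S \<Longrightarrow> NAMFL P F d S" by (rule NAFL_imp_NAMFL[OF assms(1)])
  ultimately show ?thesis by blast
qed

end
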